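(* Let $(G,\mathcal{B},\mathcal{L},\mathcal{F})$ be a quasi-biased graph such that $\mathrm{si}(G)$ is obtained from a complete graph by deleting the edges of a path with at most two edges, and $|V(G)|>3$, and suppose $M=M(G,\mathcal{B},\mathcal{L},\mathcal{F})$ is connected. Then $M$ is not unbreakable if and only if one of the following holds: (i) $V(G)$ has a partition $(V_1,V_2,V_3)$ such that $G[V_i]$ is connected for $i=1,2,3$, there are no edges between $V_1$ and $V_2$, and either $G[V_i]$ contains a cycle in $\mathcal{L}$ for some $i$, or every cycle of $G$ is balanced; (ii) $V(G)$ has a partition $(V_1,V_2)$ such that $G[V_1]$ and $G[V_2]$ are connected and $E[V_1,V_2]$ has a partition into two balancing sets; (iii) $V(G)$ has a partition $(V_1,V_2)$ and there is a balancing set $X\subseteq E(G[V_1])$ such that $G[V_1]\setminus X$ and $G[V_2]$ are both connected; (iii)$'$ $V(G)$ has a partition $(V_1,V_2,V_3)$ and there is a balancing set $X\subseteq E(G[V_1\cup V_3])$ such that $G[V_1]\setminus X$, $G[V_2]$ and $G[V_3]\setminus X$ are connected, $G[V_3]$ contains a cycle in $\mathcal{F}$, and there are no edges between $V_2$ and $V_3$; (iv) $V(G)$ has a partition $(V_1,V_2)$ and there is a balancing set $X\subseteq E(G[V_1])\cup E(G[V_2])$ such that $G[V_i]\setminus X$ is connected for $i=1,2$ and $G[V_i]$ contains a cycle in $\mathcal{L}$ for $i=1,2$; (v) $V(G)$ has a partition $(V_1,V_2,V_3)$ such that $G[V_i]$ is connected for $i=1,2,3$, there are no edges between $V_1$ and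 $V_2$, and $G[V_3]$ contains a cycle in $\mathcal{F}$.
   Context: Graphs are finite with loops and parallel edges allowed; cycles include loops and 2-cycles. A quasi-biased graph $(G,\mathcal{B},\mathcal{L},\mathcal{F})$ is a graph with a partition $(\mathcal{B},\mathcal{L},\mathcal{F})$ of its cycles such that no theta subgraph contains exactly two cycles of $\mathcal{B}$ and every cycle in $\mathcal{L}$ shares a vertex with every cycle in $\mathcal{F}$. Cycles in $\mathcal{B}$ are balanced, others unbalanced. $M(G,\mathcal{B},\mathcal{L},\mathcal{F})$ is the matroid on $E(G)$ whose circuits are: cycles in $\mathcal{B}$; theta subgraphs with no cycle in $\mathcal{B}$; tight handcuffs (two edge-disjoint cycles sharing exactly one vertex) with neither cycle in $\mathcal{B}$; unions of two vertex-disjoint cycles of $\mathcal{L}$; loose handcuffs (two vertex-disjoint cycles plus a minimal path joining them) with both cycles in $\mathcal{F}$. A balancing set is a set $X$ of edges such that $G$ has an unbalanced cycle but $G\setminus X$ has none. $E[V_1,V_2]$ is the set of edges with one end in $V_1$ and the other in $V_2$; $G[W]$ is the induced subgraph; $\mathrm{si}(G)$ is the simplification. A matroid is unbreakable if it is connected and $M/F$ is connected for every flat $F$. *)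

theory Defs
  imports Main
begin

section \<open>Finite graphs with loops and parallel edges\<close>

record ('v, 'e) mgraph =
  verts :: "'v set"
  edges :: "'e set"
  ends  :: "'e \<Rightarrow> 'v set"

text \<open>A loop at \<open>v\<close> has \<open>ends\<close> equal to \<open>{v}\<close>.\<close>

definition finite_graph :: "('v, 'e) mgraph \<Rightarrow> bool" where
  "finite_graph G \<longleftrightarrow> finite (verts G) \<and> finite (edges G) \<and>
     (\<forall>e\<in>edges G. ends G e \<subseteq> verts G \<and> (card (ends G e) = 1 \<or> card (ends G e) = 2))"

definition verts_of :: "('v, 'e) mgraph \<Rightarrow> 'e set \<Rightarrow> 'v set" where
  "verts_of G X = (\<Union>e\<in>X. ends G e)"

definition induced :: "('v, 'e) mgraph \<Rightarrow> 'v set \<Rightarrow> ('v, 'e) mgraph" where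
  "induced G W = \<lparr>verts = verts G \<inter> W, edges = {e \<in> edges G. ends G e \<subseteq> W}, ends = ends G\<rparr>"

definition delete_edges :: "('v, 'e) mgraph \<Rightarrow> 'e set \<Rightarrow> ('v, 'e) mgraph" where
  "delete_edges G X = \<lparr>verts = verts G, edges = edges G - X, ends = ends G\<rparr>"

definition edges_between :: "('v, 'e) mgraph \<Rightarrow> 'v set \<Rightarrow> 'v set \<Rightarrow> 'e set" where
  "edges_between G V1 V2 = {e \<in> edges G. \<exists>u\<in>V1. \<exists>v\<in>V2. ends G e = {u, v}}"

text \<open>
  Paths, cycles, thetas and handcuffs are represented by their edge sets. Such an edge set
  determines the subgraph, except for the paths without edges (where \<open>u = v\<close> and the edge set
  is empty).
\<close>

definition is_path :: "('v, 'e) mgraph \<Rightarrow> 'v \<Rightarrow> 'v \<Rightarrow> 'e set \<Rightarrow> bool" where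
  "is_path G u v P \<longleftrightarrow> (\<exists>vs es.
     length vs = Suc (length es) \<and> hd vs = u \<and> last vs = v \<and> distinct vs \<and>
     set vs \<subseteq> verts G \<and> set es \<subseteq> edges G \<and> set es = P \<and>
     (\<forall>i<length es. ends G (es ! i) = {vs ! i, vs ! Suc i}))"

definition connected_graph :: "('v, 'e) mgraph \<Rightarrow> bool" where
  "connected_graph G \<longleftrightarrow>
     verts G \<noteq> {} \<and> (\<forall>u\<in>verts G. \<forall>v\<in>verts G. \<exists>P. is_path G u v P)"

text \<open>
  The closed sequence of length 1 gives the loops, the one of length 2 (with two distinct edges)
  gives the pairs of parallel edges.
\<close>

definition is_cycle :: "('v, 'e) mgraph \<Rightarrow> 'e set \<Rightarrow> bool" where
  "is_cycle G C \<longleftrightarrow> (\<exists>vs es.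
     es \<noteq> [] \<and> length vs = length es \<and> distinct vs \<and> distinct es \<and>
     set vs \<subseteq> verts G \<and> set es \<subseteq> edges G \<and> set es = C \<and>
     (\<forall>i<length es. ends G (es ! i) = {vs ! i, vs ! (Suc i mod length es)}))"

text \<open>
  The disjointness of \<open>P\<close>, \<open>Q\<close>, \<open>R\<close> as edge sets is only a restriction when two of the paths
  consist of a single edge.
\<close>

definition is_theta :: "('v, 'e) mgraph \<Rightarrow> 'e set \<Rightarrow> bool" where
  "is_theta G T \<longleftrightarrow> (\<exists>u v P Q R.
     u \<noteq> v \<and> is_path G u v P \<and> is_path G u v Q \<and> is_path G u v R \<and>
     P \<inter> Q = {} \<and> P \<inter> R = {} \<and> Q \<inter> R = {} \<and>
     verts_of G P \<inter> verts_of G Q = {u, v} \<and>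
     verts_of G P \<inter> verts_of G R = {u, v} \<and>
     verts_of G Q \<inter> verts_of G R = {u, v} \<and>
     T = P \<union> Q \<union> R)"

definition tight_handcuff :: "('v, 'e) mgraph \<Rightarrow> 'e set \<Rightarrow> 'e set \<Rightarrow> bool" where
  "tight_handcuff G C D \<longleftrightarrow> is_cycle G C \<and> is_cycle G D \<and> C \<inter> D = {} \<and>
     (\<exists>v. verts_of G C \<inter> verts_of G D = {v})"

definition vertex_disjoint_cycles :: "('v, 'e) mgraph \<Rightarrow> 'e set \<Rightarrow> 'e set \<Rightarrow> bool" where
  "vertex_disjoint_cycles G C D \<longleftrightarrow> is_cycle G C \<and> is_cycle G D \<and>
     verts_of G C \<inter> verts_of G D = {}"

text \<open>A joining path is minimal iff it meets each of the two cycles only in its end vertex.\<close>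

definition loose_handcuff :: "('v, 'e) mgraph \<Rightarrow> 'e set \<Rightarrow> 'e set \<Rightarrow> 'e set \<Rightarrow> bool" where
  "loose_handcuff G C D P \<longleftrightarrow> vertex_disjoint_cycles G C D \<and>
     (\<exists>u v. is_path G u v P \<and> verts_of G C \<inter> verts_of G P = {u} \<and>
            verts_of G D \<inter> verts_of G P = {v})"

text \<open>
  In a simple graph we may take the edges to be the two-element vertex sets themselves. In the
  simplification, loops are dropped and each parallel class becomes the pair of its ends.
\<close>

definition complete_graph :: "'v set \<Rightarrow> ('v, 'v set) mgraph" where
  "complete_graph V = \<lparr>verts = V, edges = {{u, v} |u v. u \<in> V \<and> v \<in> V \<and> u \<noteq> v}, ends = id\<rparr>"

definition simplification :: "('v, 'e) mgraph \<Rightarrow> ('v, 'v set) mgraph" where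
  "simplification G =
     \<lparr>verts = verts G, edges = {ends G e |e. e \<in> edges G \<and> card (ends G e) = 2}, ends = id\<rparr>"


section \<open>Matroids given by their circuits\<close>

text \<open>
  A matroid is represented by its ground set and its collection of circuits; the notions below
  are the usual descriptions in terms of circuits. An element \<open>e\<close> outside \<open>X\<close> is in the
  closure of \<open>X\<close> iff \<open>e \<in> C \<subseteq> X \<union> {e}\<close> for a circuit \<open>C\<close>. The circuits of the contraction
  \<open>M/T\<close> are the minimal nonempty sets \<open>C - T\<close> with \<open>C\<close> a circuit.
\<close>

record 'e matroid =
  ground :: "'e set"
  circuits :: "'e set set"

definition closure_of :: "'e matroid \<Rightarrow> 'e set \<Rightarrow> 'e set" where
  "closure_of M X = X \<union> {e \<in> ground M. \<exists>C\<in>circuits M. e \<in> C \<and> C \<subseteq> insert e X}"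

definition is_flat :: "'e matroid \<Rightarrow> 'e set \<Rightarrow> bool" where
  "is_flat M F \<longleftrightarrow> F \<subseteq> ground M \<and> closure_of M F = F"

definition contract :: "'e matroid \<Rightarrow> 'e set \<Rightarrow> 'e matroid" where
  "contract M T = \<lparr>ground = ground M - T,
     circuits = {D. (\<exists>C\<in>circuits M. D = C - T) \<and> D \<noteq> {} \<and>
                    (\<forall>C\<in>circuits M. C - T \<noteq> {} \<and> C - T \<subseteq> D \<longrightarrow> C - T = D)}\<rparr>"

definition connected_matroid :: "'e matroid \<Rightarrow> bool" where
  "connected_matroid M \<longleftrightarrow>
     (\<forall>e\<in>ground M. \<forall>f\<in>ground M. e \<noteq> f \<longrightarrow> (\<exists>C\<in>circuits M. e \<in> C \<and> f \<in> C))"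

definition unbreakable :: "'e matroid \<Rightarrow> bool" where
  "unbreakable M \<longleftrightarrow> connected_matroid M \<and>
     (\<forall>F. is_flat M F \<longrightarrow> connected_matroid (contract M F))"


section \<open>Quasi-biased graphs\<close>

text \<open>The classes of the partition of the cycles may be empty.\<close>

definition quasi_biased_graph ::
  "('v, 'e) mgraph \<Rightarrow> 'e set set \<Rightarrow> 'e set set \<Rightarrow> 'e set set \<Rightarrow> bool" where
  "quasi_biased_graph G \<B> \<L> \<F> \<longleftrightarrow>
     finite_graph G \<and>
     \<B> \<union> \<L> \<union> \<F> = {C. is_cycle G C} \<and> \<B> \<inter> \<L> = {} \<and> \<B> \<inter> \<F> = {} \<and> \<L> \<inter> \<F> = {} \<and>
     (\<forall>T. is_theta G T \<longrightarrow> card {C \<in> \<B>. C \<subseteq> T} \<noteq> 2) \<and>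
     (\<forall>C\<in>\<L>. \<forall>D\<in>\<F>. verts_of G C \<inter> verts_of G D \<noteq> {})"

definition qb_matroid ::
  "('v, 'e) mgraph \<Rightarrow> 'e set set \<Rightarrow> 'e set set \<Rightarrow> 'e set set \<Rightarrow> 'e matroid" where
  "qb_matroid G \<B> \<L> \<F> = \<lparr>ground = edges G, circuits =
     \<B> \<union>
     {T. is_theta G T \<and> (\<forall>C\<in>\<B>. \<not> C \<subseteq> T)} \<union>
     {C \<union> D |C D. tight_handcuff G C D \<and> C \<notin> \<B> \<and> D \<notin> \<B>} \<union>
     {C \<union> D |C D. vertex_disjoint_cycles G C D \<and> C \<in> \<L> \<and> D \<in> \<L>} \<union>
     {C \<union> D \<union> P |C D P. loose_handcuff G C D P \<and> C \<in> \<F> \<and> D \<in> \<F>}\<rparr>"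

definition balancing_set :: "('v, 'e) mgraph \<Rightarrow> 'e set set \<Rightarrow> 'e set \<Rightarrow> bool" where
  "balancing_set G \<B> X \<longleftrightarrow> X \<subseteq> edges G \<and>
     (\<exists>C. is_cycle G C \<and> C \<notin> \<B>) \<and>
     (\<forall>C. is_cycle (delete_edges G X) C \<longrightarrow> C \<in> \<B>)"

definition contains_cycle_in :: "('v, 'e) mgraph \<Rightarrow> 'e set set \<Rightarrow> bool" where
  "contains_cycle_in H \<C> \<longleftrightarrow> (\<exists>C\<in>\<C>. is_cycle H C)"


section \<open>Ordered partitions into two and three parts\<close>

definition partition2 :: "'a set \<Rightarrow> 'a set \<Rightarrow> 'a set \<Rightarrow> bool" where
  "partition2 A A1 A2 \<longleftrightarrow> A1 \<noteq> {} \<and> A2 \<noteq> {} \<and> A1 \<inter> A2 = {} \<and> A1 \<union> A2 = A"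

definition partition3 :: "'a set \<Rightarrow> 'a set \<Rightarrow> 'a set \<Rightarrow> 'a set \<Rightarrow> bool" where
  "partition3 A A1 A2 A3 \<longleftrightarrow> A1 \<noteq> {} \<and> A2 \<noteq> {} \<and> A3 \<noteq> {} \<and>
     A1 \<inter> A2 = {} \<and> A1 \<inter> A3 = {} \<and> A2 \<inter> A3 = {} \<and> A1 \<union> A2 \<union> A3 = A"

end

theory Submission
  imports Defs
begin

text \<open>
  A connected matroid is not unbreakable iff it has a flat \<open>W\<close> of corank two that lies in exactly
  two hyperplanes: a disconnected contraction can be contracted further until it has rank two, and
  then it consists of two parallel classes. The rank of \<open>X\<close> in \<open>M(G, \<B>, \<L>, \<F>)\<close> depends only on
  the components of \<open>(V, X)\<close> and on which of them contain cycles in \<open>\<L>\<close> or \<open>\<F>\<close>. So either \<open>W\<close>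
  has three components and contains a cycle in \<open>\<L>\<close> or \<open>G\<close> is balanced, which is (i); or \<open>W\<close> is
  balanced with two components, and the two hyperplanes give (ii), (iii) or (iv); or \<open>W\<close> has two
  balanced components and further ones with cycles in \<open>\<F>\<close>. In the last case there can be no edge
  between two components of the latter kind, so near completeness of \<open>G\<close> leaves only one of them,
  and (iii)' or (v) results. The circuit elimination axiom is never used: for each \<open>X\<close> and
  \<open>e \<notin> X\<close>, circuits \<open>C\<close> with \<open>e \<in> C \<subseteq> X \<union> {e}\<close> exist iff adding \<open>e\<close> does not raise the rank.
\<close>

section \<open>Paths, cycles and thetas\<close>

text \<open>The numbers of components come from one count. \<open>crk X\<close> is the number of
  components of \<open>X\<close> without cycles in \<F>, plus one unless \<open>lifted X\<close>; so
  \<open>crk E\<close> is 1 if \<open>G\<close> has an unbalanced cycle and 2 otherwise. A flat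
  \<open>W\<close> of corank two has \<open>crk W = crk E + 2\<close>. This means three components
  if \<open>G\<close> is balanced or \<open>W\<close> contains a cycle in \<L>, two if only
  \<open>W\<close> is balanced, and otherwise two components without cycles in \<F>. In the first
  and the last case the vertices fall into three groups. Edges of the three crossing kinds would lie
  in three parallel classes of \<open>M/W\<close>, hence one kind is absent; this is the origin of
  the nonadjacent parts. The balancing sets are built from complements of hyperplanes: a hyperplane
  that connects the parts of a balanced \<open>W\<close> cannot contain an unbalanced cycle, since
  its value would drop to that of \<open>E\<close>. For the converse each alternative supplies a set
  \<open>W0\<close> and two sets that each lower its corank by exactly one and together with
  \<open>W0\<close> cover \<open>E\<close>, so only three values of \<open>crk\<close> have to be
  computed.\<close>

lemma verts_of_simps [simp]:
  "verts_of G {} = {}"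
  "verts_of G (insert e X) = ends G e \<union> verts_of G X"
  "verts_of G (X \<union> Y) = verts_of G X \<union> verts_of G Y"
  by (auto simp: verts_of_def)

lemma verts_of_mono: "X \<subseteq> Y \<Longrightarrow> verts_of G X \<subseteq> verts_of G Y"
  by (auto simp: verts_of_def)

lemma ends_subset_verts_of: "e \<in> X \<Longrightarrow> ends G e \<subseteq> verts_of G X"
  by (auto simp: verts_of_def)

text \<open>Indexed by an edge set instead of a subgraph, so that adding one edge changes nothing
  else. The relation is reflexive on the whole type, also outside \<open>verts G\<close>, which is
  why later statements mention vertices explicitly.\<close>

definition reach :: "('v, 'e) mgraph \<Rightarrow> 'e set \<Rightarrow> ('v \<times> 'v) set" where
  "reach G X = {(u, v). \<exists>e\<in>X. ends G e = {u, v}}\<^sup>*"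

lemma reach_refl [simp]: "(u, u) \<in> reach G X"
  by (simp add: reach_def)

lemma reach_trans: "(u, v) \<in> reach G X \<Longrightarrow> (v, w) \<in> reach G X \<Longrightarrow> (u, w) \<in> reach G X"
  unfolding reach_def by (rule rtrancl_trans)

lemma reach_sym: "(u, v) \<in> reach G X \<Longrightarrow> (v, u) \<in> reach G X"
proof -
  have "sym {(u, v). \<exists>e\<in>X. ends G e = {u, v}}"
    by (auto simp: sym_def insert_commute)
  then show "(u, v) \<in> reach G X \<Longrightarrow> (v, u) \<in> reach G X"
    unfolding reach_def by (meson sym_rtrancl symD)
qed

lemma reach_mono: "X \<subseteq> Y \<Longrightarrow> (u, v) \<in> reach G X \<Longrightarrow> (u, v) \<in> reach G Y"
  unfolding reach_def by (erule rtrancl_mono[THEN subsetD, rotated]) auto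

lemma reach_edge: "e \<in> X \<Longrightarrow> ends G e = {u, v} \<Longrightarrow> (u, v) \<in> reach G X"
  unfolding reach_def by auto

lemma reach_insert:
  assumes "ends G e = {u, v}"
  shows "(x, y) \<in> reach G (insert e X) \<longleftrightarrow> (x, y) \<in> reach G X \<or>
    (x, u) \<in> reach G X \<and> (v, y) \<in> reach G X \<or> (x, v) \<in> reach G X \<and> (u, y) \<in> reach G X"
proof
  let ?r = "{(u, v). \<exists>e\<in>X. ends G e = {u, v}}"
  have eq: "{(x, y). \<exists>e\<in>insert e X. ends G e = {x, y}} = insert (u, v) (insert (v, u) ?r)"
    using assms by (auto simp: doubleton_eq_iff)
  assume "(x, y) \<in> reach G (insert e X)"
  then show "(x, y) \<in> reach G X \<or>
    (x, u) \<in> reach G X \<and> (v, y) \<in> reach G X \<or> (x, v) \<in> reach G X \<and> (u, y) \<in> reach G X"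
    unfolding reach_def eq rtrancl_insert by (auto intro: rtrancl_trans)
next
  have "(u, v) \<in> reach G (insert e X)" "(v, u) \<in> reach G (insert e X)"
    using assms by (auto intro: reach_edge simp: insert_commute)
  moreover have "X \<subseteq> insert e X" by auto
  moreover assume "(x, y) \<in> reach G X \<or>
    (x, u) \<in> reach G X \<and> (v, y) \<in> reach G X \<or> (x, v) \<in> reach G X \<and> (u, y) \<in> reach G X"
  ultimately show "(x, y) \<in> reach G (insert e X)"
    by (meson reach_mono reach_trans)
qed

lemma reach_closed:
  assumes "(u, v) \<in> reach G X" "u \<in> S"
    and "\<And>e x y. e \<in> X \<Longrightarrow> ends G e = {x, y} \<Longrightarrow> x \<in> S \<Longrightarrow> y \<in> S"
  shows "v \<in> S"
  using assms(1) unfolding reach_def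
proof (induction rule: rtrancl_induct)
  case base then show ?case using assms(2) .
next
  case (step y z) then show ?case using assms(3) by blast
qed

lemma reach_restrict:
  assumes "(u, v) \<in> reach G X" "u \<in> S"
    and "\<And>e x y. e \<in> X \<Longrightarrow> ends G e = {x, y} \<Longrightarrow> x \<in> S \<Longrightarrow> y \<in> S"
  shows "(u, v) \<in> reach G {e \<in> X. ends G e \<subseteq> S}"
proof -
  have "v \<in> S \<and> (u, v) \<in> reach G {e \<in> X. ends G e \<subseteq> S}"
    using assms(1) unfolding reach_def
  proof (induction rule: rtrancl_induct)
    case base then show ?case using assms(2) by simp
  next
    case (step y z)
    then obtain e where e: "e \<in> X" "ends G e = {y, z}" by blast
    with step assms(3) have "z \<in> S" by blast
    with step e have "(y, z) \<in> {(u, v). \<exists>e\<in>{e \<in> X. ends G e \<subseteq> S}. ends G e = {u, v}}" by auto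
    with step \<open>z \<in> S\<close> show ?case by (meson rtrancl.rtrancl_into_rtrancl)
  qed
  then show ?thesis by blast
qed

lemma reach_cong: "ends H = ends G \<Longrightarrow> reach H X = reach G X"
  by (simp add: reach_def)

section \<open>Paths: induction, splitting and concatenation\<close>

lemma is_path_Nil: "u \<in> verts G \<Longrightarrow> is_path G u u {}"
  unfolding is_path_def by (intro exI[of _ "[u]"] exI[of _ "[]"]) auto

text \<open>The \<open>insert\<close> is there for the path without edges, whose vertex is not seen
  by \<open>verts_of\<close>. For the same reason the vertex set of a path is written
  \<open>insert u (verts_of G P)\<close> throughout.\<close>

lemma path_list_verts:
  assumes "length vs = Suc (length es)" "\<forall>i<length es. ends G (es ! i) = {vs ! i, vs ! Suc i}"
  shows "set vs = insert (hd vs) (verts_of G (set es))"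
  using assms
proof (induction es arbitrary: vs)
  case Nil
  then show ?case by (cases vs) auto
next
  case (Cons e es)
  then obtain v vs' where vs: "vs = v # vs'" by (cases vs) auto
  have "ends G e = {v, hd vs'}"
    using Cons.prems vs by (cases vs') (force+)
  moreover have "\<forall>i<length es. ends G (es ! i) = {vs' ! i, vs' ! Suc i}"
    using Cons.prems(2) vs by (metis Suc_less_eq length_Cons nth_Cons_Suc)
  ultimately show ?case using Cons.IH[of vs'] Cons.prems vs by auto
qed

lemma is_path_Cons:
  assumes "is_path G w v P" "e \<in> edges G" "ends G e = {u, w}" "u \<in> verts G" "u \<noteq> w"
    "u \<notin> verts_of G P"
  shows "is_path G u v (insert e P)"
proof -
  obtain vs es where *: "length vs = Suc (length es)" "hd vs = w" "last vs = v" "distinct vs"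
     "set vs \<subseteq> verts G" "set es \<subseteq> edges G" "set es = P"
     "\<forall>i<length es. ends G (es ! i) = {vs ! i, vs ! Suc i}"
    using assms(1) unfolding is_path_def by blast
  have "u \<notin> set vs" using path_list_verts[of vs es G] * assms by auto
  moreover have "\<forall>i<length (e # es). ends G ((e # es) ! i) = {(u # vs) ! i, (u # vs) ! Suc i}"
    using * assms by (auto simp: nth_Cons' hd_conv_nth)
      (metis Suc_pred hd_conv_nth length_greater_0_conv list.size(3) nat.distinct(1) not_less_eq)+
  ultimately show ?thesis unfolding is_path_def using * assms
    by (intro exI[of _ "u # vs"] exI[of _ "e # es"]) auto
qed

text \<open>Paths grow at their first vertex. Most later facts about paths use this rule, so that
  the vertex and edge lists of the definition rarely reappear.\<close>

lemma is_path_induct [consumes 1, case_names Nil Cons]: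
  assumes "is_path G u v P"
    and nil: "\<And>u. u \<in> verts G \<Longrightarrow> Q u u {}"
    and cons: "\<And>u w v e P. is_path G w v P \<Longrightarrow> Q w v P \<Longrightarrow> e \<in> edges G \<Longrightarrow> ends G e = {u, w} \<Longrightarrow>
       u \<in> verts G \<Longrightarrow> u \<noteq> w \<Longrightarrow> u \<notin> verts_of G P \<Longrightarrow> Q u v (insert e P)"
  shows "Q u v P"
proof -
  obtain vs es where "length vs = Suc (length es)" "hd vs = u" "last vs = v" "distinct vs"
     "set vs \<subseteq> verts G" "set es \<subseteq> edges G" "set es = P"
     "\<forall>i<length es. ends G (es ! i) = {vs ! i, vs ! Suc i}"
    using assms(1) unfolding is_path_def by blast
  then show ?thesis
  proof (induction es arbitrary: vs u P)
    case Nil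
    then show ?case using nil by (cases vs) auto
  next
    case (Cons e es)
    then obtain x vs' where vs: "vs = x # vs'" by (cases vs) auto
    have len: "length vs' = Suc (length es)" using Cons.prems vs by auto
    then have ne: "vs' \<noteq> []" by auto
    have ends: "\<forall>i<length es. ends G (es ! i) = {vs' ! i, vs' ! Suc i}"
      using Cons.prems(8) vs by (metis Suc_less_eq length_Cons nth_Cons_Suc)
    have e: "ends G e = {u, hd vs'}" using Cons.prems vs ne by (force simp: hd_conv_nth)
    have "last vs' = v" using Cons.prems vs ne by auto
    then have p: "is_path G (hd vs') v (set es)"
      unfolding is_path_def using Cons.prems vs len ends
      by (intro exI[of _ vs'] exI[of _ es]) auto
    have "Q (hd vs') v (set es)"
      using Cons.prems vs len ends ne by (intro Cons.IH[of vs']) auto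
    moreover have "u \<noteq> hd vs'" "u \<notin> verts_of G (set es)"
      using path_list_verts[OF len ends] Cons.prems vs ne by auto
    ultimately show ?case using cons[OF p, of e u] e Cons.prems vs by auto
  qed
qed

lemma is_path_basic:
  assumes "is_path G u v P"
  shows "u \<in> verts G" "v \<in> verts G" "P \<subseteq> edges G" "verts_of G P \<subseteq> verts G"
    "v \<in> insert u (verts_of G P)" "finite P" "(u, v) \<in> reach G P"
    "insert u (verts_of G P) = insert v (verts_of G P)"
    "\<And>x. x \<in> insert u (verts_of G P) \<Longrightarrow> (u, x) \<in> reach G P"
    "\<And>e. e \<in> P \<Longrightarrow> \<exists>a b. a \<noteq> b \<and> ends G e = {a, b}"
proof -
  have "u \<in> verts G \<and> v \<in> verts G \<and> P \<subseteq> edges G \<and> verts_of G P \<subseteq> verts G \<and>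
     insert u (verts_of G P) = insert v (verts_of G P) \<and> finite P \<and>
     (\<forall>x\<in>insert u (verts_of G P). (u, x) \<in> reach G P) \<and>
     (\<forall>e\<in>P. \<exists>a b. a \<noteq> b \<and> ends G e = {a, b})"
    using assms
  proof (induction rule: is_path_induct)
    case (Nil u)
    then show ?case by auto
  next
    case (Cons u w v e P)
    have "(u, x) \<in> reach G (insert e P)" if "x \<in> insert w (verts_of G P)" for x
      using that Cons by (subst reach_insert) auto
    with Cons show ?case by auto
  qed
  then show "u \<in> verts G" "v \<in> verts G" "P \<subseteq> edges G" "verts_of G P \<subseteq> verts G"
    "v \<in> insert u (verts_of G P)" "finite P" "(u, v) \<in> reach G P"
    "insert u (verts_of G P) = insert v (verts_of G P)"
    "\<And>x. x \<in> insert u (verts_of G P) \<Longrightarrow> (u, x) \<in> reach G P"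
    "\<And>e. e \<in> P \<Longrightarrow> \<exists>a b. a \<noteq> b \<and> ends G e = {a, b}"
    by blast+
qed

lemma is_path_append:
  assumes "is_path G u w P" "is_path G w v Q"
    "insert u (verts_of G P) \<inter> insert w (verts_of G Q) = {w}"
  shows "is_path G u v (P \<union> Q)"
  using assms
proof (induction rule: is_path_induct)
  case (Nil u)
  then show ?case by simp
next
  case (Cons u x w e P)
  have wP: "w \<in> insert x (verts_of G P)" using is_path_basic(5)[OF Cons(1)] .
  then have "insert x (verts_of G P) \<inter> insert w (verts_of G Q) = {w}"
    using Cons.prems(2) Cons.hyps by auto
  then have p: "is_path G x v (P \<union> Q)" using Cons by blast
  have "u \<noteq> w" using wP Cons.hyps by auto
  then have "u \<notin> verts_of G (P \<union> Q)" using Cons by auto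
  with p Cons show ?case using is_path_Cons[OF p, of e u] by simp
qed

lemma is_path_edge:
  assumes "e \<in> edges G" "ends G e = {u, v}" "u \<in> verts G" "v \<in> verts G" "u \<noteq> v"
  shows "is_path G u v {e}"
  using is_path_Cons[OF is_path_Nil[of v G], of e u] assms by simp

lemma is_path_sym: "is_path G u v P \<Longrightarrow> is_path G v u P"
proof (induction rule: is_path_induct)
  case (Nil u)
  then show ?case by (rule is_path_Nil)
next
  case (Cons u w v e P)
  have "is_path G w u {e}"
    using Cons is_path_basic(1)[OF Cons(1)] by (intro is_path_edge) auto
  moreover have "insert v (verts_of G P) \<inter> insert w (verts_of G {e}) = {w}"
    using Cons is_path_basic(8)[OF Cons(1)] by auto
  ultimately have "is_path G v u (P \<union> {e})" using is_path_append Cons by metis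
  then show ?case by simp
qed

lemma is_path_split:
  assumes "is_path G u v P" "w \<in> insert u (verts_of G P)"
  obtains P1 P2 where "is_path G u w P1" "is_path G w v P2" "P = P1 \<union> P2"
    "insert u (verts_of G P1) \<inter> insert w (verts_of G P2) = {w}"
proof -
  have "\<exists>P1 P2. is_path G u w P1 \<and> is_path G w v P2 \<and> P = P1 \<union> P2 \<and>
    insert u (verts_of G P1) \<inter> insert w (verts_of G P2) = {w}"
    using assms
  proof (induction rule: is_path_induct)
    case (Nil u)
    then show ?case using is_path_Nil by fastforce
  next
    case (Cons u x v e P)
    have pc: "is_path G u v (insert e P)" by (rule is_path_Cons[OF Cons.hyps])
    show ?case
    proof (cases "w = u")
      case True
      then show ?thesis using pc Cons is_path_Nil[of u G]
        by (intro exI[of _ "{}"] exI[of _ "insert e P"]) auto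
    next
      case False
      with Cons.prems Cons.hyps have "w \<in> insert x (verts_of G P)" by auto
      from Cons.IH[OF this] obtain P1 P2 where *: "is_path G x w P1" "is_path G w v P2" "P = P1 \<union> P2"
        "insert x (verts_of G P1) \<inter> insert w (verts_of G P2) = {w}" by blast
      have "is_path G u w (insert e P1)"
        by (rule is_path_Cons[OF *(1) Cons.hyps(2-5)]) (use *(3) Cons.hyps(6) in auto)
      moreover have "insert e P = insert e P1 \<union> P2" using *(3) by simp
      moreover have "insert u (verts_of G (insert e P1)) \<inter> insert w (verts_of G P2) = {w}"
        using *(3,4) Cons.hyps(3,6) False by auto
      ultimately show ?thesis using *(2) by blast
    qed
  qed
  then show ?thesis using that by blast
qed

lemma is_path_split_edge:
  assumes "is_path G u v P" "e \<in> P"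
  obtains P1 P2 a b where "is_path G u a P1" "is_path G b v P2" "P = insert e (P1 \<union> P2)"
    "ends G e = {a, b}" "insert u (verts_of G P1) \<inter> insert b (verts_of G P2) = {}" "e \<notin> P1" "e \<notin> P2"
proof -
  have "\<exists>P1 P2 a b. is_path G u a P1 \<and> is_path G b v P2 \<and> P = insert e (P1 \<union> P2) \<and>
    ends G e = {a, b} \<and> insert u (verts_of G P1) \<inter> insert b (verts_of G P2) = {}"
    using assms
  proof (induction rule: is_path_induct)
    case (Nil u)
    then show ?case by simp
  next
    case (Cons u x v f P)
    show ?case
    proof (cases "f = e")
      case True
      then show ?thesis using Cons is_path_Nil[of u G]
        by (intro exI[of _ "{}"] exI[of _ P] exI[of _ u] exI[of _ x]) auto
    next
      case False
      with Cons.prems have "e \<in> P" by auto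
      from Cons.IH[OF this] obtain P1 P2 a b where *: "is_path G x a P1" "is_path G b v P2" "P = insert e (P1 \<union> P2)"
        "ends G e = {a, b}" "insert x (verts_of G P1) \<inter> insert b (verts_of G P2) = {}" by blast
      have "is_path G u a (insert f P1)"
        by (rule is_path_Cons[OF *(1) Cons.hyps(2-5)]) (use *(3) Cons.hyps(6) in auto)
      moreover have "insert f P = insert e (insert f P1 \<union> P2)" using *(3) by auto
      moreover have "insert u (verts_of G (insert f P1)) \<inter> insert b (verts_of G P2) = {}"
        using *(3-5) Cons.hyps(3,6) by auto
      ultimately show ?thesis using *(2,4) by blast
    qed
  qed
  then obtain P1 P2 a b where *: "is_path G u a P1" "is_path G b v P2" "P = insert e (P1 \<union> P2)"
    "ends G e = {a, b}" "insert u (verts_of G P1) \<inter> insert b (verts_of G P2) = {}" by blast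
  moreover have "e \<notin> P1" "e \<notin> P2"
    using *(4,5) is_path_basic(5)[OF *(1)] is_path_basic(5)[OF *(2)]
      ends_subset_verts_of[of e P1 G] ends_subset_verts_of[of e P2 G] by auto
  ultimately show ?thesis using that by blast
qed

text \<open>Cuts a path at its first vertex in \<open>S\<close>. Joining paths and ears are trimmed
  with it until they meet a given cycle only at an end.\<close>

lemma is_path_first:
  assumes "is_path G u v P" "S \<inter> insert u (verts_of G P) \<noteq> {}"
  obtains P1 P2 a where "is_path G u a P1" "is_path G a v P2" "P = P1 \<union> P2"
    "insert u (verts_of G P1) \<inter> S = {a}"
    "insert u (verts_of G P1) \<inter> insert a (verts_of G P2) = {a}"
proof -
  have "\<exists>P1 P2 a. is_path G u a P1 \<and> is_path G a v P2 \<and> P = P1 \<union> P2 \<and>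
    insert u (verts_of G P1) \<inter> S = {a} \<and>
    insert u (verts_of G P1) \<inter> insert a (verts_of G P2) = {a}"
    using assms
  proof (induction rule: is_path_induct)
    case (Nil u)
    then show ?case using is_path_Nil[of u G]
      by (intro exI[of _ "{}"] exI[of _ u]) auto
  next
    case (Cons u x v f P)
    have pc: "is_path G u v (insert f P)" by (rule is_path_Cons[OF Cons.hyps])
    show ?case
    proof (cases "u \<in> S")
      case True
      then show ?thesis using pc Cons is_path_Nil[of u G]
        by (intro exI[of _ "{}"] exI[of _ "insert f P"] exI[of _ u]) auto
    next
      case False
      with Cons.prems Cons.hyps have "S \<inter> insert x (verts_of G P) \<noteq> {}" by auto
      from Cons.IH[OF this] obtain P1 P2 a where *: "is_path G x a P1" "is_path G a v P2" "P = P1 \<union> P2"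
        "insert x (verts_of G P1) \<inter> S = {a}"
        "insert x (verts_of G P1) \<inter> insert a (verts_of G P2) = {a}" by blast
      have "is_path G u a (insert f P1)"
        by (rule is_path_Cons[OF *(1) Cons.hyps(2-5)]) (use *(3) Cons.hyps(6) in auto)
      moreover have "insert f P = insert f P1 \<union> P2" using *(3) by simp
      moreover have "a \<in> verts_of G P1 \<union> {x}" "a \<in> S" using *(4) by auto
      then have "u \<notin> insert a (verts_of G P2)" using *(3) Cons.hyps(6) False by auto
      then have "insert u (verts_of G (insert f P1)) \<inter> insert a (verts_of G P2) = {a}"
        using *(5) Cons.hyps(3) by auto
      moreover have "insert u (verts_of G (insert f P1)) \<inter> S = {a}"
        using *(4) Cons.hyps(3) False by auto
      ultimately show ?thesis using *(2) by blast
    qed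
  qed
  then show ?thesis using that by blast
qed

text \<open>The path is built from its end. When the next vertex is already on it, the tail from
  that vertex is kept, so no repetition arises.\<close>

lemma reach_imp_path:
  assumes "(u, v) \<in> reach G X" "v \<in> verts G" "X \<subseteq> edges G" "finite_graph G"
  obtains P where "is_path G u v P" "P \<subseteq> X"
proof -
  have "\<exists>P. is_path G u v P \<and> P \<subseteq> X"
    using assms(1) unfolding reach_def
  proof (induction rule: converse_rtrancl_induct)
    case base
    show ?case using is_path_Nil[OF assms(2)] by auto
  next
    case (step u w)
    then obtain e P where e: "e \<in> X" "ends G e = {u, w}" and P: "is_path G w v P" "P \<subseteq> X" by blast
    have uV: "u \<in> verts G" using e assms(3,4) unfolding finite_graph_def by blast
    show ?case
    proof (cases "u \<in> insert w (verts_of G P)")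
      case True
      obtain P1 P2 where "is_path G u v P2" "P = P1 \<union> P2"
        using is_path_split[OF P(1) True] by metis
      with P(2) show ?thesis by blast
    next
      case False
      then show ?thesis using is_path_Cons[OF P(1), of e u] e P uV assms(3) by blast
    qed
  qed
  then show ?thesis using that by blast
qed

lemma path_loop_empty: "is_path G u u P \<Longrightarrow> P = {}"
proof -
  have "is_path G u v P \<Longrightarrow> u = v \<Longrightarrow> P = {}" for u v P
  proof (induction rule: is_path_induct)
    case (Nil u) show ?case by simp
  next
    case (Cons u w v e P) then show ?case using is_path_basic(5)[OF Cons(1)] by auto
  qed
  then show "is_path G u u P \<Longrightarrow> P = {}" by blast
qed

text \<open>Every edge of a path separates it: the vertices of the first piece are closed under the
  edges of \<open>Z\<close>, since no edge of \<open>P2\<close> touches them.\<close>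

lemma path_edge_bridge:
  assumes "is_path G u a P1" "is_path G b v P2"
    "insert u (verts_of G P1) \<inter> insert b (verts_of G P2) = {}" "Z \<subseteq> P1 \<union> P2"
    "x \<in> insert u (verts_of G P1)" "y \<in> insert b (verts_of G P2)"
  shows "(x, y) \<notin> reach G Z"
proof
  assume "(x, y) \<in> reach G Z"
  then have "y \<in> insert u (verts_of G P1)"
  proof (rule reach_closed[OF _ assms(5)])
    fix e p q assume *: "e \<in> Z" "ends G e = {p, q}" "p \<in> insert u (verts_of G P1)"
    have "e \<notin> P2" using * assms(3) ends_subset_verts_of[of e P2 G] by auto
    then have "e \<in> P1" using * assms(4) by auto
    then show "q \<in> insert u (verts_of G P1)" using ends_subset_verts_of[of e P1 G] * by auto
  qed
  then show False using assms(3,6) by auto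
qed

text \<open>An edge of \<open>Q\<close> missing from \<open>P\<close> would leave \<open>P\<close>
  inside the two pieces of \<open>Q\<close> beside it, and these do not join \<open>u\<close> to
  \<open>v\<close>.\<close>

lemma path_antichain:
  assumes "is_path G u v P" "is_path G u v Q" "P \<subseteq> Q"
  shows "P = Q"
proof (rule ccontr)
  assume "P \<noteq> Q"
  with assms(3) obtain f where f: "f \<in> Q" "f \<notin> P" by blast
  obtain Q1 Q2 a b where *: "is_path G u a Q1" "is_path G b v Q2" "Q = insert f (Q1 \<union> Q2)"
    "ends G f = {a, b}" "insert u (verts_of G Q1) \<inter> insert b (verts_of G Q2) = {}"
    using is_path_split_edge[OF assms(2) f(1)] by metis
  have "(u, v) \<notin> reach G P"
    using * f assms(3) is_path_basic(5)[OF *(2)] by (intro path_edge_bridge[OF *(1,2,5)]) auto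
  then show False using is_path_basic(7)[OF assms(1)] by simp
qed

section \<open>Cycles: opening, splitting and ears\<close>

lemma two_not_in_singleton:
  assumes "T = {x, y}" "x \<noteq> y" "T \<subseteq> A" "T \<subseteq> B" "A \<inter> B = {r}"
  shows False
proof -
  have "{x, y} \<subseteq> {r}" using assms(1,3,4) by (subst assms(5)[symmetric]) blast
  then show False using assms(2) by auto
qed

text \<open>Opening the closed sequence at its last edge leaves a path, which is empty when the
  cycle is a loop. Nearly everything about cycles is reduced to paths this way.\<close>

lemma is_cycle_iff:
  "is_cycle G C \<longleftrightarrow>
    (\<exists>e u v. e \<in> C \<and> e \<in> edges G \<and> ends G e = {u, v} \<and> is_path G u v (C - {e}))"
proof
  assume "is_cycle G C"
  then obtain vs es where *: "es \<noteq> []" "length vs = length es" "distinct vs" "distinct es"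
     "set vs \<subseteq> verts G" "set es \<subseteq> edges G" "set es = C"
     "\<forall>i<length es. ends G (es ! i) = {vs ! i, vs ! (Suc i mod length es)}"
    unfolding is_cycle_def by blast
  let ?n = "length es - 1"
  have n: "?n < length es" "Suc ?n = length es" "vs \<noteq> []" using * by auto
  have "ends G (last es) = {last vs, hd vs}"
    using *(8) n *(1,2) by (metis hd_conv_nth last_conv_nth mod_self)
  then have e: "ends G (last es) = {hd vs, last vs}" by auto
  have app: "es = butlast es @ [last es]" using *(1) by simp
  then have C: "C = insert (last es) (set (butlast es))"
    using *(7) by (metis list.simps(15) rotate1.simps(2) set_rotate1)
  moreover have "last es \<notin> set (butlast es)" using *(4) app
    by (metis distinct_butlast not_distinct_conv_prefix)
  ultimately have C': "C - {last es} = set (butlast es)" by auto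
  have "\<forall>i<length (butlast es). ends G (butlast es ! i) = {vs ! i, vs ! Suc i}"
  proof (intro allI impI)
    fix i assume "i < length (butlast es)"
    then have "i < length es" "Suc i < length es" by auto
    then show "ends G (butlast es ! i) = {vs ! i, vs ! Suc i}"
      using *(8) by (auto simp: nth_butlast)
  qed
  then have "is_path G (hd vs) (last vs) (set (butlast es))"
    unfolding is_path_def using * n
    by (intro exI[of _ vs] exI[of _ "butlast es"]) (auto dest: in_set_butlastD)
  then have "is_path G (hd vs) (last vs) (C - {last es})" using C' by simp
  moreover have "last es \<in> C" "last es \<in> edges G" using C *(6,7) by auto
  ultimately show "\<exists>e u v. e \<in> C \<and> e \<in> edges G \<and> ends G e = {u, v} \<and> is_path G u v (C - {e})"
    using e by blast
next
  assume "\<exists>e u v. e \<in> C \<and> e \<in> edges G \<and> ends G e = {u, v} \<and> is_path G u v (C - {e})"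
  then obtain e u v where e: "e \<in> C" "e \<in> edges G" "ends G e = {u, v}" and
    path: "is_path G u v (C - {e})" by blast
  obtain vs es where *: "length vs = Suc (length es)" "hd vs = u" "last vs = v" "distinct vs"
     "set vs \<subseteq> verts G" "set es \<subseteq> edges G" "set es = C - {e}"
     "\<forall>i<length es. ends G (es ! i) = {vs ! i, vs ! Suc i}"
    using path unfolding is_path_def by (elim exE conjE) (rule that; assumption)
  \<comment> \<open>\<open>is_path\<close> does not demand distinct edges. They follow from the
    distinct vertices, as edges at different positions have different pairs of ends.\<close>
  have "distinct es"
  proof (rule distinct_conv_nth[THEN iffD2], intro allI impI)
    fix i j assume ij: "i < length es" "j < length es" "i \<noteq> j"
    then have "vs ! i \<noteq> vs ! j" "vs ! i \<noteq> vs ! Suc i" "vs ! j \<noteq> vs ! Suc j" "vs ! Suc i \<noteq> vs ! Suc j"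
      using *(1,4) by (auto simp: nth_eq_iff_index_eq)
    moreover have "\<not> (vs ! i = vs ! Suc j \<and> vs ! j = vs ! Suc i)"
      using ij *(1,4) by (auto simp: nth_eq_iff_index_eq)
    ultimately show "es ! i \<noteq> es ! j"
      using *(8) ij by (metis doubleton_eq_iff)
  qed
  moreover have "\<forall>i<length (es @ [e]).
    ends G ((es @ [e]) ! i) = {vs ! i, vs ! (Suc i mod length (es @ [e]))}"
  proof (intro allI impI)
    fix i assume i: "i < length (es @ [e])"
    show "ends G ((es @ [e]) ! i) = {vs ! i, vs ! (Suc i mod length (es @ [e]))}"
    proof (cases "i < length es")
      case True
      then show ?thesis using *(8) by (auto simp: nth_append)
    next
      case False
      with i have i: "i = length es" by simp
      have "vs \<noteq> []" using *(1) by auto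
      then have "vs ! i = v" "vs ! 0 = u" using i *(1-3) by (auto simp: last_conv_nth hd_conv_nth)
      then show ?thesis using i e(3) by (auto simp: nth_append)
    qed
  qed
  ultimately show "is_cycle G C"
    unfolding is_cycle_def using * e
    by (intro exI[of _ "vs"] exI[of _ "es @ [e]"]) auto
qed

lemma cycle_insert_edge:
  "is_path G u v P \<Longrightarrow> e \<in> edges G \<Longrightarrow> ends G e = {u, v} \<Longrightarrow> e \<notin> P \<Longrightarrow> is_cycle G (insert e P)"
  unfolding is_cycle_iff by (intro exI[of _ e] exI[of _ u] exI[of _ v]) auto

text \<open>\<open>is_cycle_iff\<close> opens the cycle at one unspecified edge \<open>f\<close>. To
  open it at another edge \<open>e\<close>, the two pieces of the path beside \<open>e\<close> are
  rejoined through \<open>f\<close>.\<close>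

lemma cycle_remove_edge:
  assumes "is_cycle G C" "e \<in> C"
  obtains u v where "ends G e = {u, v}" "is_path G u v (C - {e})"
proof -
  obtain f x y where f: "f \<in> C" "f \<in> edges G" "ends G f = {x, y}" "is_path G x y (C - {f})"
    using assms(1) unfolding is_cycle_iff by blast
  show ?thesis
  proof (cases "e = f")
    case True
    then show ?thesis using f that by blast
  next
    case False
    then have "e \<in> C - {f}" using assms by auto
    from is_path_split_edge[OF f(4) this] obtain P1 P2 a b where
      *: "is_path G x a P1" "is_path G b y P2" "C - {f} = insert e (P1 \<union> P2)"
      "ends G e = {a, b}" "insert x (verts_of G P1) \<inter> insert b (verts_of G P2) = {}" "e \<notin> P1" "e \<notin> P2"
      by metis
    note P1 = is_path_basic[OF *(1)] and P2 = is_path_basic[OF *(2)]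
    have "x \<noteq> y" using P2(5) *(5) by auto
    then have "is_path G y x {f}"
      using f(2,3) P1(1) P2(2) by (intro is_path_edge) auto
    then have p: "is_path G b x (P2 \<union> {f})"
      by (rule is_path_append[OF *(2)]) (use P2(5) f(3) *(5) in auto)
    have "is_path G b a ((P2 \<union> {f}) \<union> P1)"
      by (rule is_path_append[OF p *(1)]) (use P2(5,8) f(3) *(5) in auto)
    moreover have "(P2 \<union> {f}) \<union> P1 = C - {e}" using f(1) *(3,6,7) False by auto
    ultimately show ?thesis using that[of b a] *(4) by (simp add: insert_commute)
  qed
qed

lemma cycle_basic:
  assumes "is_cycle G C"
  shows "C \<subseteq> edges G" "finite C" "C \<noteq> {}" "verts_of G C \<subseteq> verts G" "verts_of G C \<noteq> {}"
    "\<And>x y. x \<in> verts_of G C \<Longrightarrow> y \<in> verts_of G C \<Longrightarrow> (x, y) \<in> reach G C"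
    "\<And>e u v. e \<in> C \<Longrightarrow> ends G e = {u, v} \<Longrightarrow> (u, v) \<in> reach G (C - {e})"
proof -
  obtain e u v where e: "e \<in> C" "e \<in> edges G" "ends G e = {u, v}" "is_path G u v (C - {e})"
    using assms(1) unfolding is_cycle_iff by blast
  note P = is_path_basic[OF e(4)]
  have C: "C = insert e (C - {e})" using e(1) by auto
  have V: "verts_of G C = insert u (verts_of G (C - {e}))"
    by (subst C, subst verts_of_simps) (use e(3) P(8) in auto)
  show "C \<subseteq> edges G" "finite C" "C \<noteq> {}" "verts_of G C \<subseteq> verts G" "verts_of G C \<noteq> {}"
    using P e V by auto
  show "(x, y) \<in> reach G C" if "x \<in> verts_of G C" "y \<in> verts_of G C" for x y
  proof -
    have "(x, u) \<in> reach G (C - {e})" using P(9)[of x] that V by (simp add: reach_sym)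
    moreover have "(u, y) \<in> reach G (C - {e})" using P(9)[of y] that V by auto
    ultimately have "(x, y) \<in> reach G (C - {e})" by (rule reach_trans)
    then show ?thesis by (rule reach_mono[OF Diff_subset])
  qed
  show "(u, v) \<in> reach G (C - {e})" if e: "e \<in> C" "ends G e = {u, v}" for e u v
  proof -
    obtain a b where ab: "ends G e = {a, b}" "is_path G a b (C - {e})"
      using cycle_remove_edge[OF assms e(1)] .
    then have "a = u \<and> b = v \<or> a = v \<and> b = u" using e(2) by (auto simp: doubleton_eq_iff)
    then show ?thesis using is_path_basic(7)[OF ab(2)] is_path_basic(7)[OF is_path_sym[OF ab(2)]] by auto
  qed
qed

lemma cycle_remove_edge':
  assumes "is_cycle G C" "e \<in> C" "ends G e = {u, v}"
  shows "is_path G u v (C - {e})"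
proof -
  obtain a b where ab: "ends G e = {a, b}" "is_path G a b (C - {e})"
    using cycle_remove_edge[OF assms(1,2)] .
  then have "a = u \<and> b = v \<or> a = v \<and> b = u" using assms(3) by (auto simp: doubleton_eq_iff)
  then show ?thesis using ab(2) is_path_sym[OF ab(2)] by auto
qed

lemma verts_of_cycle:
  assumes "is_cycle G C" "e \<in> C" "ends G e = {u, v}"
  shows "verts_of G C = insert u (verts_of G (C - {e}))"
proof -
  have "C = insert e (C - {e})" using assms(2) by auto
  then have "verts_of G C = {u, v} \<union> verts_of G (C - {e})" using assms(3) verts_of_simps(2) by metis
  then show ?thesis using is_path_basic(8)[OF cycle_remove_edge'[OF assms]] by auto
qed

lemma cycle_edge_ends:
  assumes "is_cycle G C" "e \<in> C" obtains u v where "ends G e = {u, v}"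
  using cycle_remove_edge[OF assms] by metis

lemma cycle_antichain:
  assumes "is_cycle G C" "is_cycle G D" "C \<subseteq> D"
  shows "C = D"
proof -
  obtain e where e: "e \<in> C" using cycle_basic(3)[OF assms(1)] by blast
  obtain u v where uv: "ends G e = {u, v}" using cycle_edge_ends[OF assms(1) e] .
  have "C - {e} = D - {e}"
    using assms e uv by (intro path_antichain[of G u v]) (auto intro: cycle_remove_edge')
  then show ?thesis using e assms(3) by auto
qed

text \<open>An edge of a cycle has its ends joined by the rest of the cycle, while an edge of a path
  separates the path.\<close>

lemma path_no_cycle:
  assumes "is_path G u v P" "is_cycle G C"
  shows "\<not> C \<subseteq> P"
proof
  assume CP: "C \<subseteq> P"
  obtain e where e: "e \<in> C" using cycle_basic(3)[OF assms(2)] by blast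
  then have "e \<in> P" using CP by auto
  from is_path_split_edge[OF assms(1) this] obtain P1 P2 a b where
    *: "is_path G u a P1" "is_path G b v P2" "P = insert e (P1 \<union> P2)"
    "ends G e = {a, b}" "insert u (verts_of G P1) \<inter> insert b (verts_of G P2) = {}" by metis
  have "(a, b) \<notin> reach G (C - {e})"
    by (rule path_edge_bridge[OF *(1,2,5)]) (use *(3) CP is_path_basic(5)[OF *(1)] in auto)
  then show False using cycle_basic(7)[OF assms(2) e *(4)] by simp
qed

text \<open>With an edge \<open>e\<close> removed from \<open>P\<close>, one piece of
  \<open>P\<close>, then \<open>Q\<close>, then the other piece joins the ends of \<open>e\<close>.
  Disjointness of \<open>P\<close> and \<open>Q\<close> excludes that both are the same single
  edge.\<close>

lemma cycle_join:
  assumes "is_path G a b P" "is_path G a b Q" "a \<noteq> b" "P \<inter> Q = {}"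
    "verts_of G P \<inter> verts_of G Q = {a, b}"
  shows "is_cycle G (P \<union> Q)"
proof -
  have "P \<noteq> {}" using is_path_basic(5)[OF assms(1)] assms(3) by auto
  then obtain e where e: "e \<in> P" by auto
  from is_path_split_edge[OF assms(1) this] obtain P1 P2 p q where
    *: "is_path G a p P1" "is_path G q b P2" "P = insert e (P1 \<union> P2)"
    "ends G e = {p, q}" "insert a (verts_of G P1) \<inter> insert q (verts_of G P2) = {}" "e \<notin> P1" "e \<notin> P2"
    by metis
  note P1 = is_path_basic[OF *(1)] and P2 = is_path_basic[OF *(2)]
  have PV: "verts_of G P = insert a (verts_of G P1) \<union> insert q (verts_of G P2)"
    using *(3,4) P1(5,8) P2(5,8) by auto
  have aQ: "a \<in> verts_of G Q" "b \<in> verts_of G Q"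
    using assms(5) by auto
  have p1: "is_path G p b (P1 \<union> Q)"
    by (rule is_path_append[OF is_path_sym[OF *(1)] assms(2)])
      (use P1(5,8) P2(5,8) *(5) assms(5) PV aQ in auto)
  have "is_path G p q ((P1 \<union> Q) \<union> P2)"
    by (rule is_path_append[OF p1 is_path_sym[OF *(2)]])
      (use P1(5,8) P2(5,8) *(5) assms(5) PV aQ in auto)
  then have "is_cycle G (insert e ((P1 \<union> Q) \<union> P2))"
    by (rule cycle_insert_edge) (use e assms(4) * is_path_basic(3)[OF assms(1)] in auto)
  moreover have "insert e ((P1 \<union> Q) \<union> P2) = P \<union> Q" using *(3) by auto
  ultimately show ?thesis by simp
qed

text \<open>The edge \<open>e\<close> names the sides: later arguments keep the side with
  \<open>e\<close> and trade the other one.\<close>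

lemma cycle_split:
  assumes "is_cycle G C" "e \<in> C" "a \<in> verts_of G C" "b \<in> verts_of G C" "a \<noteq> b"
  obtains P1 P2 where "is_path G a b P1" "is_path G a b P2" "C = P1 \<union> P2" "P1 \<inter> P2 = {}"
    "verts_of G P1 \<inter> verts_of G P2 = {a, b}" "e \<in> P2"
proof -
  obtain u v where uv: "ends G e = {u, v}" "is_path G u v (C - {e})"
    using cycle_remove_edge[OF assms(1,2)] .
  have V: "verts_of G C = insert u (verts_of G (C - {e}))"
    using verts_of_cycle[OF assms(1,2) uv(1)] .
  \<comment> \<open>Treats the order in which \<open>b\<close> follows \<open>a\<close> on the path
    \<open>C - {e}\<close> from \<open>u\<close> to \<open>v\<close>: one side is the stretch from
    \<open>a\<close> to \<open>b\<close>, the other runs around through \<open>e\<close>. The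
    opposite order exchanges \<open>a\<close> and \<open>b\<close>.\<close>
  have key: "\<exists>P1 P2. is_path G a b P1 \<and> is_path G a b P2 \<and> C = P1 \<union> P2 \<and> P1 \<inter> P2 = {} \<and>
    verts_of G P1 \<inter> verts_of G P2 = {a, b} \<and> e \<in> P2"
    if ab: "a \<noteq> b" and Q: "is_path G u a Q1" "is_path G a v Q2" "C - {e} = Q1 \<union> Q2"
      "insert u (verts_of G Q1) \<inter> insert a (verts_of G Q2) = {a}" "b \<in> insert a (verts_of G Q2)"
    for a b Q1 Q2
  proof -
    from is_path_split[OF Q(2,5)] obtain R1 R2 where R: "is_path G a b R1" "is_path G b v R2"
      "Q2 = R1 \<union> R2" "insert a (verts_of G R1) \<inter> insert b (verts_of G R2) = {b}" by metis
    note R1 = is_path_basic[OF R(1)] and R2 = is_path_basic[OF R(2)] and Q1 = is_path_basic[OF Q(1)]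
    have b: "b \<notin> insert u (verts_of G Q1)" using ab Q(4,5) by auto
    have aR: "a \<notin> insert b (verts_of G R2)" using ab R(4) by auto
    have vQ2: "verts_of G Q2 = verts_of G R1 \<union> verts_of G R2" using R(3) by simp
    have d: "insert u (verts_of G Q1) \<inter> insert b (verts_of G R2) = {}"
    proof -
      have "insert b (verts_of G R2) \<subseteq> insert a (verts_of G Q2)" using vQ2 Q(5) by auto
      then have "insert u (verts_of G Q1) \<inter> insert b (verts_of G R2) \<subseteq> {a}"
        unfolding Q(4)[symmetric] by (rule Int_mono[OF subset_refl])
      then show ?thesis using aR by auto
    qed
    have "v \<noteq> u" using d R2(5) by auto
    then have "is_path G u v {e}"
      using uv(1) cycle_basic(1)[OF assms(1)] assms(2) Q1(1) R2(2) by (intro is_path_edge) auto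
    then have p1: "is_path G a v (Q1 \<union> {e})"
      by (rule is_path_append[OF is_path_sym[OF Q(1)]])
        (use uv(1) Q1(5,8) R2(5) d in auto)
    have p2: "is_path G a b ((Q1 \<union> {e}) \<union> R2)"
      by (rule is_path_append[OF p1 is_path_sym[OF R(2)]])
        (use uv(1) Q1(5,8) R2(5,8) d in auto)
    have vR1: "a \<in> verts_of G R1" "b \<in> verts_of G R1" using R1(5,8) ab by auto
    have "verts_of G R1 \<inter> insert u (verts_of G Q1) = {a}"
    proof -
      have "insert u (verts_of G Q1) \<inter> verts_of G R1 \<subseteq> {a}"
        unfolding Q(4)[symmetric] using vQ2 by auto
      then show ?thesis using Q1(5) vR1 by auto
    qed
    moreover have "verts_of G R1 \<inter> insert b (verts_of G R2) = {b}" using R(4) vR1 by blast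
    moreover have "verts_of G ((Q1 \<union> {e}) \<union> R2) = insert u (verts_of G Q1) \<union> insert b (verts_of G R2)"
      using uv(1) Q1(8) R2(8) is_path_basic(5)[OF uv(2)] by auto
    ultimately have i: "verts_of G R1 \<inter> verts_of G ((Q1 \<union> {e}) \<union> R2) = {a, b}" by blast
    have "R1 \<inter> ((Q1 \<union> {e}) \<union> R2) = {}"
    proof -
      \<comment> \<open>Edges of a path are not loops, so a common edge would put two vertices into
        an intersection that has only one.\<close>
      have "g \<notin> Q1" "g \<notin> R2" if g: "g \<in> R1" for g
      proof -
        obtain x y where xy: "ends G g = {x, y}" "x \<noteq> y" using R1(10)[OF g] by blast
        have gR: "ends G g \<subseteq> verts_of G R1" using g by (rule ends_subset_verts_of)
        then have "ends G g \<subseteq> insert a (verts_of G Q2)" "ends G g \<subseteq> insert a (verts_of G R1)"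
          using vQ2 by auto
        then show "g \<notin> Q1" "g \<notin> R2"
          using ends_subset_verts_of[of g Q1 G] ends_subset_verts_of[of g R2 G]
            two_not_in_singleton[OF xy _ _ Q(4)] two_not_in_singleton[OF xy _ _ R(4)]
          by blast+
      qed
      then show ?thesis using R(3) Q(3) by auto
    qed
    moreover have "C = R1 \<union> ((Q1 \<union> {e}) \<union> R2)" using Q(3) R(3) assms(2) by auto
    ultimately show ?thesis using R(1) p2 i by blast
  qed
  from is_path_split[OF uv(2), of a] assms(3) V obtain Q1 Q2 where
    Q: "is_path G u a Q1" "is_path G a v Q2" "C - {e} = Q1 \<union> Q2"
      "insert u (verts_of G Q1) \<inter> insert a (verts_of G Q2) = {a}" by metis
  have "\<exists>P1 P2. is_path G a b P1 \<and> is_path G a b P2 \<and> C = P1 \<union> P2 \<and> P1 \<inter> P2 = {} \<and>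
    verts_of G P1 \<inter> verts_of G P2 = {a, b} \<and> e \<in> P2"
  proof (cases "b \<in> insert a (verts_of G Q2)")
    case True
    show ?thesis by (rule key[OF assms(5) Q True])
  next
    case False
    have "verts_of G C = insert u (verts_of G Q1) \<union> insert a (verts_of G Q2)"
      using V Q(3) is_path_basic(5,8)[OF Q(1)] by auto
    then have b: "b \<in> insert u (verts_of G Q1)" using False assms(4) by auto
    from is_path_split[OF Q(1) b] obtain R1 R2 where R: "is_path G u b R1" "is_path G b a R2"
      "Q1 = R1 \<union> R2" "insert u (verts_of G R1) \<inter> insert b (verts_of G R2) = {b}" by metis
    have bv: "is_path G b v (R2 \<union> Q2)"
      by (rule is_path_append[OF R(2) Q(2)]) (use Q(4) R(3) b is_path_basic(5,8)[OF R(2)] in auto)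
    have 1: "C - {e} = R1 \<union> (R2 \<union> Q2)" using Q(3) R(3) by auto
    have "insert a (verts_of G Q2) \<inter> insert u (verts_of G R1) = {}"
    proof -
      have "insert u (verts_of G R1) \<inter> insert a (verts_of G Q2) \<subseteq> {a}"
        unfolding Q(4)[symmetric] using R(3) by auto
      moreover have "a \<notin> insert u (verts_of G R1)"
      proof
        assume "a \<in> insert u (verts_of G R1)"
        then have "a \<in> {b}" unfolding R(4)[symmetric] using is_path_basic(5)[OF R(2)] by blast
        then show False using assms(5) by simp
      qed
      ultimately show ?thesis by auto
    qed
    then have "insert u (verts_of G R1) \<inter> insert b (verts_of G (R2 \<union> Q2)) = {b}"
      using R(4) by auto
    moreover have "a \<in> insert b (verts_of G (R2 \<union> Q2))" using is_path_basic(5)[OF R(2)] by auto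
    ultimately obtain P1 P2 where P: "is_path G b a P1" "is_path G b a P2" "C = P1 \<union> P2" "P1 \<inter> P2 = {}"
      "verts_of G P1 \<inter> verts_of G P2 = {b, a}" "e \<in> P2"
      using key[OF assms(5)[symmetric] R(1) bv 1] by blast
    have "verts_of G P1 \<inter> verts_of G P2 = {a, b}" using P(5) by (simp add: insert_commute)
    then show ?thesis using is_path_sym[OF P(1)] is_path_sym[OF P(2)] P(3,4,6) by blast
  qed
  then show ?thesis using that by blast
qed

text \<open>From \<open>f\<close>, the cycle \<open>D\<close> is followed in both directions until
  it first meets \<open>C\<close>.\<close>

lemma cycle_ear:
  assumes "is_cycle G C" "is_cycle G D" "f \<in> D" "f \<notin> C"
    "p \<in> verts_of G C" "q \<in> verts_of G C" "p \<in> verts_of G D" "q \<in> verts_of G D" "p \<noteq> q"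
  obtains a b R where "a \<noteq> b" "is_path G a b R" "f \<in> R" "R \<subseteq> D - C"
    "verts_of G R \<inter> verts_of G C = {a, b}"
proof -
  let ?S = "verts_of G C"
  obtain x y where xy: "ends G f = {x, y}" "is_path G x y (D - {f})"
    using cycle_remove_edge[OF assms(2,3)] .
  have V: "verts_of G D = insert x (verts_of G (D - {f}))"
    using verts_of_cycle[OF assms(2,3) xy(1)] .
  have "?S \<inter> insert x (verts_of G (D - {f})) \<noteq> {}" using V assms by auto
  from is_path_first[OF xy(2) this] obtain Q1 Q2 a where Q: "is_path G x a Q1" "is_path G a y Q2"
    "D - {f} = Q1 \<union> Q2" "insert x (verts_of G Q1) \<inter> ?S = {a}"
    "insert x (verts_of G Q1) \<inter> insert a (verts_of G Q2) = {a}" by metis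
  note Q1 = is_path_basic[OF Q(1)] and Q2 = is_path_basic[OF Q(2)]
  have aS: "a \<in> ?S" using Q(4) by auto
  have "?S \<inter> insert y (verts_of G Q2) \<noteq> {}" using aS Q2(8) by auto
  from is_path_first[OF is_path_sym[OF Q(2)] this] obtain R1 R2 b where R: "is_path G y b R1" "is_path G b a R2"
    "Q2 = R1 \<union> R2" "insert y (verts_of G R1) \<inter> ?S = {b}"
    "insert y (verts_of G R1) \<inter> insert b (verts_of G R2) = {b}" by metis
  note R1 = is_path_basic[OF R(1)] and R2 = is_path_basic[OF R(2)]
  \<comment> \<open>If both directions met \<open>C\<close> at the same vertex, that vertex would be
    all that \<open>C\<close> and \<open>D\<close> share, against
    \<open>p \<noteq> q\<close>.\<close>
  have ab: "a \<noteq> b"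
  proof
    assume "a = b"
    then have "R2 = {}" using R(2) path_loop_empty[of G b R2] by simp
    then have "insert y (verts_of G Q2) \<inter> ?S = {a}" using R(3,4) \<open>a = b\<close> by auto
    then have "insert a (verts_of G Q2) \<inter> ?S = {a}" using Q2(8) by auto
    moreover have "verts_of G D = insert x (verts_of G Q1) \<union> insert a (verts_of G Q2)"
      using V Q(3) Q1(5,8) by auto
    ultimately have "verts_of G D \<inter> ?S = {a}" using Q(4) by auto
    then have "p = a" "q = a" using assms(5-8) by blast+
    then show False using assms(9) by simp
  qed
  have d: "insert x (verts_of G Q1) \<inter> insert y (verts_of G R1) = {}"
  proof -
    have "insert y (verts_of G R1) \<subseteq> insert a (verts_of G Q2)" using R(3) Q2(8) by auto
    then have "insert x (verts_of G Q1) \<inter> insert y (verts_of G R1) \<subseteq> {a}" using Q(5) by auto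
    moreover have "a \<notin> insert y (verts_of G R1)" using R(4) aS ab by auto
    ultimately show ?thesis by auto
  qed
  then have "x \<noteq> y" by auto
  then have "is_path G x y {f}"
    using xy(1) cycle_basic(1)[OF assms(2)] assms(3) Q1(1) R1(1) by (intro is_path_edge) auto
  then have p1: "is_path G a y (Q1 \<union> {f})"
    by (rule is_path_append[OF is_path_sym[OF Q(1)]]) (use xy(1) Q1(5,8) d in auto)
  have p2: "is_path G a b ((Q1 \<union> {f}) \<union> R1)"
    by (rule is_path_append[OF p1 R(1)]) (use xy(1) Q1(5,8) R1(5,8) d in auto)
  have "verts_of G ((Q1 \<union> {f}) \<union> R1) = insert x (verts_of G Q1) \<union> insert y (verts_of G R1)"
    using xy(1) Q1(8) R1(8) by auto
  then have "verts_of G ((Q1 \<union> {f}) \<union> R1) \<inter> ?S = {a, b}"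
    using Q(4) R(4) by auto
  moreover have "((Q1 \<union> {f}) \<union> R1) \<subseteq> D - C"
  proof -
    have "g \<notin> C" if g: "g \<in> Q1 \<union> R1" for g
    proof
      assume "g \<in> C"
      then have gS: "ends G g \<subseteq> ?S" by (rule ends_subset_verts_of)
      obtain c d where "ends G g = {c, d}" "c \<noteq> d" using g Q1(10) R1(10) by blast
      then show False
        using g gS ends_subset_verts_of[of g Q1 G] ends_subset_verts_of[of g R1 G]
          two_not_in_singleton[OF _ _ _ _ Q(4), of "ends G g" c d]
          two_not_in_singleton[OF _ _ _ _ R(4), of "ends G g" c d] by blast
    qed
    then show ?thesis using Q(3) R(3) assms(3,4) by auto
  qed
  ultimately show ?thesis using that[OF ab p2] by auto
qed

text \<open>The vertices of \<open>P\<close> between a used and an unused edge would be left by \<open>C\<close> through a single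
  edge.\<close>

lemma cycle_contains_path:
  assumes "is_path G u v P" "is_cycle G C" "C \<subseteq> P \<union> Z"
    "verts_of G P \<inter> verts_of G Z \<subseteq> {u, v}" "C \<inter> P \<noteq> {}"
  shows "P \<subseteq> C"
proof (rule ccontr)
  assume "\<not> P \<subseteq> C"
  then obtain f where f: "f \<in> P" "f \<notin> C" by auto
  obtain e where e: "e \<in> C" "e \<in> P" using assms(5) by auto
  have key: False
    if Q: "is_path G u a Q1" "is_path G b v Q2" "P = insert f (Q1 \<union> Q2)"
    "insert u (verts_of G Q1) \<inter> insert b (verts_of G Q2) = {}" and eQ: "e \<in> Q1"
    "verts_of G P \<inter> verts_of G Z \<subseteq> {u, v}" and fab: "ends G f = {a, b}"
    for u v a b Q1 Q2
  proof -
    from is_path_split_edge[OF Q(1) eQ(1)] obtain R1 R2 c d where R: "is_path G u c R1" "is_path G d a R2"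
      "Q1 = insert e (R1 \<union> R2)" "ends G e = {c, d}"
      "insert u (verts_of G R1) \<inter> insert d (verts_of G R2) = {}" by metis
    have c: "c \<in> insert u (verts_of G R1)" and a: "a \<in> insert d (verts_of G R2)"
      and b: "v \<in> insert b (verts_of G Q2)"
      using is_path_basic(5)[OF R(1)] is_path_basic(5)[OF R(2)] is_path_basic(5)[OF Q(2)] .
    have 1: "insert d (verts_of G R2) \<subseteq> verts_of G Q1" using R(3,4) by auto
    then have vS: "v \<notin> insert d (verts_of G R2)" and bS: "insert d (verts_of G R2) \<inter> insert b (verts_of G Q2) = {}"
      using Q(4) b by blast+
    have uS: "u \<notin> insert d (verts_of G R2)" using R(5) by auto
    have "c \<in> insert d (verts_of G R2)"
    proof (rule reach_closed[of d c G "C - {e}"])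
      show "(d, c) \<in> reach G (C - {e})"
        using cycle_basic(7)[OF assms(2) e(1), of d c] R(4) by (simp add: insert_commute)
      show "d \<in> insert d (verts_of G R2)" by simp
      fix g x y assume g: "g \<in> C - {e}" "ends G g = {x, y}" "x \<in> insert d (verts_of G R2)"
      have "x \<in> verts_of G P" using 1 g(3) Q(3) by auto
      then have "g \<notin> Z" using eQ(2) uS vS g(2,3) ends_subset_verts_of[of g Z G] by auto
      then have "g \<in> P" using g(1) assms(3) by auto
      moreover have "g \<notin> Q2" using g bS ends_subset_verts_of[of g Q2 G] by auto
      moreover have "g \<notin> R1" using g R(5) ends_subset_verts_of[of g R1 G] by auto
      ultimately have "g \<in> R2" using Q(3) R(3) g(1) f by auto
      then show "y \<in> insert d (verts_of G R2)" using ends_subset_verts_of[of g R2 G] g(2) by auto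
    qed
    then show False using R(5) c by auto
  qed
  from is_path_split_edge[OF assms(1) f(1)] obtain Q1 Q2 a b where
    Q: "is_path G u a Q1" "is_path G b v Q2" "P = insert f (Q1 \<union> Q2)"
    "ends G f = {a, b}" "insert u (verts_of G Q1) \<inter> insert b (verts_of G Q2) = {}" by metis
  have "e \<noteq> f" using e f by auto
  then consider "e \<in> Q1" | "e \<in> Q2" using e(2) Q(3) by auto
  then show False
  proof cases
    case 1
    show False by (rule key[OF Q(1,2,3,5) 1 assms(4) Q(4)])
  next
    case 2
    have "insert v (verts_of G Q2) \<inter> insert a (verts_of G Q1) = {}"
      using Q(5) is_path_basic(8)[OF Q(1)] is_path_basic(8)[OF Q(2)] by auto
    moreover have "P = insert f (Q2 \<union> Q1)" "ends G f = {b, a}"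
      "verts_of G P \<inter> verts_of G Z \<subseteq> {v, u}" using Q(3,4) assms(4) by auto
    ultimately show False using key[OF is_path_sym[OF Q(2)] is_path_sym[OF Q(1)]] 2 by blast
  qed
qed

section \<open>Theta subgraphs and handcuffs\<close>

locale theta =
  fixes G :: "('v, 'e) mgraph" and u v P Q R
  assumes ne: "u \<noteq> v" and paths: "is_path G u v P" "is_path G u v Q" "is_path G u v R"
    and disj: "P \<inter> Q = {}" "P \<inter> R = {}" "Q \<inter> R = {}"
    and meet: "verts_of G P \<inter> verts_of G Q = {u, v}" "verts_of G P \<inter> verts_of G R = {u, v}"
      "verts_of G Q \<inter> verts_of G R = {u, v}"
begin

lemma is_theta: "is_theta G (P \<union> Q \<union> R)"
  unfolding is_theta_def using ne paths disj meet by blast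

lemma theta_cycles:
  "is_cycle G (P \<union> Q)" "is_cycle G (P \<union> R)" "is_cycle G (Q \<union> R)"
  using cycle_join ne paths disj meet by metis+

text \<open>By \<open>cycle_contains_path\<close> a cycle uses each of the three paths entirely or
  not at all, and it cannot stay inside one of them. Two paths already form a cycle, so the
  antichain property excludes the third.\<close>

lemma theta_cycle_cases:
  assumes "is_cycle G C" "C \<subseteq> P \<union> Q \<union> R"
  shows "C = P \<union> Q \<or> C = P \<union> R \<or> C = Q \<union> R"
proof -
  have P: "P \<subseteq> C" if "C \<inter> P \<noteq> {}"
    by (rule cycle_contains_path[OF paths(1) assms(1) _ _ that, of "Q \<union> R"]) (use assms(2) meet in auto)
  have Q: "Q \<subseteq> C" if "C \<inter> Q \<noteq> {}"
    by (rule cycle_contains_path[OF paths(2) assms(1) _ _ that, of "P \<union> R"]) (use assms(2) meet in auto)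
  have R: "R \<subseteq> C" if "C \<inter> R \<noteq> {}"
    by (rule cycle_contains_path[OF paths(3) assms(1) _ _ that, of "P \<union> Q"]) (use assms(2) meet in auto)
  have PQ: "P \<union> Q = C" if "P \<subseteq> C" "Q \<subseteq> C" using that cycle_antichain[OF theta_cycles(1) assms(1)] by auto
  have PR: "P \<union> R = C" if "P \<subseteq> C" "R \<subseteq> C" using that cycle_antichain[OF theta_cycles(2) assms(1)] by auto
  have QR: "Q \<union> R = C" if "Q \<subseteq> C" "R \<subseteq> C" using that cycle_antichain[OF theta_cycles(3) assms(1)] by auto
  have "\<not> C \<subseteq> P" "\<not> C \<subseteq> Q" "\<not> C \<subseteq> R"
    using path_no_cycle[OF paths(1) assms(1)] path_no_cycle[OF paths(2) assms(1)]
      path_no_cycle[OF paths(3) assms(1)] .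
  moreover have "C \<inter> P = {} \<Longrightarrow> C \<inter> Q = {} \<Longrightarrow> C \<subseteq> R" "C \<inter> P = {} \<Longrightarrow> C \<inter> R = {} \<Longrightarrow> C \<subseteq> Q"
    "C \<inter> Q = {} \<Longrightarrow> C \<inter> R = {} \<Longrightarrow> C \<subseteq> P"
    using assms(2) by auto
  ultimately have "(C \<inter> P \<noteq> {} \<and> C \<inter> Q \<noteq> {}) \<or> (C \<inter> P \<noteq> {} \<and> C \<inter> R \<noteq> {}) \<or> (C \<inter> Q \<noteq> {} \<and> C \<inter> R \<noteq> {})"
    by argo
  moreover have "C \<inter> P \<noteq> {} \<Longrightarrow> C \<inter> Q \<noteq> {} \<Longrightarrow> C = P \<union> Q" using P Q PQ by simp
  moreover have "C \<inter> P \<noteq> {} \<Longrightarrow> C \<inter> R \<noteq> {} \<Longrightarrow> C = P \<union> R" using P R PR by simp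
  moreover have "C \<inter> Q \<noteq> {} \<Longrightarrow> C \<inter> R \<noteq> {} \<Longrightarrow> C = Q \<union> R" using Q R QR by simp
  ultimately show ?thesis by argo
qed

end

lemma is_thetaE:
  assumes "is_theta G T"
  obtains u v P Q R where "theta G u v P Q R" "T = P \<union> Q \<union> R"
  using assms unfolding is_theta_def theta_def by blast

text \<open>Whichever path carries \<open>e\<close>, the other two form a cycle without it. In a
  theta without balanced cycles this supplies the unbalanced cycle that shows \<open>e\<close> to be
  spanned.\<close>

lemma theta_other_cycle:
  assumes "theta G u v P Q R" "e \<in> P \<union> Q \<union> R"
  obtains C D where "is_cycle G C" "is_cycle G D" "e \<in> C" "e \<notin> D" "C \<subseteq> P \<union> Q \<union> R" "D \<subseteq> P \<union> Q \<union> R"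
    "verts_of G C \<inter> verts_of G D \<noteq> {}"
proof -
  interpret theta G u v P Q R by fact
  note c = theta_cycles
  have V: "u \<in> verts_of G P" "u \<in> verts_of G Q" "u \<in> verts_of G R" using meet by auto
  consider "e \<in> P" | "e \<in> Q" | "e \<in> R" using assms(2) by auto
  then show ?thesis
  proof cases
    case 1 then show ?thesis using that[OF c(1,3)] disj V by auto
  next
    case 2 then show ?thesis using that[OF c(1,2)] disj V by auto
  next
    case 3 then show ?thesis using that[OF c(2,1)] disj V by auto
  qed
qed

text \<open>A joining path is trimmed twice, to its first vertex on \<open>D\<close> and then, read
  backwards, to its first vertex on \<open>C\<close>. Its ends differ because the cycles are
  disjoint, so it has edges and \<open>verts_of\<close> sees both ends.\<close>

lemma loose_handcuff_exists:
  assumes "finite_graph G" "vertex_disjoint_cycles G C D" "X \<subseteq> edges G"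
    "x \<in> verts_of G C" "y \<in> verts_of G D" "(x, y) \<in> reach G X"
  obtains P where "P \<subseteq> X" "loose_handcuff G C D P"
proof -
  have cyc: "is_cycle G C" "is_cycle G D" and dj: "verts_of G C \<inter> verts_of G D = {}"
    using assms(2) unfolding vertex_disjoint_cycles_def by auto
  have "y \<in> verts G" using cycle_basic(4)[OF cyc(2)] assms(5) by auto
  then obtain P where P: "is_path G x y P" "P \<subseteq> X"
    using reach_imp_path[OF assms(6) _ assms(3,1)] by metis
  have "verts_of G D \<inter> insert x (verts_of G P) \<noteq> {}" using assms(5) is_path_basic(5)[OF P(1)] by auto
  from is_path_first[OF P(1) this] obtain Q d Q' where Q: "is_path G x d Q" "P = Q \<union> Q'"
    "insert x (verts_of G Q) \<inter> verts_of G D = {d}" by metis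
  have "verts_of G C \<inter> insert d (verts_of G Q) \<noteq> {}"
    using assms(4) is_path_basic(8)[OF Q(1)] by auto
  from is_path_first[OF is_path_sym[OF Q(1)] this] obtain R c R' where R: "is_path G d c R" "Q = R \<union> R'"
    "insert d (verts_of G R) \<inter> verts_of G C = {c}" by metis
  have cd: "d \<in> verts_of G D" "c \<in> verts_of G C" using Q(3) R(3) by auto
  then have ne: "c \<noteq> d" using dj by auto
  then have V: "c \<in> verts_of G R" "d \<in> verts_of G R"
    using is_path_basic(5,8)[OF R(1)] by auto
  have "verts_of G D \<inter> verts_of G R \<subseteq> {d}" unfolding Q(3)[symmetric] using R(2) by auto
  then have 1: "verts_of G D \<inter> verts_of G R = {d}" using V cd by auto
  have "verts_of G C \<inter> verts_of G R \<subseteq> {c}" unfolding R(3)[symmetric] by auto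
  then have 2: "verts_of G C \<inter> verts_of G R = {c}" using V cd by auto
  have "loose_handcuff G C D R"
    unfolding loose_handcuff_def using assms(2) is_path_sym[OF R(1)] 1 2 by blast
  then show ?thesis using that P(2) Q(2) R(2) by blast
qed

text \<open>A common edge would have all its ends at the one shared vertex, hence be a loop, and a
  cycle through a loop is that loop.\<close>

lemma tight_handcuffI:
  assumes "is_cycle G C" "is_cycle G D" "C \<noteq> D" "verts_of G C \<inter> verts_of G D = {x}"
  shows "tight_handcuff G C D"
proof -
  have "e \<notin> D" if e: "e \<in> C" for e
  proof
    assume eD: "e \<in> D"
    obtain u v where uv: "ends G e = {u, v}" using cycle_edge_ends[OF assms(1) e] .
    have "ends G e \<subseteq> verts_of G C \<inter> verts_of G D"
      using ends_subset_verts_of[OF e, of G] ends_subset_verts_of[OF eD, of G] by auto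
    then have "u = v" using uv assms(4) by auto
    then have "C - {e} = {}" "D - {e} = {}"
      using path_loop_empty cycle_remove_edge'[OF assms(1) e uv] cycle_remove_edge'[OF assms(2) eD uv] by metis+
    then show False using e eD assms(3) by auto
  qed
  then show ?thesis unfolding tight_handcuff_def using assms by blast
qed

lemma cycle_through_edge:
  assumes "finite_graph G" "e \<in> edges G" "ends G e = {u, v}" "X \<subseteq> edges G" "e \<notin> X" "(u, v) \<in> reach G X"
  obtains C where "is_cycle G C" "e \<in> C" "C \<subseteq> insert e X"
proof -
  have "v \<in> verts G" using assms(1-3) unfolding finite_graph_def by auto
  then obtain P where "is_path G u v P" "P \<subseteq> X" using reach_imp_path[OF assms(6) _ assms(4,1)] by metis
  then show ?thesis using cycle_insert_edge[of G u v P e] assms(2,3,5) that[of "insert e P"] by blast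
qed

text \<open>With \<open>e\<close> in \<open>P2\<close>, the cycle \<open>P1 \<union> R\<close> of
  the theta avoids \<open>e\<close>, and \<open>P2 \<union> R\<close> is the replacement for
  \<open>C\<close> through \<open>e\<close>. Both exchange inductions below start from this
  configuration.\<close>

lemma ear_theta:
  assumes "is_cycle G C" "is_cycle G D" "f \<in> D" "f \<notin> C" "e \<in> C"
    "p \<in> verts_of G C" "q \<in> verts_of G C" "p \<in> verts_of G D" "q \<in> verts_of G D" "p \<noteq> q"
  obtains a b P1 P2 R where "theta G a b P1 P2 R" "C = P1 \<union> P2" "P1 \<inter> P2 = {}" "e \<in> P2" "R \<subseteq> D - C"
    "a \<in> verts_of G P2" "a \<in> verts_of G R"
proof -
  from cycle_ear[OF assms(1-4,6-10)] obtain a b R where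
    R: "a \<noteq> b" "is_path G a b R" "f \<in> R" "R \<subseteq> D - C" "verts_of G R \<inter> verts_of G C = {a, b}" .
  then have "a \<in> verts_of G C" "b \<in> verts_of G C" by auto
  then obtain P1 P2 where P: "is_path G a b P1" "is_path G a b P2" "C = P1 \<union> P2" "P1 \<inter> P2 = {}"
    "verts_of G P1 \<inter> verts_of G P2 = {a, b}" "e \<in> P2"
    using cycle_split[OF assms(1,5) _ _ R(1)] by metis
  have ab: "{a, b} \<subseteq> verts_of G P1" "{a, b} \<subseteq> verts_of G P2" "{a, b} \<subseteq> verts_of G R"
    using P(5) R(5) by auto
  have RC: "verts_of G R \<inter> verts_of G P1 \<union> verts_of G R \<inter> verts_of G P2 = {a, b}"
    using R(5) P(3) by (simp add: Int_Un_distrib)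
  have th: "theta G a b P1 P2 R"
  proof
    show "P1 \<inter> R = {}" "P2 \<inter> R = {}" using R(4) P(3) by auto
    show "verts_of G P1 \<inter> verts_of G R = {a, b}" "verts_of G P2 \<inter> verts_of G R = {a, b}"
      using RC ab by blast+
  qed (use P R in auto)
  show ?thesis by (rule that[OF th P(3,4,6) R(4)]) (use ab in auto)
qed

section \<open>Spanning in quasi-biased graphs\<close>

locale qbg =
  fixes G :: "('v, 'e) mgraph" and \<B> \<L> \<F>
  assumes qbg: "quasi_biased_graph G \<B> \<L> \<F>"
begin

abbreviation "M \<equiv> qb_matroid G \<B> \<L> \<F>"

lemma finG: "finite_graph G" "finite (verts G)" "finite (edges G)"
  using qbg unfolding quasi_biased_graph_def finite_graph_def by auto

lemma ends_cases:
  assumes "e \<in> edges G" obtains u v where "ends G e = {u, v}" "u \<in> verts G" "v \<in> verts G"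
proof -
  have "ends G e \<subseteq> verts G" "card (ends G e) = 1 \<or> card (ends G e) = 2"
    using assms finG(1) unfolding finite_graph_def by auto
  then obtain u v where "ends G e = {u, v}"
    by (metis card_1_singletonE card_2_iff insert_absorb2)
  then show ?thesis using that \<open>ends G e \<subseteq> verts G\<close> by auto
qed

lemma cycle_class: "is_cycle G C \<longleftrightarrow> C \<in> \<B> \<or> C \<in> \<L> \<or> C \<in> \<F>"
  using qbg unfolding quasi_biased_graph_def by blast

lemma class_disjoint: "C \<in> \<L> \<Longrightarrow> C \<notin> \<B>" "C \<in> \<F> \<Longrightarrow> C \<notin> \<B>" "C \<in> \<L> \<Longrightarrow> C \<notin> \<F>"
  using qbg unfolding quasi_biased_graph_def by auto

lemma LF_meet: "C \<in> \<L> \<Longrightarrow> D \<in> \<F> \<Longrightarrow> verts_of G C \<inter> verts_of G D \<noteq> {}"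
  using qbg unfolding quasi_biased_graph_def by blast

text \<open>The axiom counts all balanced cycles in the theta. By \<open>theta_cycle_cases\<close>
  there are only three candidates, so two balanced ones and an unbalanced third would give exactly
  two.\<close>

lemma theta_balanced:
  assumes "theta G u v P Q R" "P \<union> Q \<in> \<B>" "P \<union> R \<in> \<B>"
  shows "Q \<union> R \<in> \<B>"
proof (rule ccontr)
  assume nb: "Q \<union> R \<notin> \<B>"
  interpret theta G u v P Q R by fact
  have "{C \<in> \<B>. C \<subseteq> P \<union> Q \<union> R} = {P \<union> Q, P \<union> R}"
  proof -
    have "C = P \<union> Q \<or> C = P \<union> R" if "C \<in> \<B>" "C \<subseteq> P \<union> Q \<union> R" for C
      using theta_cycle_cases[OF _ that(2)] that(1) nb cycle_class by blast
    then show ?thesis using assms(2,3) by auto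
  qed
  moreover have "P \<union> Q \<noteq> P \<union> R"
  proof
    assume "P \<union> Q = P \<union> R"
    then have "Q = {}" using disj by auto
    then show False using meet by auto
  qed
  ultimately have "card {C \<in> \<B>. C \<subseteq> P \<union> Q \<union> R} = 2" by simp
  then show False using is_theta qbg unfolding quasi_biased_graph_def by blast
qed

text \<open>Ear exchange between two cycles through \<open>e\<close>, decreasing \<open>C - D\<close>.\<close>

lemma balanced_exchange:
  assumes "C \<in> \<B>" "is_cycle G D" "e \<in> C" "e \<in> D"
    and "\<And>Z. is_cycle G Z \<Longrightarrow> Z \<subseteq> C \<union> D - {e} \<Longrightarrow> Z \<in> \<B>"
  shows "D \<in> \<B>"
  using assms
proof (induction "card (C - D)" arbitrary: C rule: less_induct)
  case less
  have C: "is_cycle G C" using less.prems(1) cycle_class by blast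
  note D = less.prems(2)
  show ?case
  proof (cases "D \<subseteq> C")
    case True
    then show ?thesis using cycle_antichain[OF D C] less.prems(1) by auto
  next
    case False
    then obtain f where f: "f \<in> D" "f \<notin> C" by auto
    obtain p q where pq: "ends G e = {p, q}" using cycle_edge_ends[OF C less.prems(3)] .
    have V: "{p, q} \<subseteq> verts_of G C" "{p, q} \<subseteq> verts_of G D"
      using ends_subset_verts_of[of e _ G] less.prems(3,4) pq by auto
    have "p \<noteq> q"
    proof
      assume "p = q"
      then have "is_path G p p (D - {e})" using cycle_remove_edge'[OF D less.prems(4) pq] by simp
      then show False using path_loop_empty f less.prems(3) by fastforce
    qed
    moreover have "p \<in> verts_of G C" "q \<in> verts_of G C" "p \<in> verts_of G D" "q \<in> verts_of G D"
      using V by auto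
    ultimately obtain a b P1 P2 R where th: "theta G a b P1 P2 R" and
      P: "C = P1 \<union> P2" "P1 \<inter> P2 = {}" "e \<in> P2" "R \<subseteq> D - C"
      using ear_theta[OF C D f less.prems(3), of p q] by metis
    interpret theta G a b P1 P2 R by (rule th)
    have eP1: "e \<notin> P1" "e \<notin> R" using P(2,3,4) less.prems(3) by auto
    \<comment> \<open>This cycle avoids \<open>e\<close> and lies in \<open>C \<union> D\<close>, so
      the hypothesis applies; the theta property then passes balance on from \<open>C\<close> to
      \<open>P2 \<union> R\<close>.\<close>
    have 1: "P1 \<union> R \<in> \<B>"
      by (rule less.prems(5)[OF theta_cycles(2)]) (use P(1) P(4) eP1 in auto)
    have 2: "P2 \<union> R \<in> \<B>"
      using theta_balanced[OF th] 1 P(1) less.prems(1) by auto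
    \<comment> \<open>Ensures progress: dropping \<open>P1\<close> removes an edge outside
      \<open>D\<close>, and \<open>R\<close> adds only edges of \<open>D\<close>.\<close>
    have "\<not> P1 \<subseteq> D"
    proof
      assume "P1 \<subseteq> D"
      then have "P1 \<union> R = D" using cycle_antichain[OF theta_cycles(2) D] P(4) by auto
      then show False using eP1 less.prems(4) by auto
    qed
    then have "P2 \<union> R - D \<subset> C - D" using P(1,2) P(4) by auto
    moreover have "finite (C - D)" using cycle_basic(2)[OF C] by auto
    ultimately have "card (P2 \<union> R - D) < card (C - D)" by (meson psubset_card_mono)
    moreover have "e \<in> P2 \<union> R" using P(3) by simp
    moreover have "Z \<in> \<B>" if "is_cycle G Z" "Z \<subseteq> (P2 \<union> R) \<union> D - {e}" for Z
      by (rule less.prems(5)[OF that(1)]) (use that(2) P(1) P(4) in auto)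
    ultimately show ?thesis using less.hyps[OF _ 2 D _ less.prems(4)] by blast
  qed
qed

section \<open>Circuits and the spanning relation\<close>

lemma circuitI:
  "C \<in> \<B> \<Longrightarrow> C \<in> circuits M"
  "is_theta G T \<Longrightarrow> (\<And>C. C \<in> \<B> \<Longrightarrow> \<not> C \<subseteq> T) \<Longrightarrow> T \<in> circuits M"
  "tight_handcuff G C D \<Longrightarrow> C \<notin> \<B> \<Longrightarrow> D \<notin> \<B> \<Longrightarrow> C \<union> D \<in> circuits M"
  "vertex_disjoint_cycles G C D \<Longrightarrow> C \<in> \<L> \<Longrightarrow> D \<in> \<L> \<Longrightarrow> C \<union> D \<in> circuits M"
  "loose_handcuff G C D P \<Longrightarrow> C \<in> \<F> \<Longrightarrow> D \<in> \<F> \<Longrightarrow> C \<union> D \<union> P \<in> circuits M"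
  unfolding qb_matroid_def by auto

text \<open>Cycles sharing one vertex form a tight handcuff. Otherwise an ear of \<open>D\<close> on
  \<open>C\<close> gives a theta: it is a circuit if no cycle in it is balanced, and a balanced
  \<open>P2 \<union> R\<close> is a circuit itself. If only \<open>P1 \<union> R\<close> is
  balanced, then \<open>P2 \<union> R\<close> is unbalanced and closer to \<open>D\<close>, and it
  takes the place of \<open>C\<close>.\<close>

lemma unbalanced_circuit:
  assumes "is_cycle G C" "C \<notin> \<B>" "is_cycle G D" "D \<notin> \<B>" "e \<in> C" "e \<notin> D"
    "verts_of G C \<inter> verts_of G D \<noteq> {}"
  shows "\<exists>K\<in>circuits M. e \<in> K \<and> K \<subseteq> C \<union> D"
  using assms
proof (induction "card (C - D)" arbitrary: C rule: less_induct)
  case less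
  note C = less.prems(1) and D = less.prems(3)
  obtain a where a: "a \<in> verts_of G C" "a \<in> verts_of G D" using less.prems(7) by auto
  show ?case
  proof (cases "verts_of G C \<inter> verts_of G D = {a}")
    case True
    have "C \<noteq> D" using less.prems(5,6) by auto
    then have "C \<union> D \<in> circuits M"
      using circuitI(3)[OF tight_handcuffI[OF C D _ True]] less.prems(2,4) by auto
    then show ?thesis by (rule bexI[rotated]) (use less.prems(5) in simp)
  next
    case False
    then obtain b where b: "b \<in> verts_of G C" "b \<in> verts_of G D" "a \<noteq> b" using a by auto
    have "\<not> D \<subseteq> C" using cycle_antichain[OF D C] less.prems(5,6) by auto
    then obtain f where f: "f \<in> D" "f \<notin> C" by auto
    obtain a b P1 P2 R where th: "theta G a b P1 P2 R" and P: "C = P1 \<union> P2" "P1 \<inter> P2 = {}" "e \<in> P2"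
      "R \<subseteq> D - C" and ab: "a \<in> verts_of G P2" "a \<in> verts_of G R"
      using ear_theta[OF C D f less.prems(5) a(1) b(1) a(2) b(2,3)] .
    interpret theta G a b P1 P2 R by (rule th)
    have sub: "P1 \<union> P2 \<union> R \<subseteq> C \<union> D" using P(1) P(4) by auto
    consider "P2 \<union> R \<in> \<B>" | "P2 \<union> R \<notin> \<B>" "P1 \<union> R \<notin> \<B>" | "P2 \<union> R \<notin> \<B>" "P1 \<union> R \<in> \<B>" by blast
    then show ?thesis
    proof cases
      case 1
      then show ?thesis using circuitI(1)[OF 1] P(3) sub by auto
    next
      case 2
      have "\<not> Z \<subseteq> P1 \<union> P2 \<union> R" if "Z \<in> \<B>" for Z
        using theta_cycle_cases[of Z] that cycle_class 2 P(1) less.prems(2) by auto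
      then have "P1 \<union> P2 \<union> R \<in> circuits M" using circuitI(2)[OF is_theta] by blast
      then show ?thesis by (rule bexI[rotated]) (use P(3) sub in simp)
    next
      case 3
      have "\<not> P1 \<subseteq> D"
      proof
        assume "P1 \<subseteq> D"
        then have "P1 \<union> R = D" using cycle_antichain[OF theta_cycles(2) D] P(4) by auto
        then show False using 3 less.prems(4) by auto
      qed
      then have "P2 \<union> R - D \<subset> C - D" using P(1,2) P(4) by auto
      moreover have "finite (C - D)" using cycle_basic(2)[OF C] by auto
      ultimately have lt: "card (P2 \<union> R - D) < card (C - D)" by (meson psubset_card_mono)
      have "verts_of G R \<subseteq> verts_of G D" using P(4) by (intro verts_of_mono) auto
      then have "verts_of G (P2 \<union> R) \<inter> verts_of G D \<noteq> {}" using ab by auto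
      then obtain K where "K \<in> circuits M" "e \<in> K" "K \<subseteq> P2 \<union> R \<union> D"
        using less.hyps[OF lt theta_cycles(3) 3(1) D less.prems(4) _ less.prems(6)] P(3) by blast
      then show ?thesis using sub by blast
    qed
  qed
qed

definition hasF :: "'e set \<Rightarrow> 'v \<Rightarrow> bool" where
  "hasF X u \<longleftrightarrow> (\<exists>C\<in>\<F>. C \<subseteq> X \<and> (\<exists>x\<in>verts_of G C. (u, x) \<in> reach G X))"

lemma hasF_reach: "(u, v) \<in> reach G X \<Longrightarrow> hasF X v \<Longrightarrow> hasF X u"
  unfolding hasF_def using reach_trans by metis

text \<open>For \<open>e \<notin> X\<close> this is membership in the closure of \<open>X\<close>,
  phrased without circuits so that it can be compared with a count of components. A cycle in \<L>
  may lie anywhere in \<open>X\<close>, as two disjoint ones form a circuit without a joining path;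
  cycles in \<F> must be reachable from the ends of \<open>e\<close>.\<close>

definition spans :: "'e set \<Rightarrow> 'e \<Rightarrow> bool" where
  "spans X e \<longleftrightarrow> (\<exists>C\<in>\<B>. e \<in> C \<and> C \<subseteq> insert e X) \<or>
     (\<exists>u v. ends G e = {u, v} \<and> ((u, v) \<in> reach G X \<and> (\<exists>C\<in>\<L>. C \<subseteq> X) \<or> hasF X u \<and> hasF X v))"

lemma cycle_avoid_reach:
  assumes "is_cycle G C" "e \<in> C" "C \<subseteq> insert e X" "ends G e = {u, v}" "x \<in> verts_of G C"
  shows "(u, v) \<in> reach G X" "(u, x) \<in> reach G X" "(v, x) \<in> reach G X"
proof -
  note P = cycle_remove_edge'[OF assms(1,2,4)]
  have "(u, x) \<in> reach G (C - {e})"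
    using is_path_basic(9)[OF P] assms(5) verts_of_cycle[OF assms(1,2,4)] by simp
  moreover have "(u, v) \<in> reach G (C - {e})" using is_path_basic(7)[OF P] .
  moreover have "C - {e} \<subseteq> X" using assms(3) by auto
  ultimately show "(u, v) \<in> reach G X" "(u, x) \<in> reach G X" by (auto intro: reach_mono)
  from reach_trans[OF reach_sym[OF this(1)] this(2)] show "(v, x) \<in> reach G X" .
qed

text \<open>The unbalanced cycle \<open>D\<close> lies in \<open>X\<close> and is reached from both
  ends of \<open>e\<close> along \<open>C\<close>; its class decides which clause of
  \<open>spans\<close> applies.\<close>

lemma spans_two_cycles:
  assumes "is_cycle G C" "is_cycle G D" "e \<in> C" "e \<notin> D" "D \<notin> \<B>" "C \<subseteq> insert e X" "D \<subseteq> insert e X"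
    "verts_of G C \<inter> verts_of G D \<noteq> {}"
  shows "spans X e"
proof -
  obtain u v where uv: "ends G e = {u, v}" using cycle_edge_ends[OF assms(1,3)] .
  obtain x where x: "x \<in> verts_of G C" "x \<in> verts_of G D" using assms(8) by auto
  note r = cycle_avoid_reach[OF assms(1,3,6) uv x(1)]
  have DX: "D \<subseteq> X" using assms(4,7) by auto
  show ?thesis
  proof (cases "D \<in> \<F>")
    case True
    then have "hasF X u" "hasF X v" unfolding hasF_def using r DX x(2) by blast+
    then show ?thesis unfolding spans_def using uv by blast
  next
    case False
    then have "D \<in> \<L>" using assms(2,5) cycle_class by blast
    then show ?thesis unfolding spans_def using uv r(1) DX by blast
  qed
qed

lemma circuit_cases:
  assumes "K \<in> circuits M"
  obtains "K \<in> \<B>" | "is_theta G K" "\<And>C. C \<in> \<B> \<Longrightarrow> \<not> C \<subseteq> K"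
  | C D where "K = C \<union> D" "tight_handcuff G C D" "C \<notin> \<B>" "D \<notin> \<B>"
  | C D where "K = C \<union> D" "vertex_disjoint_cycles G C D" "C \<in> \<L>" "D \<in> \<L>"
  | C D P where "K = C \<union> D \<union> P" "loose_handcuff G C D P" "C \<in> \<F>" "D \<in> \<F>"
proof -
  have "K \<in> \<B> \<or> (is_theta G K \<and> (\<forall>C\<in>\<B>. \<not> C \<subseteq> K)) \<or>
    (\<exists>C D. K = C \<union> D \<and> tight_handcuff G C D \<and> C \<notin> \<B> \<and> D \<notin> \<B>) \<or>
    (\<exists>C D. K = C \<union> D \<and> vertex_disjoint_cycles G C D \<and> C \<in> \<L> \<and> D \<in> \<L>) \<or>
    (\<exists>C D P. K = C \<union> D \<union> P \<and> loose_handcuff G C D P \<and> C \<in> \<F> \<and> D \<in> \<F>)"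
    using assms unfolding qb_matroid_def by (simp add: disj_assoc)
  then show ?thesis
  proof (elim disjE exE conjE)
    assume "is_theta G K" "\<forall>C\<in>\<B>. \<not> C \<subseteq> K"
    then show ?thesis by (intro that(2)) auto
  qed (fact that(1) that(3-5))+
qed

lemma loose_handcuff_sym: "loose_handcuff G C D P \<Longrightarrow> loose_handcuff G D C P"
  unfolding loose_handcuff_def vertex_disjoint_cycles_def
  by (auto simp: Int_commute intro: is_path_sym)

text \<open>Both ends of \<open>e\<close> reach \<open>D\<close> along the rest of \<open>C\<close>
  and the joining path. That path avoids \<open>e\<close> because it meets \<open>C\<close> in a
  single vertex and contains no loops.\<close>

lemma spans_handcuff:
  assumes "loose_handcuff G C D P" "C \<in> \<F>" "D \<in> \<F>" "C \<union> D \<union> P \<subseteq> insert e X" "e \<in> C"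
  shows "spans X e"
proof -
  obtain p q where P: "is_path G p q P" "verts_of G C \<inter> verts_of G P = {p}"
      "verts_of G D \<inter> verts_of G P = {q}" and CD: "verts_of G C \<inter> verts_of G D = {}"
      "is_cycle G C" "is_cycle G D"
    using assms(1) unfolding loose_handcuff_def vertex_disjoint_cycles_def by blast
  obtain u v where uv: "ends G e = {u, v}" using cycle_edge_ends[OF CD(2) assms(5)] .
  have eC: "ends G e \<subseteq> verts_of G C" using assms(5) by (rule ends_subset_verts_of)
  have "e \<notin> D" using ends_subset_verts_of[of e D G] eC uv CD(1) by auto
  moreover have "e \<notin> P"
  proof
    assume eP: "e \<in> P"
    obtain x y where xy: "ends G e = {x, y}" "x \<noteq> y" using is_path_basic(10)[OF P(1) eP] by blast
    show False using two_not_in_singleton[OF xy eC ends_subset_verts_of[OF eP] P(2)] .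
  qed
  ultimately have sub: "D \<subseteq> X" "P \<subseteq> X" using assms(4) by auto
  have pq: "p \<in> verts_of G C" "q \<in> verts_of G D" using P by auto
  have "C \<subseteq> insert e X" using assms(4) by auto
  note r = cycle_avoid_reach[OF CD(2) assms(5) this uv pq(1)]
  have "(p, q) \<in> reach G X" using is_path_basic(7)[OF P(1)] sub(2) by (rule reach_mono[rotated])
  then have "(u, q) \<in> reach G X" "(v, q) \<in> reach G X" using r reach_trans by metis+
  then have "hasF X u" "hasF X v" unfolding hasF_def using assms(3) sub(1) pq(2) by blast+
  then show ?thesis unfolding spans_def using uv by blast
qed

lemma circuit_imp_spans:
  assumes "K \<in> circuits M" "e \<in> K" "K \<subseteq> insert e X"
  shows "spans X e"
  using assms(1)
proof (cases rule: circuit_cases)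
  case 1
  then show ?thesis unfolding spans_def using assms by blast
next
  case 2
  then obtain u v P Q R where th: "theta G u v P Q R" "K = P \<union> Q \<union> R" using is_thetaE by metis
  from theta_other_cycle[OF th(1)] assms(2) th(2)
  obtain C D where CD: "is_cycle G C" "is_cycle G D" "e \<in> C" "e \<notin> D" "C \<subseteq> K" "D \<subseteq> K"
    "verts_of G C \<inter> verts_of G D \<noteq> {}" by metis
  have "D \<notin> \<B>" using 2(2)[of D] CD(6) by blast
  then show ?thesis using spans_two_cycles[OF CD(1-4)] CD(5-7) assms(3) by blast
next
  case (3 C D)
  then have CD: "is_cycle G C" "is_cycle G D" "C \<inter> D = {}" "verts_of G C \<inter> verts_of G D \<noteq> {}"
    "C \<subseteq> insert e X" "D \<subseteq> insert e X" "verts_of G D \<inter> verts_of G C \<noteq> {}"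
    using assms(3) unfolding tight_handcuff_def by auto
  have "e \<in> C \<and> e \<notin> D \<or> e \<in> D \<and> e \<notin> C" using assms(2) 3(1) CD(3) by auto
  then show ?thesis
    using spans_two_cycles[OF CD(1,2) _ _ 3(4) CD(5,6,4)] spans_two_cycles[OF CD(2,1) _ _ 3(3) CD(6,5,7)]
    by blast
next
  case (4 C D)
  have key: "spans X e" if h: "vertex_disjoint_cycles G C D" "D \<in> \<L>" "e \<in> C" "C \<union> D \<subseteq> insert e X" for C D
  proof -
    have C: "is_cycle G C" "verts_of G C \<inter> verts_of G D = {}"
      using h(1) unfolding vertex_disjoint_cycles_def by auto
    obtain u v where uv: "ends G e = {u, v}" using cycle_edge_ends[OF C(1) h(3)] .
    have u: "u \<in> verts_of G C" using ends_subset_verts_of[OF h(3), of G] uv by auto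
    have "e \<notin> D" using u C(2) ends_subset_verts_of[of e D G] uv by auto
    then have "D \<subseteq> X" using h(4) by auto
    moreover have "(u, v) \<in> reach G X"
      by (rule cycle_avoid_reach(1)[OF C(1) h(3) _ uv u]) (use h(4) in auto)
    ultimately show ?thesis unfolding spans_def using uv h(2) by blast
  qed
  have "vertex_disjoint_cycles G D C" using 4(2) unfolding vertex_disjoint_cycles_def by auto
  then show ?thesis using key[OF 4(2,4)] key[of D C] 4(1,3) assms(2,3) by auto
next
  case (5 C D P)
  show ?thesis
  proof (cases "e \<in> C \<union> D")
    case True
    then show ?thesis using spans_handcuff[OF 5(2,3,4)] spans_handcuff[OF loose_handcuff_sym[OF 5(2)] 5(4,3)]
      5(1) assms(3) by auto
  next
    case False
    then have eP: "e \<in> P" using 5(1) assms(2) by auto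
    obtain p q where P: "is_path G p q P" "verts_of G C \<inter> verts_of G P = {p}"
      "verts_of G D \<inter> verts_of G P = {q}"
      using 5(2) unfolding loose_handcuff_def by blast
    \<comment> \<open>With \<open>e\<close> on the joining path, its removal leaves each end of
      \<open>e\<close> attached to one of the two cycles.\<close>
    from is_path_split_edge[OF P(1) eP] obtain P1 P2 a b where Q:
      "is_path G p a P1" "is_path G b q P2" "P = insert e (P1 \<union> P2)" "ends G e = {a, b}"
      "e \<notin> P1" "e \<notin> P2" by metis
    have sub: "C \<subseteq> X" "D \<subseteq> X" "P1 \<subseteq> X" "P2 \<subseteq> X" using assms(3) 5(1) False Q(3,5,6) by auto
    have "(a, p) \<in> reach G X" "(b, q) \<in> reach G X"
      using is_path_basic(7)[OF is_path_sym[OF Q(1)]] is_path_basic(7)[OF Q(2)] sub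
      by (auto intro: reach_mono)
    moreover have "p \<in> verts_of G C" "q \<in> verts_of G D" using P by auto
    ultimately have "hasF X a" "hasF X b" unfolding hasF_def using 5(3,4) sub by blast+
    then show ?thesis unfolding spans_def using Q(4) by blast
  qed
qed

text \<open>If the ends of \<open>e\<close> are joined in \<open>X\<close>, then \<open>e\<close>
  closes a cycle \<open>C\<close>. It is balanced, or it meets the given unbalanced cycle, or it is
  disjoint from that cycle and then has the same class, because cycles in \<L> and \<F> always meet.
  If the ends are not joined, \<open>e\<close> lies on the path of a loose handcuff.\<close>

lemma spans_imp_circuit:
  assumes "spans X e" "X \<subseteq> edges G" "e \<in> edges G" "e \<notin> X"
  shows "\<exists>K\<in>circuits M. e \<in> K \<and> K \<subseteq> insert e X"
proof -
  consider C where "C \<in> \<B>" "e \<in> C" "C \<subseteq> insert e X"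
    | u v D where "ends G e = {u, v}" "(u, v) \<in> reach G X" "D \<in> \<L>" "D \<subseteq> X"
    | u v where "ends G e = {u, v}" "hasF X u" "hasF X v"
    using assms(1) unfolding spans_def by blast
  then show ?thesis
  proof cases
    case 1
    then show ?thesis using circuitI(1) by blast
  next
    case 2
    have D: "is_cycle G D" "D \<notin> \<B>" using 2(3) cycle_class class_disjoint by auto
    obtain C where C: "is_cycle G C" "e \<in> C" "C \<subseteq> insert e X"
      using cycle_through_edge[OF finG(1) assms(3) 2(1) assms(2,4) 2(2)] .
    have eD: "e \<notin> D" using 2(4) assms(4) by auto
    consider "C \<in> \<B>" | "C \<notin> \<B>" "verts_of G C \<inter> verts_of G D \<noteq> {}"
      | "C \<notin> \<B>" "verts_of G C \<inter> verts_of G D = {}" by blast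
    then show ?thesis
    proof cases
      case 1 then show ?thesis using circuitI(1) C by blast
    next
      case 22: 2
      show ?thesis using unbalanced_circuit[OF C(1) 22(1) D C(2) eD 22(2)] C(3) 2(4) by blast
    next
      case 3
      then have "C \<notin> \<F>" using LF_meet[OF 2(3), of C] by (auto simp: Int_commute)
      then have "C \<in> \<L>" using 3(1) C(1) cycle_class by blast
      moreover have "vertex_disjoint_cycles G C D" unfolding vertex_disjoint_cycles_def using C D 3 by auto
      ultimately have "C \<union> D \<in> circuits M" using circuitI(4) 2(3) by simp
      then show ?thesis by (rule bexI[rotated]) (use C 2(4) in auto)
    qed
  next
    case 3
    obtain D x where D: "D \<in> \<F>" "D \<subseteq> X" "x \<in> verts_of G D" "(u, x) \<in> reach G X"
      using 3(2) unfolding hasF_def by blast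
    obtain D' x' where D': "D' \<in> \<F>" "D' \<subseteq> X" "x' \<in> verts_of G D'" "(v, x') \<in> reach G X"
      using 3(3) unfolding hasF_def by blast
    have cD: "is_cycle G D" "D \<notin> \<B>" "is_cycle G D'" "D' \<notin> \<B>" using D(1) D'(1) cycle_class class_disjoint by auto
    have eD: "e \<notin> D" "e \<notin> D'" using D(2) D'(2) assms(4) by auto
    have ins: "insert e X \<subseteq> edges G" "X \<subseteq> insert e X" using assms(2,3) by auto
    show ?thesis
    proof (cases "(u, v) \<in> reach G X")
      case True
      obtain C where C: "is_cycle G C" "e \<in> C" "C \<subseteq> insert e X"
        using cycle_through_edge[OF finG(1) assms(3) 3(1) assms(2,4) True] .
      consider "C \<in> \<B>" | "C \<notin> \<B>" "verts_of G C \<inter> verts_of G D \<noteq> {}"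
        | "C \<notin> \<B>" "verts_of G C \<inter> verts_of G D = {}" by blast
      then show ?thesis
      proof cases
        case 1 then show ?thesis using circuitI(1) C by blast
      next
        case 22: 2
        show ?thesis using unbalanced_circuit[OF C(1) 22(1) cD(1,2) C(2) eD(1) 22(2)] C(3) D(2) by blast
      next
        case 33: 3
        then have "C \<notin> \<L>" using LF_meet[OF _ D(1)] by blast
        then have CF: "C \<in> \<F>" using 33(1) C(1) cycle_class by blast
        have vd: "vertex_disjoint_cycles G C D" unfolding vertex_disjoint_cycles_def using C cD 33 by auto
        have u: "u \<in> verts_of G C" using ends_subset_verts_of[OF C(2), of G] 3(1) by auto
        obtain P where P: "P \<subseteq> insert e X" "loose_handcuff G C D P"
          using loose_handcuff_exists[OF finG(1) vd ins(1) u D(3) reach_mono[OF ins(2) D(4)]] .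
        then have "C \<union> D \<union> P \<in> circuits M" using circuitI(5) CF D(1) by simp
        moreover have "e \<in> C \<union> D \<union> P" "C \<union> D \<union> P \<subseteq> insert e X" using C P D(2) by auto
        ultimately show ?thesis by (intro bexI[of _ "C \<union> D \<union> P"] conjI)
      qed
    next
      case False
      \<comment> \<open>Meeting cycles would join the ends of \<open>e\<close> within
        \<open>X\<close>. For the same reason the joining path found below cannot avoid
        \<open>e\<close>.\<close>
      have "verts_of G D \<inter> verts_of G D' = {}"
      proof (rule ccontr)
        assume "verts_of G D \<inter> verts_of G D' \<noteq> {}"
        then obtain z where z: "z \<in> verts_of G D" "z \<in> verts_of G D'" by auto
        have "(x, z) \<in> reach G X" "(z, x') \<in> reach G X"
          using reach_mono[OF D(2) cycle_basic(6)[OF cD(1) D(3) z(1)]]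
            reach_mono[OF D'(2) cycle_basic(6)[OF cD(3) z(2) D'(3)]] .
        then have "(u, x') \<in> reach G X" using D(4) reach_trans by metis
        then show False using False reach_trans[OF _ reach_sym[OF D'(4)]] by blast
      qed
      then have vd: "vertex_disjoint_cycles G D D'" unfolding vertex_disjoint_cycles_def using cD by auto
      have r: "(x, x') \<in> reach G (insert e X)"
        using reach_trans[OF reach_trans[OF reach_mono[OF ins(2) reach_sym[OF D(4)]]
          reach_edge[of e "insert e X" G u v]] reach_mono[OF ins(2) D'(4)]] 3(1) by simp
      obtain P where P: "P \<subseteq> insert e X" "loose_handcuff G D D' P"
        using loose_handcuff_exists[OF finG(1) vd ins(1) D(3) D'(3) r] .
      have K: "D \<union> D' \<union> P \<in> circuits M" using circuitI(5) P D(1) D'(1) by simp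
      have "e \<in> P"
      proof (rule ccontr)
        assume "e \<notin> P"
        then have PX: "P \<subseteq> X" using P by auto
        obtain p q where pq: "is_path G p q P" "verts_of G D \<inter> verts_of G P = {p}"
          "verts_of G D' \<inter> verts_of G P = {q}" using P(2) unfolding loose_handcuff_def by blast
        then have V: "p \<in> verts_of G D" "q \<in> verts_of G D'" by auto
        have "(x, p) \<in> reach G X" "(p, q) \<in> reach G X" "(q, x') \<in> reach G X"
          using reach_mono[OF D(2) cycle_basic(6)[OF cD(1) D(3) V(1)]]
            reach_mono[OF PX is_path_basic(7)[OF pq(1)]]
            reach_mono[OF D'(2) cycle_basic(6)[OF cD(3) V(2) D'(3)]] .
        then have "(u, x') \<in> reach G X" using D(4) reach_trans by metis
        then show False using False reach_trans[OF _ reach_sym[OF D'(4)]] by blast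
      qed
      moreover have "D \<union> D' \<union> P \<subseteq> insert e X" using D D' P by auto
      ultimately show ?thesis using K by (intro bexI[of _ "D \<union> D' \<union> P"] conjI) auto
    qed
  qed
qed

end

section \<open>Corank\<close>

context qbg
begin

definition comp :: "'e set \<Rightarrow> 'v \<Rightarrow> 'v set" where
  "comp X v = {w. (v, w) \<in> reach G X}"

definition nonF :: "'e set \<Rightarrow> 'v set set" where
  "nonF X = comp X ` {v \<in> verts G. \<not> hasF X v}"

text \<open>A cycle in \<L> raises the rank once for the whole set, not once per component. When a
  cycle in \<F> is present too, all these cycles share a component by \<open>LF_meet\<close>; that
  component is already left out of \<open>nonF\<close>, and the gain must not be counted
  twice.\<close>

definition lifted :: "'e set \<Rightarrow> bool" where
  "lifted X \<longleftrightarrow> (\<exists>C\<in>\<L>. C \<subseteq> X) \<and> \<not> (\<exists>C\<in>\<F>. C \<subseteq> X)"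

text \<open>Equal to \<open>card (verts G) + 1\<close> minus the rank of \<open>X\<close>; see \<open>crk_insert\<close>.\<close>

definition crk :: "'e set \<Rightarrow> nat" where
  "crk X = card (nonF X) + (if lifted X then 0 else 1)"

lemma finite_nonF [simp]: "finite (nonF X)"
  unfolding nonF_def using finG by simp

lemma comp_eq_iff: "comp X u = comp X v \<longleftrightarrow> (u, v) \<in> reach G X"
proof
  assume "comp X u = comp X v"
  then show "(u, v) \<in> reach G X" unfolding comp_def using reach_refl[of v G X] by blast
next
  assume uv: "(u, v) \<in> reach G X"
  show "comp X u = comp X v" unfolding comp_def
    using reach_trans[OF uv] reach_trans[OF reach_sym[OF uv]] by blast
qed

lemma in_comp [simp]: "w \<in> comp X v \<longleftrightarrow> (v, w) \<in> reach G X"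
  by (simp add: comp_def)

lemma hasF_reach_iff: "(u, v) \<in> reach G X \<Longrightarrow> hasF X u = hasF X v"
  using hasF_reach reach_sym by metis

lemma comp_in_nonF: "comp X u \<in> nonF X \<longleftrightarrow> (\<exists>w\<in>verts G. (u, w) \<in> reach G X) \<and> \<not> hasF X u"
proof
  assume "comp X u \<in> nonF X"
  then obtain w where w: "w \<in> verts G" "\<not> hasF X w" "comp X u = comp X w" unfolding nonF_def by blast
  then have "(u, w) \<in> reach G X" using comp_eq_iff by simp
  then show "(\<exists>w\<in>verts G. (u, w) \<in> reach G X) \<and> \<not> hasF X u" using w hasF_reach_iff by metis
next
  assume "(\<exists>w\<in>verts G. (u, w) \<in> reach G X) \<and> \<not> hasF X u"
  then obtain w where w: "w \<in> verts G" "(u, w) \<in> reach G X" "\<not> hasF X u" by blast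
  then have "\<not> hasF X w" "comp X u = comp X w" using hasF_reach_iff comp_eq_iff by metis+
  then show "comp X u \<in> nonF X" unfolding nonF_def using w(1) by blast
qed

section \<open>The effect of one edge on the corank\<close>

lemma bridge_not_in_cycle:
  assumes "ends G e = {u, v}" "(u, v) \<notin> reach G X" "is_cycle G C" "C \<subseteq> insert e X"
  shows "C \<subseteq> X"
proof -
  have "e \<notin> C"
  proof
    assume e: "e \<in> C"
    have "u \<in> verts_of G C" using ends_subset_verts_of[OF e, of G] assms(1) by auto
    then show False using cycle_avoid_reach(1)[OF assms(3) e assms(4,1)] assms(2) by simp
  qed
  then show ?thesis using assms(4) by auto
qed

lemma hasF_insert_bridge:
  assumes "ends G e = {u, v}" "(u, v) \<notin> reach G X"
  shows "hasF (insert e X) w \<longleftrightarrow>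
    hasF X w \<or> (w, u) \<in> reach G X \<and> hasF X v \<or> (w, v) \<in> reach G X \<and> hasF X u"
proof
  note r = reach_insert[OF assms(1)]
  assume "hasF (insert e X) w"
  then obtain C x where C: "C \<in> \<F>" "C \<subseteq> insert e X" "x \<in> verts_of G C" "(w, x) \<in> reach G (insert e X)"
    unfolding hasF_def by blast
  have "C \<subseteq> X" using bridge_not_in_cycle[OF assms, of C] C(1,2) cycle_class by blast
  then have "(y, x) \<in> reach G X \<Longrightarrow> hasF X y" for y unfolding hasF_def using C by blast
  then show "hasF X w \<or> (w, u) \<in> reach G X \<and> hasF X v \<or> (w, v) \<in> reach G X \<and> hasF X u"
    using C(4) unfolding r by blast
next
  note r = reach_insert[OF assms(1)]
  have "hasF X y \<Longrightarrow> hasF (insert e X) y" for y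
    unfolding hasF_def using reach_mono[OF subset_insertI, of y _ G X e] by blast
  moreover assume "hasF X w \<or> (w, u) \<in> reach G X \<and> hasF X v \<or> (w, v) \<in> reach G X \<and> hasF X u"
  moreover have "(w, u) \<in> reach G X \<Longrightarrow> (w, v) \<in> reach G (insert e X)" "(w, v) \<in> reach G X \<Longrightarrow> (w, u) \<in> reach G (insert e X)"
    using r by auto
  ultimately show "hasF (insert e X) w" using hasF_reach by blast
qed

text \<open>The edge merges two components and creates no cycle, so \<open>lifted\<close> is
  unaffected. The number of components without cycles in \<F> drops by one unless both ends already
  reach such cycles, and this is exactly the case in which \<open>e\<close> is spanned.\<close>

lemma crk_insert_bridge:
  assumes "X \<subseteq> edges G" "e \<in> edges G" "e \<notin> X" "ends G e = {u, v}" "(u, v) \<notin> reach G X"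
    "u \<in> verts G" "v \<in> verts G"
  shows "if spans X e then crk (insert e X) = crk X else crk X = Suc (crk (insert e X))"
proof -
  let ?X = "insert e X"
  note old = bridge_not_in_cycle[OF assms(4,5)]
  have F: "C \<in> \<F> \<and> C \<subseteq> ?X \<longleftrightarrow> C \<in> \<F> \<and> C \<subseteq> X" for C using old[of C] cycle_class by blast
  have L: "C \<in> \<L> \<and> C \<subseteq> ?X \<longleftrightarrow> C \<in> \<L> \<and> C \<subseteq> X" for C using old[of C] cycle_class by blast
  have lift: "lifted ?X = lifted X" unfolding lifted_def Bex_def using F L by simp
  have r: "(x, y) \<in> reach G ?X \<longleftrightarrow> (x, y) \<in> reach G X \<or>
    (x, u) \<in> reach G X \<and> (v, y) \<in> reach G X \<or> (x, v) \<in> reach G X \<and> (u, y) \<in> reach G X" for x y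
    using reach_insert[OF assms(4)] .
  note hF = hasF_insert_bridge[OF assms(4,5)]
  have sp: "spans X e \<longleftrightarrow> hasF X u \<and> hasF X v"
  proof
    assume "spans X e"
    then consider C where "C \<in> \<B>" "e \<in> C" "C \<subseteq> ?X"
      | a b where "ends G e = {a, b}" "(a, b) \<in> reach G X"
      | a b where "ends G e = {a, b}" "hasF X a" "hasF X b"
      unfolding spans_def by blast
    then show "hasF X u \<and> hasF X v"
    proof cases
      case 1
      then show ?thesis using old[of C] cycle_class assms(3) by blast
    next
      case 2
      then have "(u, v) \<in> reach G X" using assms(4) reach_sym[OF 2(2)] by (auto simp: doubleton_eq_iff)
      then show ?thesis using assms(5) by simp
    next
      case 3
      then show ?thesis using assms(4) by (auto simp: doubleton_eq_iff)
    qed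
  next
    assume "hasF X u \<and> hasF X v"
    then show "spans X e" unfolding spans_def using assms(4) by blast
  qed
  have far: "comp ?X w = comp X w" if "(w, u) \<notin> reach G X" "(w, v) \<notin> reach G X" for w
    using that r by (auto simp: set_eq_iff)
  show ?thesis
  proof (cases "spans X e")
    case True
    then have uv: "hasF X u" "hasF X v" using sp by auto
    have "hasF ?X w = hasF X w" for w using hF[of w] uv hasF_reach by blast
    moreover have "comp ?X w = comp X w" if "\<not> hasF X w" for w
      using far[of w] that uv hasF_reach by blast
    ultimately have "nonF ?X = nonF X" unfolding nonF_def by auto
    then show ?thesis using True lift unfolding crk_def by simp
  next
    case False
    \<comment> \<open>Stated for an ordered pair with the side of \<open>u\<close> free of \<F>, so
      that it applies to either end. The component of \<open>u\<close> is the one that vanishes from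
      the count.\<close>
    have key: "card (nonF X) = Suc (card (nonF ?X))"
      if uv: "(u, v) \<notin> reach G X" "u \<in> verts G" "v \<in> verts G" and nF: "\<not> hasF X u"
      and r: "\<And>x y. (x, y) \<in> reach G ?X \<longleftrightarrow> (x, y) \<in> reach G X \<or>
    (x, u) \<in> reach G X \<and> (v, y) \<in> reach G X \<or> (x, v) \<in> reach G X \<and> (u, y) \<in> reach G X"
      and hF: "\<And>w. hasF ?X w \<longleftrightarrow> hasF X w \<or> (w, u) \<in> reach G X \<and> hasF X v \<or> (w, v) \<in> reach G X \<and> hasF X u"
      for u v
    proof -
      \<comment> \<open>The new collection is the old one without the component of \<open>u\<close>
        and with that of \<open>v\<close> enlarged. If \<open>v\<close> reaches a cycle in \<F>, its
        component is not counted and the map changes nothing.\<close>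
      let ?\<phi> = "\<lambda>K. if K = comp X v then K \<union> comp X u else K"
      have far: "comp ?X w = comp X w" if "(w, u) \<notin> reach G X" "(w, v) \<notin> reach G X" for w
        using that r by (auto simp: set_eq_iff)
      have vu: "(v, u) \<notin> reach G X" using uv(1) reach_sym[of v u G X] by blast
      have cv: "comp ?X v = comp X v \<union> comp X u" using vu r by (auto simp: set_eq_iff)
      have "(u, v) \<in> reach G ?X" using r by simp
      then have cu: "comp ?X u = comp X v \<union> comp X u" using cv comp_eq_iff by metis
      have fF: "hasF ?X w \<longleftrightarrow> hasF X w \<or> (w, u) \<in> reach G X \<and> hasF X v" for w
        using hF[of w] nF by blast
      have "comp X u \<noteq> comp X v" using uv(1) comp_eq_iff by metis
      have inj: "inj_on ?\<phi> (nonF X - {comp X u})"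
      proof (rule inj_onI)
        fix K K' assume K: "K \<in> nonF X - {comp X u}" "K' \<in> nonF X - {comp X u}" and eq: "?\<phi> K = ?\<phi> K'"
        have "u \<notin> Z" if Z: "Z \<in> nonF X - {comp X u}" for Z
        proof
          assume u: "u \<in> Z"
          obtain w where w: "Z = comp X w" using Z unfolding nonF_def by blast
          then have "Z = comp X u" using u comp_eq_iff[of X w u] by simp
          then show False using Z by simp
        qed
        then have nu: "u \<notin> K" "u \<notin> K'" using K by auto
        have "u \<in> comp X u" by simp
        then show "K = K'" using eq nu by (auto split: if_splits)
      qed
      have "?\<phi> ` (nonF X - {comp X u}) = nonF ?X"
      proof (intro equalityI subsetI)
        fix K assume "K \<in> ?\<phi> ` (nonF X - {comp X u})"
        then obtain w where w: "w \<in> verts G" "\<not> hasF X w" "comp X w \<noteq> comp X u" "K = ?\<phi> (comp X w)"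
          unfolding nonF_def by blast
        have wu: "(w, u) \<notin> reach G X" using w(3) comp_eq_iff by metis
        then have nw: "\<not> hasF ?X w" using fF w(2) by simp
        have "K = comp ?X w"
        proof (cases "comp X w = comp X v")
          case True
          then have "(w, v) \<in> reach G ?X" using r comp_eq_iff by metis
          then have "comp ?X w = comp ?X v" using comp_eq_iff by metis
          then show ?thesis using w(4) True cv by simp
        next
          case False
          then have "(w, v) \<notin> reach G X" using comp_eq_iff by metis
          then show ?thesis using far[OF wu] w(4) False by simp
        qed
        then show "K \<in> nonF ?X" unfolding nonF_def using w(1) nw by blast
      next
        fix K assume "K \<in> nonF ?X"
        then obtain w where w: "w \<in> verts G" "\<not> hasF ?X w" "K = comp ?X w" unfolding nonF_def by blast
        then have nw: "\<not> hasF X w" using fF by blast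
        show "K \<in> ?\<phi> ` (nonF X - {comp X u})"
        proof (cases "(w, u) \<in> reach G X \<or> (w, v) \<in> reach G X")
          case True
          then have "(w, v) \<in> reach G ?X" using r[of w v] by auto
          then have K: "K = comp X v \<union> comp X u" using w(3) cv comp_eq_iff by metis
          have "\<not> hasF X v"
          proof
            assume v: "hasF X v"
            then have "(w, v) \<in> reach G X" using True w(2) fF by blast
            then show False using hasF_reach[OF _ v] nw by blast
          qed
          then have "comp X v \<in> nonF X" using uv(3) unfolding nonF_def by blast
          then show ?thesis using \<open>comp X u \<noteq> comp X v\<close> K by (intro image_eqI[of _ _ "comp X v"]) auto
        next
          case False
          then have f: "(w, u) \<notin> reach G X" "(w, v) \<notin> reach G X" by auto
          then have ne: "comp X w \<noteq> comp X u" "comp X w \<noteq> comp X v" using comp_eq_iff by metis+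
          have "comp X w \<in> nonF X" using w(1) nw unfolding nonF_def by blast
          then show ?thesis using ne far[OF f] w(3) by (intro image_eqI[of _ _ "comp X w"]) auto
        qed
      qed
      then have "card (nonF ?X) = card (nonF X - {comp X u})" using card_image[OF inj] by simp
      moreover have "comp X u \<in> nonF X" using uv(2) nF unfolding nonF_def by blast
      ultimately show ?thesis
        using card_Suc_Diff1[of "nonF X" "comp X u"] by simp
    qed
    have "card (nonF X) = Suc (card (nonF ?X))"
    proof (cases "hasF X u")
      case False
      show ?thesis by (rule key[OF assms(5-7) False r hF])
    next
      case True
      then have nv: "\<not> hasF X v" using sp False by simp
      have vu: "(v, u) \<notin> reach G X" using assms(5) reach_sym[of v u G X] by blast
      show ?thesis
      proof (rule key[OF vu assms(7,6) nv])
        show "(x, y) \<in> reach G ?X \<longleftrightarrow> (x, y) \<in> reach G X \<or>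
          (x, v) \<in> reach G X \<and> (u, y) \<in> reach G X \<or> (x, u) \<in> reach G X \<and> (v, y) \<in> reach G X" for x y
          unfolding r[of x y] by argo
        show "hasF ?X w \<longleftrightarrow> hasF X w \<or> (w, v) \<in> reach G X \<and> hasF X u \<or> (w, u) \<in> reach G X \<and> hasF X v" for w
          unfolding hF[of w] by argo
      qed
    qed
    then show ?thesis using False lift unfolding crk_def by simp
  qed
qed

text \<open>Components stay the same, so only the presence of cycles in \<L> and \<F> can change.
  The cases follow the kind of cycle that the edge creates; \<open>sp\<close> is the form that
  \<open>spans\<close> takes for joined ends.\<close>

lemma crk_insert_chord:
  assumes "X \<subseteq> edges G" "e \<in> edges G" "e \<notin> X" "ends G e = {u, v}" "(u, v) \<in> reach G X"
    "u \<in> verts G" "v \<in> verts G"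
  shows "if spans X e then crk (insert e X) = crk X else crk X = Suc (crk (insert e X))"
proof -
  let ?X = "insert e X"
  have vu: "(v, u) \<in> reach G X" using reach_sym[OF assms(5)] .
  have r: "reach G ?X = reach G X"
  proof -
    have "(x, y) \<in> reach G ?X \<longleftrightarrow> (x, y) \<in> reach G X" for x y
      using reach_insert[OF assms(4), of x y X] reach_trans[OF _ reach_trans[OF assms(5)], of x y]
        reach_trans[OF _ reach_trans[OF vu], of x y] by blast
    then show ?thesis by auto
  qed
  have cr: "comp ?X = comp X" unfolding comp_def r ..
  have near: "(u, x) \<in> reach G X" if "is_cycle G C" "e \<in> C" "C \<subseteq> ?X" "x \<in> verts_of G C" for C x
    using cycle_avoid_reach(2)[OF that(1-3) assms(4) that(4)] .
  have sp: "spans X e \<longleftrightarrow> (\<exists>C\<in>\<B>. e \<in> C \<and> C \<subseteq> ?X) \<or> (\<exists>C\<in>\<L>. C \<subseteq> X) \<or> hasF X u"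
  proof
    assume "spans X e"
    then consider C where "C \<in> \<B>" "e \<in> C" "C \<subseteq> ?X" | "\<exists>C\<in>\<L>. C \<subseteq> X"
      | a b where "ends G e = {a, b}" "hasF X a" "hasF X b"
      unfolding spans_def by blast
    then show "(\<exists>C\<in>\<B>. e \<in> C \<and> C \<subseteq> ?X) \<or> (\<exists>C\<in>\<L>. C \<subseteq> X) \<or> hasF X u"
    proof cases
      case 3
      then show ?thesis using assms(4) by (auto simp: doubleton_eq_iff)
    qed blast+
  next
    assume *: "(\<exists>C\<in>\<B>. e \<in> C \<and> C \<subseteq> ?X) \<or> (\<exists>C\<in>\<L>. C \<subseteq> X) \<or> hasF X u"
    have "hasF X u = hasF X v" using hasF_reach_iff[OF assms(5)] .
    then show "spans X e" unfolding spans_def using * assms(4,5) by blast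
  qed
  obtain C0 where C0: "is_cycle G C0" "e \<in> C0" "C0 \<subseteq> ?X"
    using cycle_through_edge[OF finG(1) assms(2,4,1,3,5)] .
  have hF: "hasF ?X w \<longleftrightarrow> hasF X w \<or> (w, u) \<in> reach G X \<and> (\<exists>C\<in>\<F>. e \<in> C \<and> C \<subseteq> ?X)" for w
  proof
    assume "hasF ?X w"
    then obtain C x where C: "C \<in> \<F>" "C \<subseteq> ?X" "x \<in> verts_of G C" "(w, x) \<in> reach G X"
      unfolding hasF_def r by blast
    show "hasF X w \<or> (w, u) \<in> reach G X \<and> (\<exists>C\<in>\<F>. e \<in> C \<and> C \<subseteq> ?X)"
    proof (cases "e \<in> C")
      case True
      have "(u, x) \<in> reach G X" using near[OF _ True C(2,3)] C(1) cycle_class by simp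
      then have "(w, u) \<in> reach G X" using reach_trans[OF C(4) reach_sym] by blast
      then show ?thesis using True C(1,2) by blast
    next
      case False
      then show ?thesis using C unfolding hasF_def by blast
    qed
  next
    assume "hasF X w \<or> (w, u) \<in> reach G X \<and> (\<exists>C\<in>\<F>. e \<in> C \<and> C \<subseteq> ?X)"
    then show "hasF ?X w"
    proof
      assume "hasF X w"
      then show ?thesis unfolding hasF_def r by blast
    next
      assume *: "(w, u) \<in> reach G X \<and> (\<exists>C\<in>\<F>. e \<in> C \<and> C \<subseteq> ?X)"
      then obtain C where C: "C \<in> \<F>" "e \<in> C" "C \<subseteq> ?X" by blast
      have "u \<in> verts_of G C" using ends_subset_verts_of[OF C(2), of G] assms(4) by auto
      then show ?thesis unfolding hasF_def r using C * by blast
    qed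
  qed
  \<comment> \<open>If \<open>X\<close> has no cycle in \<L> and \<open>u\<close> reaches none in
    \<F>, one balanced cycle through \<open>e\<close> makes all of them balanced. So a new
    unbalanced cycle rules out the first clause of \<open>spans\<close>.\<close>
  have balanced: "C \<in> \<B>" if noL: "\<not> (\<exists>C\<in>\<L>. C \<subseteq> X)" and noF: "\<not> hasF X u"
    and Z: "Z \<in> \<B>" "e \<in> Z" "Z \<subseteq> ?X" and C: "is_cycle G C" "e \<in> C" "C \<subseteq> ?X" for C Z
  proof (rule balanced_exchange[OF Z(1) C(1) Z(2) C(2)])
    fix Y assume Y: "is_cycle G Y" "Y \<subseteq> Z \<union> C - {e}"
    have cZ: "is_cycle G Z" using Z(1) cycle_class by simp
    have YX: "Y \<subseteq> X" using Y(2) Z(3) C(3) by auto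
    obtain y where y: "y \<in> verts_of G Y" using cycle_basic(5)[OF Y(1)] by auto
    have "y \<in> verts_of G (Z \<union> C)" using y Y(2) verts_of_mono[of Y "Z \<union> C" G] by auto
    then have "(u, y) \<in> reach G X" using near[OF cZ Z(2,3)] near[OF C] by auto
    then have "Y \<notin> \<F>" using noF YX y unfolding hasF_def by blast
    moreover have "Y \<notin> \<L>" using noL YX by blast
    ultimately show "Y \<in> \<B>" using Y(1) cycle_class by blast
  qed
  show ?thesis
  proof (cases "hasF X u")
    case True
    then obtain D where D: "D \<in> \<F>" "D \<subseteq> X" unfolding hasF_def by blast
    have "hasF ?X w = hasF X w" for w using hF[of w] hasF_reach[OF _ True] by blast
    then have "nonF ?X = nonF X" unfolding nonF_def cr by simp
    moreover have "\<not> lifted ?X" "\<not> lifted X" unfolding lifted_def using D by blast+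
    ultimately show ?thesis using True sp unfolding crk_def by simp
  next
    case noF: False
    show ?thesis
    proof (cases "\<exists>C\<in>\<F>. e \<in> C \<and> C \<subseteq> ?X")
      case True
      then obtain C where C: "C \<in> \<F>" "e \<in> C" "C \<subseteq> ?X" by blast
      have cC: "is_cycle G C" using C(1) cycle_class by simp
      have "nonF X = insert (comp X u) (nonF ?X)"
      proof -
        have "{v \<in> verts G. \<not> hasF X v} = {v \<in> verts G. (v, u) \<in> reach G X} \<union> {v \<in> verts G. \<not> hasF ?X v}"
        proof -
          have "\<not> hasF X v \<longleftrightarrow> (v, u) \<in> reach G X \<or> \<not> hasF ?X v" for v
            using hF[of v] True hasF_reach_iff[of v u X] noF by blast
          then show ?thesis by blast
        qed
        moreover have "comp X ` {v \<in> verts G. (v, u) \<in> reach G X} = {comp X u}"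
        proof -
          have "comp X ` {v \<in> verts G. (v, u) \<in> reach G X} = (\<lambda>_. comp X u) ` {v \<in> verts G. (v, u) \<in> reach G X}"
            by (intro image_cong) (simp_all add: comp_eq_iff)
          also have "\<dots> = {comp X u}" by (rule image_constant[of u]) (simp add: assms(6))
          finally show ?thesis .
        qed
        ultimately show ?thesis unfolding nonF_def cr by (simp add: image_Un)
      qed
      moreover have "comp X u \<notin> nonF ?X"
        using comp_in_nonF[of ?X u] hF[of u] True unfolding cr by simp
      ultimately have card: "card (nonF X) = Suc (card (nonF ?X))" by simp
      have nl: "\<not> lifted ?X" unfolding lifted_def using C by blast
      show ?thesis
      proof (cases "lifted X")
        case True
        then have "spans X e" using sp unfolding lifted_def by blast
        \<comment> \<open>One component is lost from the count, but \<open>lifted\<close> fails for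
          the larger set and contributes one, so the two effects cancel.\<close>
        then show ?thesis using card nl True unfolding crk_def by simp
      next
        case False
        \<comment> \<open>A cycle in \<L> inside a set that is not lifted comes with a cycle
          \<open>D\<close> in \<F>. Both \<open>D\<close> and the new \<open>C\<close> meet it,
          which would make \<open>D\<close> reachable from \<open>u\<close>.\<close>
        have noL: "\<not> (\<exists>C\<in>\<L>. C \<subseteq> X)"
        proof
          assume L: "\<exists>C\<in>\<L>. C \<subseteq> X"
          then obtain Z where Z: "Z \<in> \<L>" "Z \<subseteq> X" by blast
          obtain D where D: "D \<in> \<F>" "D \<subseteq> X" using False L unfolding lifted_def by blast
          obtain z where z: "z \<in> verts_of G Z" "z \<in> verts_of G C" using LF_meet[OF Z(1) C(1)] by blast
          obtain d where d: "d \<in> verts_of G Z" "d \<in> verts_of G D" using LF_meet[OF Z(1) D(1)] by blast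
          have cZ: "is_cycle G Z" using Z(1) cycle_class by simp
          have "(z, d) \<in> reach G X" using reach_mono[OF Z(2) cycle_basic(6)[OF cZ z(1) d(1)]] .
          then have "(u, d) \<in> reach G X" by (rule reach_trans[OF near[OF cC C(2,3) z(2)]])
          then show False using noF D d(2) unfolding hasF_def by blast
        qed
        have "\<not> spans X e"
          using sp noL noF balanced[OF noL noF _ _ _ cC C(2,3)] class_disjoint(2)[OF C(1)] by blast
        then show ?thesis using card nl False unfolding crk_def by simp
      qed
    next
      case newF: False
      have "hasF ?X w = hasF X w" for w using hF newF by simp
      then have nF: "nonF ?X = nonF X" unfolding nonF_def cr by simp
      have FX: "(\<exists>C\<in>\<F>. C \<subseteq> ?X) \<longleftrightarrow> (\<exists>C\<in>\<F>. C \<subseteq> X)"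
        using newF by (meson subset_insert subset_insertI2)
      consider (L) "\<exists>C\<in>\<L>. C \<subseteq> X" | (F) "\<not> (\<exists>C\<in>\<L>. C \<subseteq> X)" "\<exists>C\<in>\<F>. C \<subseteq> X"
        | (new) C where "\<not> (\<exists>C\<in>\<L>. C \<subseteq> X)" "\<not> (\<exists>C\<in>\<F>. C \<subseteq> X)" "C \<in> \<L>" "C \<subseteq> ?X"
        | (none) "\<not> (\<exists>C\<in>\<L>. C \<subseteq> ?X)" "\<not> (\<exists>C\<in>\<F>. C \<subseteq> X)"
        by blast
      then show ?thesis
      proof cases
        case L
        then have "\<exists>C\<in>\<L>. C \<subseteq> ?X" by blast
        then have "lifted ?X = lifted X" unfolding lifted_def using FX L by simp
        then show ?thesis using L sp nF unfolding crk_def by simp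
      next
        case F
        then have "\<not> lifted X" "\<not> lifted ?X" unfolding lifted_def using FX by blast+
        \<comment> \<open>A cycle in \<L> through \<open>e\<close> would meet the cycle in \<F> that
          \<open>X\<close> contains and make it reachable from \<open>u\<close>.\<close>
        moreover have "C0 \<in> \<B>"
        proof (rule ccontr)
          assume "C0 \<notin> \<B>"
          then have L: "C0 \<in> \<L>" using newF C0 cycle_class by blast
          obtain D where D: "D \<in> \<F>" "D \<subseteq> X" using F by blast
          obtain d where d: "d \<in> verts_of G C0" "d \<in> verts_of G D" using LF_meet[OF L D(1)] by blast
          then show False using noF near[OF C0 d(1)] D unfolding hasF_def by blast
        qed
        then have "spans X e" using sp C0 by blast
        ultimately show ?thesis using nF unfolding crk_def by simp
      next
        case new
        have eC: "e \<in> C" using new(1,3,4) by (meson subset_insert)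
        have cC: "is_cycle G C" using new(3) cycle_class by simp
        have "lifted ?X" "\<not> lifted X" unfolding lifted_def using FX new by blast+
        moreover have "\<not> spans X e"
          using sp new(1) noF balanced[OF new(1) noF _ _ _ cC eC new(4)] class_disjoint(1)[OF new(3)] by blast
        ultimately show ?thesis using nF unfolding crk_def by simp
      next
        case none
        then have "\<not> lifted X" "\<not> lifted ?X" unfolding lifted_def by blast+
        moreover have "C0 \<in> \<B>" using none(1) newF C0 cycle_class by blast
        then have "spans X e" using sp C0 by blast
        ultimately show ?thesis using nF unfolding crk_def by simp
      qed
    qed
  qed
qed

lemma crk_insert:
  assumes "X \<subseteq> edges G" "e \<in> edges G" "e \<notin> X"
  shows "if spans X e then crk (insert e X) = crk X else crk X = Suc (crk (insert e X))"
proof -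
  obtain u v where uv: "ends G e = {u, v}" "u \<in> verts G" "v \<in> verts G" using ends_cases[OF assms(2)] .
  show ?thesis
    by (cases "(u, v) \<in> reach G X")
      (fact crk_insert_chord[OF assms uv(1) _ uv(2,3)] crk_insert_bridge[OF assms uv(1) _ uv(2,3)])+
qed

end

section \<open>Matroids with a corank function\<close>

lemma in_closure_of_iff:
  "e \<in> closure_of M X \<longleftrightarrow> e \<in> X \<or> e \<in> ground M \<and> (\<exists>C\<in>circuits M. e \<in> C \<and> C \<subseteq> insert e X)"
  unfolding closure_of_def by blast

lemma closure_of_extensive: "X \<subseteq> closure_of M X"
  unfolding closure_of_def by auto

lemma closure_of_mono: "X \<subseteq> Y \<Longrightarrow> closure_of M X \<subseteq> closure_of M Y"
  unfolding closure_of_def by blast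

text \<open>\<open>k\<close> behaves like rank subtracted from a constant.\<close>

locale corank =
  fixes M :: "'e matroid" and k :: "'e set \<Rightarrow> nat"
  assumes finite_ground: "finite (ground M)"
    and circuit_subset: "\<And>C. C \<in> circuits M \<Longrightarrow> C \<subseteq> ground M"
    and k_insert: "\<And>X e. X \<subseteq> ground M \<Longrightarrow> e \<in> ground M \<Longrightarrow> e \<notin> X \<Longrightarrow>
      if e \<in> closure_of M X then k (insert e X) = k X else k X = Suc (k (insert e X))"
begin

abbreviation "\<E> \<equiv> ground M"
abbreviation "cl \<equiv> closure_of M"

lemma cl_subset: "X \<subseteq> \<E> \<Longrightarrow> cl X \<subseteq> \<E>"
  unfolding closure_of_def by auto

lemma k_insert_notin: "X \<subseteq> \<E> \<Longrightarrow> e \<in> \<E> \<Longrightarrow> e \<notin> cl X \<Longrightarrow> k X = Suc (k (insert e X))"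
  using k_insert[of X e] closure_of_extensive[of X M] by auto

lemma in_cl_iff: "X \<subseteq> \<E> \<Longrightarrow> e \<in> \<E> \<Longrightarrow> e \<in> cl X \<longleftrightarrow> k (insert e X) = k X"
  using k_insert[of X e] closure_of_extensive[of X M]
  by (cases "e \<in> X") (auto simp: insert_absorb split: if_splits)

lemma k_insert_le: "X \<subseteq> \<E> \<Longrightarrow> e \<in> \<E> \<Longrightarrow> k (insert e X) \<le> k X \<and> k X \<le> Suc (k (insert e X))"
  using k_insert_notin[of X e] in_cl_iff[of X e] by (cases "e \<in> cl X") auto

lemma k_antimono:
  assumes "X \<subseteq> Y" "Y \<subseteq> \<E>"
  shows "k Y \<le> k X"
proof -
  have "k (X \<union> Z) \<le> k X" if "finite Z" "Z \<subseteq> \<E>" for Z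
    using that
  proof (induction rule: finite_induct)
    case (insert z Z)
    then have "k (insert z (X \<union> Z)) \<le> k (X \<union> Z)" using assms by (intro k_insert_le[THEN conjunct1]) auto
    then show ?case using insert by simp
  qed simp
  from this[of Y] show ?thesis using assms finite_ground by (simp add: Un_absorb1 finite_subset)
qed

lemma k_cl_un:
  assumes "X \<subseteq> \<E>" "Z \<subseteq> cl X"
  shows "k (X \<union> Z) = k X"
proof -
  have "finite Z" using assms cl_subset[OF assms(1)] finite_ground finite_subset by metis
  then show ?thesis using assms(2)
  proof (induction rule: finite_induct)
    case (insert z Z)
    have "z \<in> cl (X \<union> Z)" using insert.prems closure_of_mono[of X "X \<union> Z" M] by auto
    moreover have "X \<union> Z \<subseteq> \<E>" "z \<in> \<E>" using insert.prems cl_subset[OF assms(1)] assms(1) by auto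
    ultimately have "k (insert z (X \<union> Z)) = k (X \<union> Z)" using in_cl_iff by simp
    then show ?case using insert by simp
  qed simp
qed

lemma k_cl: "X \<subseteq> \<E> \<Longrightarrow> k (cl X) = k X"
  using k_cl_un[of X "cl X"] closure_of_extensive[of X M] by (simp add: Un_absorb1)

text \<open>If adding \<open>e\<close> to \<open>cl X\<close> leaves \<open>k\<close> unchanged,
  monotonicity forces the same for \<open>X\<close>, because \<open>X\<close> and
  \<open>cl X\<close> have equal \<open>k\<close>.\<close>

lemma cl_idem:
  assumes "X \<subseteq> \<E>"
  shows "cl (cl X) = cl X"
proof
  show "cl (cl X) \<subseteq> cl X"
  proof
    fix e assume e: "e \<in> cl (cl X)"
    have clE: "cl X \<subseteq> \<E>" using cl_subset[OF assms] .
    have eE: "e \<in> \<E>" using e cl_subset[OF clE] by auto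
    have "k (insert e (cl X)) = k X" using e in_cl_iff[OF clE eE] k_cl[OF assms] by simp
    moreover have "k (insert e (cl X)) \<le> k (insert e X)"
      using closure_of_extensive[of X M] clE eE by (intro k_antimono) auto
    moreover have "k (insert e X) \<le> k X" using k_insert_le[OF assms eE] by simp
    ultimately show "e \<in> cl X" using in_cl_iff[OF assms eE] by simp
  qed
qed (rule closure_of_extensive)

lemma cl_least: "X \<subseteq> cl Y \<Longrightarrow> Y \<subseteq> \<E> \<Longrightarrow> cl X \<subseteq> cl Y"
  using closure_of_mono[of X "cl Y" M] cl_idem[of Y] by simp

lemma cl_flat: "X \<subseteq> \<E> \<Longrightarrow> is_flat M (cl X)"
  unfolding is_flat_def using cl_idem cl_subset by simp

lemma flatD: "is_flat M W \<Longrightarrow> W \<subseteq> \<E>" "is_flat M W \<Longrightarrow> cl W = W"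
  unfolding is_flat_def by auto

text \<open>Exchange in the contraction by \<open>W\<close>: both elements lower \<open>k\<close> by
  one over \<open>W\<close> and together by no more, so each is spanned by the other.\<close>

lemma parallel:
  assumes "is_flat M W" "g \<in> \<E>" "h \<in> cl (insert g W)" "h \<notin> W"
  shows "cl (insert h W) = cl (insert g W)"
proof -
  note W = flatD[OF assms(1)]
  have gW: "insert g W \<subseteq> \<E>" using W assms(2) by auto
  have hE: "h \<in> \<E>" using assms(3) cl_subset[OF gW] by auto
  then have hW: "insert h W \<subseteq> \<E>" using W by auto
  have "k (insert h (insert g W)) = k (insert g W)" using in_cl_iff[OF gW hE] assms(3) by simp
  moreover have "k W = Suc (k (insert h W))" using k_insert_notin[OF W(1) hE] W(2) assms(4) by simp
  moreover have "k W \<le> Suc (k (insert g W))" using k_insert_le[OF W(1) assms(2)] by simp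
  moreover have "k (insert g (insert h W)) \<le> k (insert h W)" using k_insert_le[OF hW assms(2)] by simp
  ultimately have "k (insert g (insert h W)) = k (insert h W)" by (simp add: insert_commute)
  then have "g \<in> cl (insert h W)" using in_cl_iff[OF hW assms(2)] by simp
  then have "insert g W \<subseteq> cl (insert h W)" using closure_of_extensive[of "insert h W" M] by auto
  moreover have "insert h W \<subseteq> cl (insert g W)"
    using closure_of_extensive[of "insert g W" M] assms(3) by auto
  ultimately show ?thesis using cl_least[OF _ hW] cl_least[OF _ gW] by blast
qed

text \<open>\<open>M/W\<close> has rank two, no loops and exactly two parallel classes.\<close>

definition two_class :: "'e set \<Rightarrow> bool" where
  "two_class W \<longleftrightarrow> is_flat M W \<and> k W = k \<E> + 2 \<and>
     (\<forall>g\<in>\<E> - W. \<forall>h\<in>\<E> - W. h \<notin> cl (insert g W) \<longrightarrow> \<E> \<subseteq> cl (insert g W) \<union> cl (insert h W))"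

text \<open>By \<open>parallel\<close> every element outside \<open>W\<close> spans the same line
  over \<open>W\<close> as \<open>e\<close> or \<open>f\<close>, so any two nonparallel elements can
  replace them.\<close>

lemma two_classI:
  assumes "is_flat M W" "k W = k \<E> + 2" "e \<in> \<E>" "f \<in> \<E>" "\<E> \<subseteq> cl (insert e W) \<union> cl (insert f W)"
  shows "two_class W"
  unfolding two_class_def
proof (intro conjI ballI impI assms(1,2))
  fix g h assume g: "g \<in> \<E> - W" and h: "h \<in> \<E> - W" and gh: "h \<notin> cl (insert g W)"
  have "cl (insert x W) = cl (insert e W) \<or> cl (insert x W) = cl (insert f W)" if "x \<in> \<E> - W" for x
    using parallel[OF assms(1,3), of x] parallel[OF assms(1,4), of x] that assms(5) by blast
  note this[OF g] this[OF h]
  moreover have "cl (insert g W) \<noteq> cl (insert h W)"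
    using gh closure_of_extensive[of "insert h W" M] by auto
  ultimately show "\<E> \<subseteq> cl (insert g W) \<union> cl (insert h W)" using assms(5) by auto
qed

text \<open>Two elements \<open>e\<close>, \<open>f\<close> in no common circuit of the contraction
  are fixed, and \<open>W\<close> is a maximal flat over \<open>F\<close> that keeps them
  independent. Maximality makes them span everything over \<open>W\<close>. An element on neither of
  the lines through \<open>e\<close> and \<open>f\<close> would produce a circuit of the contraction
  by \<open>F\<close> containing both.\<close>

lemma disconnected_contraction_two_class:
  assumes F: "is_flat M F" and disc: "\<not> connected_matroid (contract M F)"
  obtains W where "two_class W"
proof -
  obtain e f where ef: "e \<in> \<E> - F" "f \<in> \<E> - F" "e \<noteq> f" and
    nD: "\<And>D. D \<in> circuits (contract M F) \<Longrightarrow> e \<in> D \<Longrightarrow> f \<notin> D"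
  proof -
    have "ground (contract M F) = \<E> - F" by (simp add: contract_def)
    then have "\<exists>e\<in>\<E> - F. \<exists>f\<in>\<E> - F. e \<noteq> f \<and> (\<forall>D\<in>circuits (contract M F). e \<in> D \<longrightarrow> f \<notin> D)"
      using disc unfolding connected_matroid_def by simp
    then obtain e f where *: "e \<in> \<E> - F" "f \<in> \<E> - F" "e \<noteq> f"
      "\<forall>D\<in>circuits (contract M F). e \<in> D \<longrightarrow> f \<notin> D" by blast
    show ?thesis by (rule that[OF *(1-3)]) (use *(4) in simp)
  qed
  note FE = flatD[OF F]
  have circF: "C - F \<noteq> {e}" "C - F \<noteq> {f}" if "C \<in> circuits M" for C
  proof -
    have "x \<in> F" if "C - F = {x}" "x \<in> \<E>" for x
    proof -
      have "x \<in> C" "C \<subseteq> insert x F" using that(1) by blast+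
      then have "x \<in> cl F" using that(2) \<open>C \<in> circuits M\<close> in_closure_of_iff by metis
      then show ?thesis using FE by simp
    qed
    then show "C - F \<noteq> {e}" "C - F \<noteq> {f}" using ef by blast+
  qed
  \<comment> \<open>Otherwise \<open>{e, f}\<close> would be a circuit of the contraction, since
    neither element is a loop in it.\<close>
  have start: "e \<notin> cl (insert f F)"
  proof
    assume "e \<in> cl (insert f F)"
    then obtain C where C: "C \<in> circuits M" "e \<in> C" "C \<subseteq> insert e (insert f F)"
      using ef in_closure_of_iff[of e M "insert f F"] by auto
    have "C - F = {e} \<or> C - F = {e, f}" using C(2,3) ef by blast
    then have CF: "C - F = {e, f}" using circF[OF C(1)] by auto
    have "C' - F = {e, f}" if "C' \<in> circuits M" "C' - F \<noteq> {}" "C' - F \<subseteq> {e, f}" for C'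
    proof -
      have "C' - F = {e} \<or> C' - F = {f} \<or> C' - F = {e, f}" using that(2,3) by blast
      then show ?thesis using circF[OF that(1)] by auto
    qed
    then have "{e, f} \<in> circuits (contract M F)"
      unfolding contract_def using CF C(1) by (simp, metis)
    then show False using nD by blast
  qed
  define Q where "Q = {W. F \<subseteq> W \<and> is_flat M W \<and> e \<notin> W \<and> f \<notin> W \<and> e \<notin> cl (insert f W)}"
  have finQ: "finite Q" unfolding Q_def
    by (rule finite_subset[of _ "Pow \<E>"]) (auto simp: is_flat_def finite_ground)
  have "F \<in> Q" unfolding Q_def using F ef start by auto
  from finite_has_maximal2[OF finQ this] obtain W where W: "W \<in> Q"
    and max: "\<forall>W'\<in>Q. W \<subseteq> W' \<longrightarrow> W = W'" by auto
  have W': "F \<subseteq> W" "is_flat M W" "e \<notin> W" "f \<notin> W" "e \<notin> cl (insert f W)" using W unfolding Q_def by auto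
  note WE = flatD[OF W'(2)]
  have eE: "e \<in> \<E>" "f \<in> \<E>" using ef by auto
  have kf: "k W = Suc (k (insert f W))" using k_insert_notin[OF WE(1) eE(2)] WE(2) W'(4) by simp
  have fWE: "insert f W \<subseteq> \<E>" using WE eE by auto
  have kef: "k (insert f W) = Suc (k (insert e (insert f W)))" using k_insert_notin[OF fWE eE(1) W'(5)] .
  \<comment> \<open>A further independent direction \<open>g\<close> could be added to
    \<open>W\<close> while keeping \<open>e\<close> and \<open>f\<close> independent, against
    maximality.\<close>
  have span: "g \<in> cl (insert e (insert f W))" if g: "g \<in> \<E>" for g
  proof (rule ccontr)
    assume ng: "g \<notin> cl (insert e (insert f W))"
    have sub: "insert e (insert f W) \<subseteq> \<E>" "insert g W \<subseteq> \<E>" "insert f (insert g W) \<subseteq> \<E>"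
      "insert e (insert g W) \<subseteq> \<E>"
      using fWE eE g by auto
    have k3: "k W = k (insert e (insert f (insert g W))) + 3"
      using k_insert_notin[OF sub(1) g ng] kf kef by (simp add: insert_commute)
    have gW: "g \<notin> W" using ng closure_of_extensive[of "insert e (insert f W)" M] by auto
    have kg: "k W = Suc (k (insert g W))" using k_insert_notin[OF WE(1) g] gW WE(2) by simp
    let ?W = "cl (insert g W)"
    have "e \<notin> ?W"
      using in_cl_iff[OF sub(2) eE(1)] k_insert_le[OF sub(4) eE(2)] k3 kg by (auto simp: insert_commute)
    moreover have "f \<notin> ?W"
      using in_cl_iff[OF sub(2) eE(2)] k_insert_le[OF sub(3) eE(1)] k3 kg by auto
    moreover have "e \<notin> cl (insert f ?W)"
    proof
      assume e: "e \<in> cl (insert f ?W)"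
      have "insert f ?W \<subseteq> cl (insert f (insert g W))"
        using closure_of_mono[of "insert g W" "insert f (insert g W)" M] closure_of_extensive[of "insert f (insert g W)" M] by auto
      then have "e \<in> cl (insert f (insert g W))" using cl_least[OF _ sub(3)] e by blast
      then show False using in_cl_iff[OF sub(3) eE(1)] k_insert_le[OF sub(2) eE(2)] k3 kg by auto
    qed
    moreover have "F \<subseteq> ?W" "W \<subseteq> ?W" "g \<in> ?W" using W'(1) closure_of_extensive[of "insert g W" M] by auto
    ultimately have "?W \<in> Q" unfolding Q_def using cl_flat[OF sub(2)] by simp
    then show False using max \<open>W \<subseteq> ?W\<close> \<open>g \<in> ?W\<close> gW by metis
  qed
  have "k \<E> = k (insert e (insert f W))"
  proof -
    have "insert e (insert f W) \<union> \<E> = \<E>" using fWE eE by auto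
    then show ?thesis using k_cl_un[of "insert e (insert f W)" \<E>] span fWE eE by auto
  qed
  then have kW: "k W = k \<E> + 2" using kf kef by simp
  have "g \<in> cl (insert e W) \<union> cl (insert f W)" if g: "g \<in> \<E>" for g
  proof (rule ccontr)
    assume ng: "g \<notin> cl (insert e W) \<union> cl (insert f W)"
    have gW: "g \<notin> insert e (insert f W)"
      using ng closure_of_extensive[of "insert e W" M] closure_of_extensive[of "insert f W" M] by auto
    \<comment> \<open>A minimal set that spans \<open>g\<close> together with \<open>F\<close> must
      contain \<open>e\<close> and \<open>f\<close>, since \<open>g\<close> is on neither line. With
      \<open>g\<close> added it becomes a circuit of the contraction.\<close>
    define \<S> where "\<S> = {S. S \<subseteq> insert e (insert f W) - F \<and> g \<in> cl (F \<union> S)}"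
    have finS: "finite \<S>" unfolding \<S>_def
      by (rule finite_subset[of _ "Pow \<E>"]) (use fWE eE finite_ground in auto)
    have "F \<union> (insert e (insert f W) - F) = insert e (insert f W)" using W'(1) by auto
    then have "insert e (insert f W) - F \<in> \<S>" unfolding \<S>_def using span[OF g] by simp
    from finite_has_minimal2[OF finS this] obtain S where S: "S \<in> \<S>"
      and min: "\<forall>S'\<in>\<S>. S' \<subseteq> S \<longrightarrow> S = S'" by auto
    have S': "S \<subseteq> insert e (insert f W) - F" "g \<in> cl (F \<union> S)" using S unfolding \<S>_def by auto
    have min': "S' = S" if "S' \<subseteq> S" "g \<in> cl (F \<union> S')" for S'
    proof -
      have "S' \<in> \<S>" using that S'(1) unfolding \<S>_def by auto
      then show ?thesis using min that(1) by metis
    qed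
    have FSE: "F \<union> S \<subseteq> \<E>" using S'(1) fWE eE FE by auto
    have "e \<in> S"
    proof (rule ccontr)
      assume "e \<notin> S"
      then have "F \<union> S \<subseteq> insert f W" using S'(1) W'(1) by auto
      then show False using closure_of_mono[of "F \<union> S" "insert f W" M] S'(2) ng by blast
    qed
    have "f \<in> S"
    proof (rule ccontr)
      assume "f \<notin> S"
      then have "F \<union> S \<subseteq> insert e W" using S'(1) W'(1) by auto
      then show False using closure_of_mono[of "F \<union> S" "insert e W" M] S'(2) ng by blast
    qed
    have gFS: "g \<notin> F \<union> S" using gW S'(1) W'(1) by auto
    have drop: "C - F - {g} = S" if "C \<in> circuits M" "g \<in> C" "C - F \<subseteq> insert g S" for C
    proof (rule min')
      show "C - F - {g} \<subseteq> S" using that(3) by auto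
      have "C \<subseteq> insert g (F \<union> (C - F - {g}))" by auto
      then show "g \<in> cl (F \<union> (C - F - {g}))" using in_closure_of_iff g that(1,2) by metis
    qed
    obtain C where C: "C \<in> circuits M" "g \<in> C" "C \<subseteq> insert g (F \<union> S)"
      using S'(2) gFS in_closure_of_iff[of g M "F \<union> S"] by auto
    have "C - F - {g} = S" using drop[OF C(1,2)] C(3) by auto
    then have CF: "C - F = insert g S" using C(2) gFS by auto
    \<comment> \<open>A circuit inside must contain \<open>g\<close>, or else some \<open>s\<close>
      in \<open>S\<close> would be spanned by the others and could be dropped. With \<open>g\<close>
      it must contain all of \<open>S\<close>, by the choice of \<open>S\<close>.\<close>
    have "C' - F = insert g S" if C': "C' \<in> circuits M" "C' - F \<noteq> {}" "C' - F \<subseteq> insert g S" for C'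
    proof (cases "g \<in> C'")
      case True
      have "C' - F - {g} = S" using drop[OF C'(1) True C'(3)] .
      then show ?thesis using True gFS by auto
    next
      case False
      obtain s where s: "s \<in> C' - F" using C'(2) by auto
      have sS: "s \<in> S" using s C'(3) False by auto
      have "C' \<subseteq> insert s (F \<union> (S - {s}))" using C'(3) False by auto
      then have "s \<in> cl (F \<union> (S - {s}))"
        using in_closure_of_iff[of s M "F \<union> (S - {s})"] C'(1) s sS FSE by auto
      then have "F \<union> S \<subseteq> cl (F \<union> (S - {s}))"
        using closure_of_extensive[of "F \<union> (S - {s})" M] by auto
      then have "g \<in> cl (F \<union> (S - {s}))" using cl_least[of "F \<union> S" "F \<union> (S - {s})"] S'(2) FSE by auto
      then have "S - {s} = S" by (intro min') auto
      then show ?thesis using sS by auto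
    qed
    then have "insert g S \<in> circuits (contract M F)"
      unfolding contract_def using CF C(1) by (simp, metis)
    then show False using nD \<open>e \<in> S\<close> \<open>f \<in> S\<close> by blast
  qed
  then have "two_class W" using two_classI[OF W'(2) kW eE] by blast
  then show ?thesis using that by blast
qed

text \<open>The closure of \<open>W0\<close> has corank two, and each of \<open>A\<close> and
  \<open>B\<close> adds one line to it. A circuit of the contraction through a representative of
  each line cannot consist of these two elements alone. A third element is parallel to one of them
  and gives a smaller dependent set.\<close>

lemma disconnected_contractionI:
  assumes "W0 \<subseteq> \<E>" "A \<subseteq> \<E>" "B \<subseteq> \<E>" "\<E> \<subseteq> W0 \<union> A \<union> B"
    "k W0 = k \<E> + 2" "k (W0 \<union> A) = k \<E> + 1" "k (W0 \<union> B) = k \<E> + 1"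
  shows "\<exists>W. is_flat M W \<and> \<not> connected_matroid (contract M W)"
proof -
  let ?W = "cl W0"
  have W: "?W \<subseteq> \<E>" "W0 \<subseteq> ?W" "is_flat M ?W" "cl ?W = ?W" "k ?W = k \<E> + 2"
    using assms cl_subset closure_of_extensive cl_flat cl_idem k_cl by metis+
  have grow: "\<exists>e\<in>A - ?W. A \<subseteq> cl (insert e ?W)" if A: "A \<subseteq> \<E>" "k (W0 \<union> A) = k \<E> + 1" for A
  proof -
    have "\<not> A \<subseteq> ?W"
    proof
      assume "A \<subseteq> ?W"
      then have "k (W0 \<union> A) = k W0" using k_cl_un[OF assms(1)] by simp
      then show False using A(2) assms(5) by simp
    qed
    then obtain e where e: "e \<in> A" "e \<notin> ?W" by auto
    have eW: "insert e ?W \<subseteq> \<E>" using e A W by auto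
    have ke: "k (insert e ?W) = k \<E> + 1" using k_insert_notin[OF W(1), of e] e A W by auto
    have WAE: "W0 \<union> A \<subseteq> \<E>" using A assms(1) by auto
    have "?W \<union> A \<subseteq> cl (W0 \<union> A)"
      using closure_of_mono[of W0 "W0 \<union> A" M] closure_of_extensive[of "W0 \<union> A" M] by auto
    then have kA: "k \<E> + 1 \<le> k (?W \<union> A)"
      using k_antimono[of "?W \<union> A" "cl (W0 \<union> A)"] cl_subset[OF WAE] k_cl[OF WAE] A(2) by simp
    have "A \<subseteq> cl (insert e ?W)"
    proof
      fix a assume a: "a \<in> A"
      have "k (?W \<union> A) \<le> k (insert a (insert e ?W))"
        using e a A W by (intro k_antimono) auto
      then show "a \<in> cl (insert e ?W)"
        using in_cl_iff[OF eW, of a] k_insert_le[OF eW, of a] ke kA a A(1) by auto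
    qed
    then show ?thesis using e by blast
  qed
  obtain e where e: "e \<in> A - ?W" "A \<subseteq> cl (insert e ?W)" using grow[OF assms(2,6)] by blast
  obtain f where f: "f \<in> B - ?W" "B \<subseteq> cl (insert f ?W)" using grow[OF assms(3,7)] by blast
  have eE: "e \<in> \<E>" "f \<in> \<E>" using e f assms by auto
  have WE: "insert e ?W \<subseteq> \<E>" "insert f ?W \<subseteq> \<E>" using W eE by auto
  have cover: "g \<in> cl (insert e ?W) \<or> g \<in> cl (insert f ?W)" if "g \<in> \<E>" for g
  proof -
    have "g \<in> W0 \<or> g \<in> A \<or> g \<in> B" using that assms(4) by auto
    then show ?thesis using e(2) f(2) W(2) closure_of_extensive[of "insert e ?W" M] by blast
  qed
  \<comment> \<open>Otherwise one line would contain both representatives and hence all of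
    \<open>M\<close>, although its corank is one.\<close>
  have nef: "e \<notin> cl (insert f ?W)"
  proof
    assume "e \<in> cl (insert f ?W)"
    then have "cl (insert e ?W) \<subseteq> cl (insert f ?W)"
      using closure_of_extensive[of "insert f ?W" M] by (intro cl_least[OF _ WE(2)]) auto
    then have "\<E> \<subseteq> cl (insert f ?W)" using cover by auto
    then have "k (insert f ?W \<union> \<E>) = k (insert f ?W)" by (rule k_cl_un[OF WE(2)])
    then have "k \<E> = k (insert f ?W)" unfolding Un_absorb1[OF WE(2)] .
    then show False using k_insert_notin[OF W(1) eE(2)] f W by simp
  qed
  have "e \<noteq> f" using nef closure_of_extensive[of "insert f ?W" M] by auto
  have "\<not> (e \<in> D \<and> f \<in> D)" if D: "D \<in> circuits (contract M ?W)" for D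
  proof
    assume ef: "e \<in> D \<and> f \<in> D"
    obtain C where C: "C \<in> circuits M" "D = C - ?W" and
      min: "\<And>C'. C' \<in> circuits M \<Longrightarrow> C' - ?W \<noteq> {} \<Longrightarrow> C' - ?W \<subseteq> D \<Longrightarrow> C' - ?W = D"
      using D unfolding contract_def by auto
    show False
    proof (cases "D \<subseteq> {e, f}")
      case True
      then have "C \<subseteq> insert e (insert f ?W)" "e \<in> C" using C(2) ef by auto
      then show False using nef C(1) eE in_closure_of_iff by metis
    next
      case False
      then obtain g where g: "g \<in> D" "g \<noteq> e" "g \<noteq> f" by auto
      \<comment> \<open>An element \<open>g\<close> of the circuit parallel to \<open>x\<close>
        gives a dependent set inside \<open>{g, x}\<close>, which misses \<open>y\<close> and
        contradicts minimality.\<close>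
      have sm: False if h: "x \<in> D" "y \<in> D" "y \<noteq> g" "g \<in> cl (insert x ?W)" "x \<noteq> g" "y \<noteq> x" for x y
      proof -
        have "g \<notin> insert x ?W" using g(1) C(2) h by auto
        then obtain C' where C': "C' \<in> circuits M" "g \<in> C'" "C' \<subseteq> insert g (insert x ?W)"
          using h(4) in_closure_of_iff[of g M "insert x ?W"] by auto
        have "C' - ?W \<noteq> {}" using C'(2) g(1) C(2) by auto
        moreover have "C' - ?W \<subseteq> D" using C'(3) g(1) h(1) by auto
        ultimately have "C' - ?W = D" by (rule min[OF C'(1)])
        then show False using h C'(3) C(2) by auto
      qed
      have "g \<in> \<E>" using circuit_subset[OF C(1)] C(2) g(1) by auto
      then have "g \<in> cl (insert e ?W) \<or> g \<in> cl (insert f ?W)" by (rule cover)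
      then show False using sm[of e f] sm[of f e] ef g \<open>e \<noteq> f\<close> by auto
    qed
  qed
  moreover have "ground (contract M ?W) = \<E> - ?W" by (simp add: contract_def)
  then have "e \<in> ground (contract M ?W)" "f \<in> ground (contract M ?W)" using e f eE by auto
  ultimately have "\<not> connected_matroid (contract M ?W)"
    unfolding connected_matroid_def using \<open>e \<noteq> f\<close> by metis
  then show ?thesis using W(3) by blast
qed

lemma not_unbreakable_iff:
  assumes "connected_matroid M"
  shows "\<not> unbreakable M \<longleftrightarrow> (\<exists>W. is_flat M W \<and> \<not> connected_matroid (contract M W))"
  unfolding unbreakable_def using assms by blast

end

section \<open>Components and subgraphs\<close>

lemma connected_graph_iff_reach:
  assumes "finite_graph H"
  shows "connected_graph H \<longleftrightarrow> verts H \<noteq> {} \<and> (\<forall>u\<in>verts H. \<forall>v\<in>verts H. (u, v) \<in> reach H (edges H))"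
proof -
  have "(\<exists>P. is_path H u v P) \<longleftrightarrow> (u, v) \<in> reach H (edges H)" if "v \<in> verts H" for u v
  proof
    assume "\<exists>P. is_path H u v P"
    then obtain P where P: "is_path H u v P" by blast
    show "(u, v) \<in> reach H (edges H)"
      by (rule reach_mono[OF is_path_basic(3)[OF P] is_path_basic(7)[OF P]])
  next
    assume "(u, v) \<in> reach H (edges H)"
    from reach_imp_path[OF this that subset_refl assms] show "\<exists>P. is_path H u v P" by metis
  qed
  then show ?thesis unfolding connected_graph_def by simp
qed

text \<open>Each vertex of the closed sequence is an end of one of its edges, so the vertices lie in
  \<open>H\<close> as soon as the edges do.\<close>

lemma is_cycle_subgraph:
  assumes "ends H = ends G" "edges H \<subseteq> edges G" "verts H \<subseteq> verts G"
    "\<And>e. e \<in> edges H \<Longrightarrow> ends G e \<subseteq> verts H"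
  shows "is_cycle H C \<longleftrightarrow> is_cycle G C \<and> C \<subseteq> edges H"
proof
  assume H: "is_cycle H C"
  then show "is_cycle G C \<and> C \<subseteq> edges H"
  proof -
    obtain vs es where c: "es \<noteq> []" "length vs = length es" "distinct vs" "distinct es"
       "set vs \<subseteq> verts H" "set es \<subseteq> edges H" "set es = C"
       "\<forall>i<length es. ends H (es ! i) = {vs ! i, vs ! (Suc i mod length es)}"
      using H unfolding is_cycle_def by (elim conjE exE) (rule that; assumption)
    then have "is_cycle G C" unfolding is_cycle_def using assms(1-3)
      by (intro exI[of _ vs] exI[of _ es]) auto
    then show ?thesis using cycle_basic(1)[OF H] by simp
  qed
next
  assume *: "is_cycle G C \<and> C \<subseteq> edges H"
  then obtain vs es where c: "es \<noteq> []" "length vs = length es" "distinct vs" "distinct es"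
     "set vs \<subseteq> verts G" "set es \<subseteq> edges G" "set es = C"
     "\<forall>i<length es. ends G (es ! i) = {vs ! i, vs ! (Suc i mod length es)}"
    unfolding is_cycle_def by (elim conjE exE) (rule that; assumption)
  have "set vs \<subseteq> verts H"
  proof
    fix x assume "x \<in> set vs"
    then obtain i where i: "i < length es" "x = vs ! i" using c(2) by (metis in_set_conv_nth)
    then have "es ! i \<in> edges H" using * c(7) nth_mem by blast
    then show "x \<in> verts H" using assms(4) c(8) i by blast
  qed
  then show "is_cycle H C" unfolding is_cycle_def using c * assms(1)
    by (intro exI[of _ vs] exI[of _ es]) simp
qed

context qbg
begin

abbreviation "E \<equiv> edges G"
abbreviation "V \<equiv> verts G"

section \<open>Edges inside a vertex set and components of an edge set\<close>

definition inner :: "'v set \<Rightarrow> 'e set" where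
  "inner A = {e \<in> E. ends G e \<subseteq> A}"

lemma edges_induced: "edges (induced G A) = inner A"
  by (simp add: induced_def inner_def)

lemma connected_induced_delete:
  assumes "A \<subseteq> V"
  shows "connected_graph (delete_edges (induced G A) X) \<longleftrightarrow>
    A \<noteq> {} \<and> (\<forall>u\<in>A. \<forall>v\<in>A. (u, v) \<in> reach G (inner A - X))"
proof -
  let ?H = "delete_edges (induced G A) X"
  have H: "verts ?H = A" "edges ?H = inner A - X" "ends ?H = ends G"
    using assms by (auto simp: delete_edges_def induced_def inner_def)
  have "finite_graph ?H"
    using finG(1) assms finite_subset[OF assms] unfolding finite_graph_def H by (auto simp: inner_def)
  from connected_graph_iff_reach[OF this] show ?thesis unfolding H reach_cong[OF H(3)] .
qed

lemma connected_induced: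
  assumes "A \<subseteq> V"
  shows "connected_graph (induced G A) \<longleftrightarrow> A \<noteq> {} \<and> (\<forall>u\<in>A. \<forall>v\<in>A. (u, v) \<in> reach G (inner A))"
proof -
  have "delete_edges (induced G A) {} = induced G A" by (simp add: delete_edges_def induced_def)
  then show ?thesis using connected_induced_delete[OF assms, of "{}"] by simp
qed

lemma cycle_induced:
  assumes "A \<subseteq> V"
  shows "is_cycle (induced G A) C \<longleftrightarrow> is_cycle G C \<and> verts_of G C \<subseteq> A"
proof -
  have "is_cycle (induced G A) C \<longleftrightarrow> is_cycle G C \<and> C \<subseteq> inner A"
    unfolding edges_induced[symmetric]
    by (rule is_cycle_subgraph) (use assms in \<open>auto simp: induced_def\<close>)
  moreover have "C \<subseteq> inner A \<longleftrightarrow> verts_of G C \<subseteq> A" if "is_cycle G C"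
    using cycle_basic(1)[OF that] unfolding inner_def verts_of_def by auto
  ultimately show ?thesis by blast
qed

lemma contains_cycle_induced:
  assumes "A \<subseteq> V" "S \<subseteq> \<B> \<union> \<L> \<union> \<F>"
  shows "contains_cycle_in (induced G A) S \<longleftrightarrow> (\<exists>C\<in>S. verts_of G C \<subseteq> A)"
  unfolding contains_cycle_in_def cycle_induced[OF assms(1)] using assms(2) cycle_class by blast

lemma balancing_iff:
  "balancing_set G \<B> X \<longleftrightarrow> X \<subseteq> E \<and> (\<exists>C. is_cycle G C \<and> C \<notin> \<B>) \<and>
    (\<forall>C. is_cycle G C \<longrightarrow> C \<subseteq> E - X \<longrightarrow> C \<in> \<B>)"
proof -
  have "is_cycle (delete_edges G X) C \<longleftrightarrow> is_cycle G C \<and> C \<subseteq> edges (delete_edges G X)" for C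
    by (rule is_cycle_subgraph) (use finG(1) in \<open>auto simp: delete_edges_def finite_graph_def\<close>)
  then show ?thesis unfolding balancing_set_def by (auto simp: delete_edges_def)
qed

definition comps :: "'e set \<Rightarrow> 'v set set" where
  "comps X = comp X ` V"

lemma reach_verts: "(u, v) \<in> reach G X \<Longrightarrow> X \<subseteq> E \<Longrightarrow> u \<in> V \<Longrightarrow> v \<in> V"
proof (rule reach_closed[of u v G X])
  fix e x y assume *: "X \<subseteq> E" "e \<in> X" "ends G e = {x, y}"
  then have "ends G e \<subseteq> V" using finG(1) unfolding finite_graph_def by blast
  then show "y \<in> V" using *(3) by auto
qed

lemma finite_comps [simp]: "finite (comps X)"
  unfolding comps_def using finG(2) by simp

lemma nonF_subset: "nonF X \<subseteq> comps X"
  unfolding nonF_def comps_def by auto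

lemma comps_disjoint:
  assumes "K \<in> comps X" "K' \<in> comps X" "K \<noteq> K'" shows "K \<inter> K' = {}"
proof (rule ccontr)
  obtain a b where ab: "K = comp X a" "K' = comp X b" using assms unfolding comps_def by blast
  assume "K \<inter> K' \<noteq> {}"
  then obtain z where az: "(a, z) \<in> reach G X" and bz: "(b, z) \<in> reach G X" using ab by auto
  have "(a, b) \<in> reach G X" by (rule reach_trans[OF az reach_sym[OF bz]])
  then show False using ab assms(3) comp_eq_iff by simp
qed

lemma comps_nonempty: "K \<in> comps X \<Longrightarrow> K \<noteq> {}"
  unfolding comps_def comp_def using reach_refl[of _ G X] by blast

lemma comps_cover: "X \<subseteq> E \<Longrightarrow> \<Union> (comps X) = V"
  unfolding comps_def using reach_verts[of _ _ X] by (auto intro: reach_refl)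

lemma comps_reach:
  assumes "K \<in> comps X" "u \<in> K" shows "v \<in> K \<longleftrightarrow> (u, v) \<in> reach G X"
proof -
  obtain a where a: "K = comp X a" using assms(1) unfolding comps_def by blast
  then have "K = comp X u" using assms(2) comp_eq_iff[of X a u] by simp
  then show ?thesis by simp
qed

lemma comps_connected:
  assumes "K \<in> comps X" "u \<in> K" "v \<in> K"
  shows "(u, v) \<in> reach G {e \<in> X. ends G e \<subseteq> K}"
proof (rule reach_restrict)
  show "(u, v) \<in> reach G X" using comps_reach[OF assms(1,2), of v] assms(3) by simp
  fix e x y assume "e \<in> X" "ends G e = {x, y}" "x \<in> K"
  then show "y \<in> K" using comps_reach[OF assms(1), of x y] reach_edge[of e X G x y] by simp
qed fact

lemma comps_edge:
  assumes "K \<in> comps X" "e \<in> X" "ends G e \<inter> K \<noteq> {}" "X \<subseteq> E" shows "ends G e \<subseteq> K"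
proof -
  obtain x y where xy: "ends G e = {x, y}" using ends_cases[of e] subsetD[OF assms(4,2)] by metis
  have r: "(x, y) \<in> reach G X" by (rule reach_edge[OF assms(2) xy])
  have "x \<in> K \<longleftrightarrow> y \<in> K"
    using comps_reach[OF assms(1), of x y] comps_reach[OF assms(1), of y x] r reach_sym[OF r] by auto
  then show ?thesis using xy assms(3) by auto
qed

lemma cycle_in_comp:
  assumes "is_cycle G C" "C \<subseteq> X"
  shows "\<exists>K\<in>comps X. verts_of G C \<subseteq> K"
proof -
  obtain x where x: "x \<in> verts_of G C" using cycle_basic(5)[OF assms(1)] by blast
  have "verts_of G C \<subseteq> comp X x"
    using reach_mono[OF assms(2) cycle_basic(6)[OF assms(1) x]] by auto
  moreover have "x \<in> V" using x cycle_basic(4)[OF assms(1)] by auto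
  ultimately show ?thesis unfolding comps_def by blast
qed

lemma comps_eqI:
  assumes "\<And>A. A \<in> \<P> \<Longrightarrow> A \<noteq> {}" "\<Union> \<P> = V"
    and edge: "\<And>e. e \<in> X \<Longrightarrow> \<exists>A\<in>\<P>. ends G e \<subseteq> A"
    and conn: "\<And>A u v. A \<in> \<P> \<Longrightarrow> u \<in> A \<Longrightarrow> v \<in> A \<Longrightarrow> (u, v) \<in> reach G X"
    and disj: "\<And>A B. A \<in> \<P> \<Longrightarrow> B \<in> \<P> \<Longrightarrow> A \<noteq> B \<Longrightarrow> A \<inter> B = {}"
  shows "comps X = \<P>"
proof -
  have c: "comp X u = A" if A: "A \<in> \<P>" "u \<in> A" for A u
  proof
    show "A \<subseteq> comp X u" using conn[OF A] by auto
    show "comp X u \<subseteq> A"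
    proof
      fix v assume "v \<in> comp X u"
      then have "(u, v) \<in> reach G X" by simp
      then show "v \<in> A"
      proof (rule reach_closed[OF _ A(2)])
        fix e x y assume e: "e \<in> X" "ends G e = {x, y}" "x \<in> A"
        obtain B where B: "B \<in> \<P>" "ends G e \<subseteq> B" using edge[OF e(1)] by blast
        then have "B = A" using disj[OF B(1) A(1)] e by auto
        then show "y \<in> A" using B e by auto
      qed
    qed
  qed
  show ?thesis
  proof (intro equalityI subsetI)
    fix K assume "K \<in> comps X"
    then obtain u where u: "u \<in> V" "K = comp X u" unfolding comps_def by blast
    then obtain A where "A \<in> \<P>" "u \<in> A" using assms(2) by blast
    then show "K \<in> \<P>" using c u by simp
  next
    fix A assume A: "A \<in> \<P>"
    then obtain u where u: "u \<in> A" using assms(1) by blast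
    then have "u \<in> V" using A assms(2) by auto
    then show "A \<in> comps X" unfolding comps_def using c[OF A u] by blast
  qed
qed

lemma crk_balanced:
  assumes "\<And>C. is_cycle G C \<Longrightarrow> C \<subseteq> X \<Longrightarrow> C \<in> \<B>"
  shows "crk X = card (comps X) + 1"
proof -
  have L: "\<not> (\<exists>C\<in>\<L>. C \<subseteq> X)" and F: "\<not> (\<exists>C\<in>\<F>. C \<subseteq> X)"
    using assms cycle_class class_disjoint by blast+
  then have "nonF X = comps X" unfolding nonF_def comps_def hasF_def by blast
  then show ?thesis unfolding crk_def lifted_def using L by simp
qed

text \<open>Two situations give the same value: a cycle in \<F> takes \<open>K\<close> out of the
  count while the summand one remains, or there is no cycle in \<F> and a cycle in \<L> removes the
  summand.\<close>

lemma crk_one: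
  assumes "K \<in> comps X" "is_cycle G C" "C \<subseteq> X" "C \<notin> \<B>"
    "\<And>D. D \<in> \<F> \<Longrightarrow> D \<subseteq> X \<Longrightarrow> verts_of G D \<subseteq> K" "C \<in> \<F> \<or> (\<exists>Z\<in>\<L>. Z \<subseteq> X)"
  shows "crk X = card (comps X)"
proof (cases "\<exists>D\<in>\<F>. D \<subseteq> X")
  case True
  then obtain D where D: "D \<in> \<F>" "D \<subseteq> X" by blast
  then have DK: "verts_of G D \<subseteq> K" using assms(5) by blast
  obtain d where d: "d \<in> verts_of G D" using cycle_basic(5)[of G D] cycle_class D(1) by blast
  have hasF: "hasF X u \<longleftrightarrow> u \<in> K" for u
  proof
    assume "hasF X u"
    then obtain D' x where D': "D' \<in> \<F>" "D' \<subseteq> X" "x \<in> verts_of G D'" "(u, x) \<in> reach G X"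
      unfolding hasF_def by blast
    then have "x \<in> K" using assms(5) by blast
    then show "u \<in> K" using comps_reach[OF assms(1), of x u] reach_sym[OF D'(4)] by simp
  next
    assume "u \<in> K"
    then have "(u, d) \<in> reach G X" using comps_reach[OF assms(1), of u d] d DK by auto
    then show "hasF X u" unfolding hasF_def using D d by blast
  qed
  have "nonF X = comps X - {K}"
  proof -
    have "comp X v \<noteq> K \<longleftrightarrow> v \<notin> K" if "v \<in> V" for v
    proof -
      have "v \<in> comp X v" by simp
      moreover have "comp X v \<in> comps X" using that unfolding comps_def by blast
      ultimately show ?thesis using comps_disjoint[OF _ assms(1), of "comp X v"] by blast
    qed
    then show ?thesis unfolding nonF_def comps_def hasF by blast
  qed
  then have "Suc (card (nonF X)) = card (comps X)" using card_Suc_Diff1[OF finite_comps assms(1)] by simp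
  moreover have "\<not> lifted X" unfolding lifted_def using True by blast
  ultimately show ?thesis unfolding crk_def by simp
next
  case False
  then have "nonF X = comps X" unfolding nonF_def comps_def hasF_def by blast
  moreover have "lifted X" unfolding lifted_def using False assms(3,6) by blast
  ultimately show ?thesis unfolding crk_def by simp
qed

text \<open>Every cycle in \<F> meets \<open>Z\<close>, so all of them lie in the component of
  \<open>Z\<close> and \<open>crk_one\<close> applies.\<close>

lemma crk_lifted:
  assumes "Z \<in> \<L>" "Z \<subseteq> X"
  shows "crk X = card (comps X)"
proof -
  have cZ: "is_cycle G Z" "Z \<notin> \<B>" using assms(1) cycle_class class_disjoint by auto
  obtain K where K: "K \<in> comps X" "verts_of G Z \<subseteq> K" using cycle_in_comp[OF cZ(1) assms(2)] by blast
  show ?thesis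
  proof (rule crk_one[OF K(1) cZ(1) assms(2) cZ(2)])
    fix D assume D: "D \<in> \<F>" "D \<subseteq> X"
    obtain K' where K': "K' \<in> comps X" "verts_of G D \<subseteq> K'" using cycle_in_comp D cycle_class by blast
    have "K \<inter> K' \<noteq> {}" using LF_meet[OF assms(1) D(1)] K(2) K'(2) by auto
    then show "verts_of G D \<subseteq> K" using comps_disjoint[OF K(1) K'(1)] K'(2) by auto
  qed (use assms in auto)
qed

lemma crk_single:
  assumes "K \<in> comps X" "is_cycle G C" "C \<subseteq> X" "C \<notin> \<B>"
    "\<And>D. is_cycle G D \<Longrightarrow> D \<notin> \<B> \<Longrightarrow> D \<subseteq> X \<Longrightarrow> verts_of G D \<subseteq> K"
  shows "crk X = card (comps X)"
proof -
  have "C \<in> \<F> \<or> (\<exists>Z\<in>\<L>. Z \<subseteq> X)" using assms(2-4) cycle_class by blast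
  then show ?thesis
    by (rule crk_one[OF assms(1-4), rotated]) (use assms(5) cycle_class class_disjoint in blast)
qed

lemma circuit_subset_edges:
  assumes "K \<in> circuits M" shows "K \<subseteq> E"
  using assms
proof (cases rule: circuit_cases)
  case 1
  then show ?thesis using cycle_class cycle_basic(1) by blast
next
  case 2
  then obtain u v P Q R where *: "is_path G u v P" "is_path G u v Q" "is_path G u v R" "K = P \<union> Q \<union> R"
    unfolding is_theta_def by blast
  then have "P \<subseteq> E" "Q \<subseteq> E" "R \<subseteq> E" using is_path_basic(3)[of G] by simp_all
  then show ?thesis using *(4) by simp
next
  case (3 C D)
  then have "is_cycle G C" "is_cycle G D" unfolding tight_handcuff_def by auto
  then show ?thesis using 3(1) cycle_basic(1)[of G] by simp
next
  case (4 C D)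
  then have "is_cycle G C" "is_cycle G D" unfolding vertex_disjoint_cycles_def by auto
  then show ?thesis using 4(1) cycle_basic(1)[of G] by simp
next
  case (5 C D P)
  then obtain u v where "is_cycle G C" "is_cycle G D" "is_path G u v P"
    unfolding loose_handcuff_def vertex_disjoint_cycles_def by blast
  then have "C \<subseteq> E" "D \<subseteq> E" "P \<subseteq> E" using cycle_basic(1)[of G] is_path_basic(3)[of G] by simp_all
  then show ?thesis using 5(1) by simp
qed

lemma ground_M [simp]: "ground M = E"
  by (simp add: qb_matroid_def)

lemma in_closure_iff_spans:
  assumes "X \<subseteq> E" "e \<in> E" "e \<notin> X" shows "e \<in> closure_of M X \<longleftrightarrow> spans X e"
proof -
  have "e \<in> closure_of M X \<longleftrightarrow> (\<exists>C\<in>circuits M. e \<in> C \<and> C \<subseteq> insert e X)"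
    using in_closure_of_iff[of e M X] assms by simp
  then show ?thesis using spans_imp_circuit[OF _ assms] circuit_imp_spans by blast
qed

sublocale corank M crk
proof
  show "finite (ground M)" using finG(3) by simp
  show "C \<subseteq> ground M" if "C \<in> circuits M" for C using circuit_subset_edges[OF that] by simp
  show "if e \<in> closure_of M X then crk (insert e X) = crk X else crk X = Suc (crk (insert e X))"
    if "X \<subseteq> ground M" "e \<in> ground M" "e \<notin> X" for X e
    using that crk_insert[of X e] in_closure_iff_spans[of X e] by simp
qed

end

section \<open>Sufficiency\<close>

context corank
begin

lemma subset_cl_if_k_eq:
  assumes "Y \<subseteq> \<E>" "X \<subseteq> Y" "k Y = k X" shows "Y \<subseteq> cl X"
proof
  fix y assume y: "y \<in> Y"
  have X: "X \<subseteq> \<E>" "y \<in> \<E>" "insert y X \<subseteq> Y" using assms y by auto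
  have "k Y \<le> k (insert y X)" "k (insert y X) \<le> k X"
    using k_antimono[OF X(3) assms(1)] k_insert_le[OF X(1,2)] by auto
  then show "y \<in> cl X" using in_cl_iff[OF X(1,2)] assms(3) by simp
qed

end

context qbg
begin

text \<open>The connecting walks may leave \<open>A\<close>, so one set \<open>X\<close> can be
  tested on several parts. For \<open>X \<subseteq> inner A\<close> they stay inside, and for
  nonempty \<open>A\<close> the notion becomes connectedness of the subgraph on
  \<open>A\<close>.\<close>

definition conn_in :: "'e set \<Rightarrow> 'v set \<Rightarrow> bool" where
  "conn_in X A \<longleftrightarrow> (\<forall>u\<in>A. \<forall>v\<in>A. (u, v) \<in> reach G X)"

lemma conn_in_mono: "conn_in X A \<Longrightarrow> X \<subseteq> Y \<Longrightarrow> conn_in Y A"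
  unfolding conn_in_def using reach_mono by metis

lemma conn_in_Un:
  assumes "conn_in X A" "conn_in X B" "a \<in> A" "b \<in> B" "(a, b) \<in> reach G X"
  shows "conn_in X (A \<union> B)"
proof -
  have 1: "(u, v) \<in> reach G X" if "u \<in> A" "v \<in> B" for u v
    using reach_trans[OF _ reach_trans[OF assms(5)], of u v] assms(1-4) that unfolding conn_in_def by simp
  have 2: "(v, u) \<in> reach G X" if "u \<in> A" "v \<in> B" for u v
    using reach_sym[OF 1[OF that]] .
  show ?thesis unfolding conn_in_def
  proof (intro ballI)
    fix u v assume "u \<in> A \<union> B" "v \<in> A \<union> B"
    then show "(u, v) \<in> reach G X" using 1 2 assms(1,2) unfolding conn_in_def by blast
  qed
qed

text \<open>Taken as a minimal subset that keeps \<open>A\<close> joined: an edge on a cycle could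
  be removed, because the rest of the cycle replaces it.\<close>

lemma spanning_tree:
  assumes "conn_in Y A" "Y \<subseteq> E"
  obtains T where "T \<subseteq> Y" "conn_in T A" "\<And>C. is_cycle G C \<Longrightarrow> \<not> C \<subseteq> T"
proof -
  have "finite {T. T \<subseteq> Y \<and> conn_in T A}"
    using finite_subset[OF assms(2) finG(3)] by simp
  from finite_has_minimal2[OF this, of Y] assms(1) obtain T where T: "T \<subseteq> Y" "conn_in T A"
    and min: "\<And>T'. T' \<subseteq> Y \<Longrightarrow> conn_in T' A \<Longrightarrow> T' \<subseteq> T \<Longrightarrow> T = T'" by auto
  have "\<not> C \<subseteq> T" if C: "is_cycle G C" for C
  proof
    assume CT: "C \<subseteq> T"
    obtain e where e: "e \<in> C" using cycle_basic(3)[OF C] by blast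
    obtain u v where uv: "ends G e = {u, v}" using cycle_edge_ends[OF C e] .
    have Te: "insert e (T - {e}) = T" using e CT by auto
    have "C - {e} \<subseteq> T - {e}" using CT by auto
    from reach_mono[OF this cycle_basic(7)[OF C e uv]] have r: "(u, v) \<in> reach G (T - {e})" .
    have "(x, y) \<in> reach G (T - {e})" if "(x, y) \<in> reach G T" for x y
    proof -
      have "(x, y) \<in> reach G (insert e (T - {e}))" using that Te by simp
      then show ?thesis unfolding reach_insert[OF uv]
        using reach_trans[OF _ reach_trans[OF r], of x y] reach_trans[OF _ reach_trans[OF reach_sym[OF r]], of x y]
        by blast
    qed
    then have "conn_in (T - {e}) A" using T(2) unfolding conn_in_def by blast
    then have "T = T - {e}" using min[of "T - {e}"] T(1) by auto
    then show False using e CT by auto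
  qed
  then show ?thesis using that T by blast
qed

section \<open>Edges inside and between the parts of a partition\<close>

abbreviation "between \<equiv> edges_between G"

lemma between_cases:
  assumes "e \<in> between A B" obtains u v where "e \<in> E" "ends G e = {u, v}" "u \<in> A" "v \<in> B"
  using assms unfolding edges_between_def by blast

lemma between_comm: "between A B = between B A"
  unfolding edges_between_def by (auto simp: insert_commute)

lemma between_Un: "between A (B \<union> C) = between A B \<union> between A C"
  unfolding edges_between_def by blast

lemma between_subset: "between A B \<subseteq> E"
  unfolding edges_between_def by auto

lemma inner_subset: "inner A \<subseteq> E"
  unfolding inner_def by auto

lemma inner_mono: "A \<subseteq> B \<Longrightarrow> inner A \<subseteq> inner B"
  unfolding inner_def by auto

lemma between_inner_Un: "between A B \<subseteq> inner (A \<union> B)"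
  unfolding edges_between_def inner_def by auto

lemma ends_nonempty: "e \<in> E \<Longrightarrow> ends G e \<noteq> {}"
  by (metis ends_cases insert_not_empty)

lemma inner_disjoint: "A \<inter> B = {} \<Longrightarrow> inner A \<inter> inner B = {}"
  unfolding inner_def using ends_nonempty by blast

lemma between_inner_disjoint: "A \<inter> C = {} \<or> B \<inter> C = {} \<Longrightarrow> between A B \<inter> inner C = {}"
  unfolding edges_between_def inner_def by auto

lemma cycle_inner:
  assumes "is_cycle G C" "verts_of G C \<subseteq> A" shows "C \<subseteq> inner A"
  using cycle_basic(1)[OF assms(1)] assms(2) unfolding inner_def verts_of_def by auto

lemma edges_partition2:
  assumes "V = A \<union> B" "e \<in> E"
  shows "e \<in> inner A \<or> e \<in> inner B \<or> e \<in> between A B"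
proof -
  obtain u v where "ends G e = {u, v}" "u \<in> V" "v \<in> V" using ends_cases[OF assms(2)] .
  then show ?thesis using assms unfolding inner_def edges_between_def by (auto simp: insert_commute)
qed

lemma edges_partition3:
  assumes "V = A \<union> B \<union> C" "e \<in> E"
  shows "e \<in> inner A \<or> e \<in> inner B \<or> e \<in> inner C \<or> e \<in> between A B \<or> e \<in> between A C \<or> e \<in> between B C"
proof -
  obtain u v where "ends G e = {u, v}" "u \<in> V" "v \<in> V" using ends_cases[OF assms(2)] .
  then show ?thesis using assms unfolding inner_def edges_between_def by (auto simp: insert_commute)
qed

lemma comps2:
  assumes "V = A \<union> B" "A \<inter> B = {}" "A \<noteq> {}" "B \<noteq> {}" "X \<subseteq> inner A \<union> inner B" "conn_in X A" "conn_in X B"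
  shows "comps X = {A, B}" "card (comps X) = 2"
proof -
  show "comps X = {A, B}"
    by (rule comps_eqI) (use assms in \<open>auto simp: conn_in_def inner_def\<close>)
  moreover have "A \<noteq> B" using assms(2,3) by auto
  ultimately show "card (comps X) = 2" by simp
qed

lemma comps3:
  assumes "V = A \<union> B \<union> C" "A \<inter> B = {}" "A \<inter> C = {}" "B \<inter> C = {}" "A \<noteq> {}" "B \<noteq> {}" "C \<noteq> {}"
    "X \<subseteq> inner A \<union> inner B \<union> inner C" "conn_in X A" "conn_in X B" "conn_in X C"
  shows "comps X = {A, B, C}" "card (comps X) = 3"
proof -
  have *: "X \<subseteq> {e. ends G e \<subseteq> A \<or> ends G e \<subseteq> B \<or> ends G e \<subseteq> C}" using assms(8) by (auto simp: inner_def)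
  show "comps X = {A, B, C}"
  proof (rule comps_eqI)
    show "\<Union> {A, B, C} = V" using assms(1) by auto
    show "K \<noteq> {}" if "K \<in> {A, B, C}" for K using that assms(5-7) by auto
    show "\<exists>K\<in>{A, B, C}. ends G e \<subseteq> K" if "e \<in> X" for e using that * by auto
    show "(u, v) \<in> reach G X" if "K \<in> {A, B, C}" "u \<in> K" "v \<in> K" for K u v
      using that assms(9-11) by (auto simp: conn_in_def)
    show "K \<inter> K' = {}" if "K \<in> {A, B, C}" "K' \<in> {A, B, C}" "K \<noteq> K'" for K K'
      using that assms(2-4) by (auto simp: Int_commute)
  qed
  moreover have "A \<noteq> B" "A \<noteq> C" "B \<noteq> C" using assms(2-7) by auto
  ultimately show "card (comps X) = 3" by simp
qed

lemma comps1:
  assumes "V \<noteq> {}" "X \<subseteq> E" "conn_in X V"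
  shows "comps X = {V}" "card (comps X) = 1"
proof -
  show "comps X = {V}"
  proof (rule comps_eqI)
    show "\<exists>K\<in>{V}. ends G e \<subseteq> K" if "e \<in> X" for e
      using that assms(2) finG(1) unfolding finite_graph_def by blast
  qed (use assms in \<open>auto simp: conn_in_def\<close>)
  then show "card (comps X) = 1" by simp
qed

lemma crk_single2:
  assumes "comps X = {A, B}" "card (comps X) = 2"
    "is_cycle G C" "C \<subseteq> X" "C \<notin> \<B>"
    "\<And>D. is_cycle G D \<Longrightarrow> D \<subseteq> X \<Longrightarrow> verts_of G D \<subseteq> B \<Longrightarrow> D \<in> \<B>"
  shows "crk X = 2"
proof -
  have "crk X = card (comps X)"
  proof (rule crk_single[OF _ assms(3-5)])
    show "A \<in> comps X" using assms(1) by simp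
    fix D assume D: "is_cycle G D" "D \<notin> \<B>" "D \<subseteq> X"
    obtain K where "K \<in> comps X" "verts_of G D \<subseteq> K" using cycle_in_comp[OF D(1,3)] by blast
    then show "verts_of G D \<subseteq> A" using assms(1,6) D by auto
  qed
  then show ?thesis using assms(2) by simp
qed

lemma crk_single3:
  assumes "comps X = {A, B, A'}" "card (comps X) = 3"
    "is_cycle G C" "C \<subseteq> X" "C \<notin> \<B>"
    "\<And>D. is_cycle G D \<Longrightarrow> D \<subseteq> X \<Longrightarrow> verts_of G D \<subseteq> B \<or> verts_of G D \<subseteq> A' \<Longrightarrow> D \<in> \<B>"
  shows "crk X = 3"
proof -
  have "crk X = card (comps X)"
  proof (rule crk_single[OF _ assms(3-5)])
    show "A \<in> comps X" using assms(1) by simp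
    fix D assume D: "is_cycle G D" "D \<notin> \<B>" "D \<subseteq> X"
    obtain K where "K \<in> comps X" "verts_of G D \<subseteq> K" using cycle_in_comp[OF D(1,3)] by blast
    then show "verts_of G D \<subseteq> A" using assms(1,6) D by auto
  qed
  then show ?thesis using assms(2) by simp
qed

end

section \<open>Connected graphs and the sufficient conditions\<close>

locale connected_qbg = qbg +
  assumes connG: "conn_in E V" and V_ne: "V \<noteq> {}"
begin

definition breakable :: bool where
  "breakable \<longleftrightarrow> (\<exists>W. is_flat M W \<and> \<not> connected_matroid (contract M W))"

lemma cross_edge:
  assumes "V = A \<union> B" "A \<inter> B = {}" "A \<noteq> {}" "B \<noteq> {}"
  shows "between A B \<noteq> {}"
proof
  assume empty: "between A B = {}"
  obtain a b where ab: "a \<in> A" "b \<in> B" using assms by blast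
  then have "(a, b) \<in> reach G E" using connG assms(1) unfolding conn_in_def by auto
  then have "b \<in> A"
  proof (rule reach_closed[OF _ ab(1)])
    fix e x y assume e: "e \<in> E" "ends G e = {x, y}" "x \<in> A"
    then have "e \<notin> inner B" using assms(2) unfolding inner_def by auto
    then have "e \<in> inner A" using edges_partition2[OF assms(1) e(1)] empty by auto
    then show "y \<in> A" using e(2) unfolding inner_def by auto
  qed
  then show False using ab assms(2) by auto
qed

lemma between_conn:
  assumes "between A B \<noteq> {}" "between A B \<subseteq> X" "conn_in X A" "conn_in X B"
  shows "conn_in X (A \<union> B)"
proof -
  obtain e where e: "e \<in> between A B" using assms(1) by auto
  then obtain u v where uv: "ends G e = {u, v}" "u \<in> A" "v \<in> B" using between_cases by metis
  have "(u, v) \<in> reach G X" by (rule reach_edge[OF _ uv(1)]) (use e assms(2) in auto)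
  then show ?thesis by (rule conn_in_Un[OF assms(3,4) uv(2,3)])
qed

lemma crk_E:
  "(\<And>C. is_cycle G C \<Longrightarrow> C \<in> \<B>) \<Longrightarrow> crk E = 2"
  "is_cycle G C \<Longrightarrow> C \<notin> \<B> \<Longrightarrow> crk E = 1"
proof -
  have c: "comps E = {V}" "card (comps E) = 1" using comps1[OF V_ne subset_refl connG] by auto
  show "crk E = 2" if "\<And>C. is_cycle G C \<Longrightarrow> C \<in> \<B>"
    using crk_balanced[of E] that c by simp
  show "crk E = 1" if C: "is_cycle G C" "C \<notin> \<B>"
  proof -
    have "crk E = card (comps E)"
    proof (rule crk_single[of V E C, OF _ C(1) _ C(2)])
      show "V \<in> comps E" using c by simp
      show "C \<subseteq> E" by (rule cycle_basic(1)[OF C(1)])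
      show "verts_of G D \<subseteq> V" if "is_cycle G D" for D by (rule cycle_basic(4)[OF that])
    qed
    then show ?thesis using c by simp
  qed
qed

lemma breakableI:
  assumes "W0 \<subseteq> E" "A \<subseteq> E" "B \<subseteq> E" "E \<subseteq> W0 \<union> A \<union> B"
    "crk W0 = crk E + 2" "crk (W0 \<union> A) = crk E + 1" "crk (W0 \<union> B) = crk E + 1"
  shows breakable
  using disconnected_contractionI[of W0 A B] assms unfolding breakable_def by simp

text \<open>\<open>W0\<close> consists of all edges inside the parts. Adding the edges from
  \<open>C\<close> to \<open>A\<close>, or those from \<open>C\<close> to \<open>B\<close>, merges
  two components, and these additions exhaust the graph since \<open>A\<close> and \<open>B\<close>
  are not adjacent. By \<open>alt\<close> the difference between \<open>crk\<close> and the number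
  of components is the same for all sets compared.\<close>

lemma suff_i:
  assumes p: "V = A \<union> B \<union> C" "A \<inter> B = {}" "A \<inter> C = {}" "B \<inter> C = {}" "A \<noteq> {}" "B \<noteq> {}" "C \<noteq> {}"
    and c: "conn_in (inner A) A" "conn_in (inner B) B" "conn_in (inner C) C" and AB: "between A B = {}"
    and alt: "(\<exists>Z\<in>\<L>. Z \<subseteq> inner A \<union> inner B \<union> inner C) \<or> (\<forall>Z. is_cycle G Z \<longrightarrow> Z \<in> \<B>)"
  shows breakable
proof -
  let ?W = "inner A \<union> inner B \<union> inner C"
  have W: "?W \<subseteq> E" using inner_subset by auto
  have cW: "conn_in ?W A" "conn_in ?W B" "conn_in ?W C"
    using c by (auto intro: conn_in_mono)
  have "between A (B \<union> C) \<noteq> {}" "between B (A \<union> C) \<noteq> {}" using p by (intro cross_edge; auto)+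
  then have ne: "between A C \<noteq> {}" "between B C \<noteq> {}"
    using AB between_comm[of B A] by (auto simp: between_Un)
  have 0: "card (comps ?W) = 3" using comps3(2)[OF p] cW by auto
  have 1: "card (comps (?W \<union> between A C)) = 2"
  proof (rule comps2(2)[of "A \<union> C" B])
    have "conn_in (?W \<union> between A C) A" "conn_in (?W \<union> between A C) C" using cW by (auto intro: conn_in_mono)
    then show "conn_in (?W \<union> between A C) (A \<union> C)" by (intro between_conn ne) auto
    show "conn_in (?W \<union> between A C) B" using cW by (auto intro: conn_in_mono)
    show "?W \<union> between A C \<subseteq> inner (A \<union> C) \<union> inner B"
      using between_inner_Un[of A C] inner_mono[of A "A \<union> C"] inner_mono[of C "A \<union> C"] by auto
  qed (use p in auto)
  have 2: "card (comps (?W \<union> between B C)) = 2"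
  proof (rule comps2(2)[of "B \<union> C" A])
    have "conn_in (?W \<union> between B C) B" "conn_in (?W \<union> between B C) C" using cW by (auto intro: conn_in_mono)
    then show "conn_in (?W \<union> between B C) (B \<union> C)" by (intro between_conn ne) auto
    show "conn_in (?W \<union> between B C) A" using cW by (auto intro: conn_in_mono)
    show "?W \<union> between B C \<subseteq> inner (B \<union> C) \<union> inner A"
      using between_inner_Un[of B C] inner_mono[of B "B \<union> C"] inner_mono[of C "B \<union> C"] by auto
  qed (use p in auto)
  have crk: "crk ?W = crk E + 2 \<and> crk (?W \<union> between A C) = crk E + 1 \<and> crk (?W \<union> between B C) = crk E + 1"
  proof (cases "\<forall>Z. is_cycle G Z \<longrightarrow> Z \<in> \<B>")
    case True
    then show ?thesis
      using crk_balanced[of ?W] crk_balanced[of "?W \<union> between A C"] crk_balanced[of "?W \<union> between B C"]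
        crk_E(1) 0 1 2 by auto
  next
    case False
    then obtain Z where Z: "Z \<in> \<L>" "Z \<subseteq> ?W" using alt by blast
    have "crk E = 1" using crk_E(2)[of Z] Z(1) cycle_class class_disjoint by blast
    then show ?thesis
      using crk_lifted[OF Z] crk_lifted[OF Z(1) le_supI1[OF Z(2)]] 0 1 2 by simp
  qed
  show ?thesis
  proof (rule breakableI[OF W between_subset[of A C] between_subset[of B C]])
    show "E \<subseteq> ?W \<union> between A C \<union> between B C" using edges_partition3[OF p(1)] AB by blast
    show "crk ?W = crk E + 2" "crk (?W \<union> between A C) = crk E + 1" "crk (?W \<union> between B C) = crk E + 1"
      using crk by auto
  qed
qed

text \<open>With \<open>W0\<close> the edges inside the two parts, each of \<open>X\<close> and
  \<open>Y\<close> joins the parts, and the result stays balanced because it avoids the other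
  balancing set.\<close>

lemma suff_ii:
  assumes p: "V = A \<union> B" "A \<inter> B = {}" "A \<noteq> {}" "B \<noteq> {}"
    and c: "conn_in (inner A) A" "conn_in (inner B) B"
    and XY: "X \<noteq> {}" "Y \<noteq> {}" "X \<inter> Y = {}" "X \<union> Y = between A B"
    and unb: "is_cycle G C0" "C0 \<notin> \<B>"
    and bal: "\<And>C. is_cycle G C \<Longrightarrow> C \<subseteq> E - X \<Longrightarrow> C \<in> \<B>" "\<And>C. is_cycle G C \<Longrightarrow> C \<subseteq> E - Y \<Longrightarrow> C \<in> \<B>"
  shows breakable
proof -
  let ?W = "inner A \<union> inner B"
  have W: "?W \<subseteq> E" using inner_subset by auto
  have XYE: "X \<subseteq> E" "Y \<subseteq> E" using XY(4) between_subset[of A B] by auto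
  have d: "?W \<inter> between A B = {}" using between_inner_disjoint[of A A B] between_inner_disjoint[of A B B] p(2) by auto
  have cW: "conn_in ?W A" "conn_in ?W B" using c by (auto intro: conn_in_mono)
  have E1: "crk E = 1" using crk_E(2) unb by blast
  have conn: "crk (?W \<union> Z) = 2" if Z: "Z \<noteq> {}" "Z \<subseteq> between A B" and b: "\<And>C. is_cycle G C \<Longrightarrow> C \<subseteq> ?W \<union> Z \<Longrightarrow> C \<in> \<B>" for Z
  proof -
    obtain e u v where e: "e \<in> Z" "ends G e = {u, v}" "u \<in> A" "v \<in> B"
      using Z between_cases[of _ A B] by (metis all_not_in_conv subsetD)
    have "(u, v) \<in> reach G (?W \<union> Z)" by (rule reach_edge[OF _ e(2)]) (use e(1) in auto)
    moreover have "conn_in (?W \<union> Z) A" "conn_in (?W \<union> Z) B" using cW by (auto intro: conn_in_mono)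
    ultimately have "conn_in (?W \<union> Z) (A \<union> B)" using conn_in_Un e(3,4) by metis
    then have "card (comps (?W \<union> Z)) = 1" using comps1(2)[OF V_ne, of "?W \<union> Z"] W Z(2) between_subset[of A B] p(1) by auto
    then show ?thesis using crk_balanced[OF b] by simp
  qed
  show ?thesis
  proof (rule breakableI[OF W XYE])
    show "E \<subseteq> ?W \<union> X \<union> Y" using edges_partition2[OF p(1)] XY(4) by blast
    have "card (comps ?W) = 2" using comps2(2)[OF p subset_refl cW] .
    moreover have "C \<in> \<B>" if "is_cycle G C" "C \<subseteq> ?W" for C
      using bal(1)[OF that(1)] that(2) d XY(4) W by blast
    ultimately show "crk ?W = crk E + 2" using crk_balanced[of ?W] E1 by simp
    have "crk (?W \<union> X) = 2"
    proof (rule conn[OF XY(1)])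
      show "C \<in> \<B>" if "is_cycle G C" "C \<subseteq> ?W \<union> X" for C
        using bal(2)[OF that(1)] that(2) d XY W XYE by blast
    qed (use XY in auto)
    then show "crk (?W \<union> X) = crk E + 1" using E1 by simp
    have "crk (?W \<union> Y) = 2"
    proof (rule conn[OF XY(2)])
      show "C \<in> \<B>" if "is_cycle G C" "C \<subseteq> ?W \<union> Y" for C
        using bal(1)[OF that(1)] that(2) d XY W XYE by blast
    qed (use XY in auto)
    then show "crk (?W \<union> Y) = crk E + 1" using E1 by simp
  qed
qed

text \<open>Common part of (iii) and (iv).\<close>

lemma suff_balancing:
  assumes p: "V = A \<union> B" "A \<inter> B = {}" "A \<noteq> {}" "B \<noteq> {}"
    and c: "conn_in (inner A - X) A" "conn_in (inner B - X) B"
    and X: "X \<subseteq> inner A \<union> inner B"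
    and unb: "is_cycle G C0" "C0 \<notin> \<B>"
    and bal: "\<And>C. is_cycle G C \<Longrightarrow> C \<subseteq> E - X \<Longrightarrow> C \<in> \<B>"
    and alt: "X \<subseteq> inner A \<or> (\<exists>Z\<in>\<L>. Z \<subseteq> inner A \<union> inner B)"
  shows breakable
proof -
  \<comment> \<open>Balanced with two components. Adding \<open>X\<close> brings in unbalanced
    cycles but keeps the parts apart; adding the crossing edges joins the parts but avoids
    \<open>X\<close> and stays balanced.\<close>
  let ?W = "(inner A - X) \<union> (inner B - X)"
  have I: "inner A \<union> inner B \<subseteq> E" using inner_subset by auto
  then have W: "?W \<subseteq> E" and XE: "X \<subseteq> E" using X by auto
  have WX: "?W \<union> X = inner A \<union> inner B" using X by auto
  have d: "between A B \<inter> X = {}"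
    using between_inner_disjoint[of A A B] between_inner_disjoint[of A B B] p(2) X by auto
  have cW: "conn_in ?W A" "conn_in ?W B" using c by (auto intro: conn_in_mono)
  have E1: "crk E = 1" using crk_E(2) unb by blast
  have cover: "E \<subseteq> ?W \<union> X \<union> between A B" unfolding WX using edges_partition2[OF p(1)] by blast
  have "card (comps ?W) = 2" by (rule comps2(2)[OF p _ cW]) auto
  moreover have "C \<in> \<B>" if "is_cycle G C" "C \<subseteq> ?W" for C using bal[OF that(1)] that(2) W by blast
  ultimately have W3: "crk ?W = 3" using crk_balanced[of ?W] by simp
  have B2: "crk (?W \<union> between A B) = 2"
  proof -
    have "conn_in (?W \<union> between A B) (A \<union> B)"
      using cW by (intro between_conn cross_edge p) (auto intro: conn_in_mono)
    then have "card (comps (?W \<union> between A B)) = 1"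
      using comps1(2)[OF V_ne, of "?W \<union> between A B"] W between_subset[of A B] p(1) by auto
    moreover have "C \<in> \<B>" if "is_cycle G C" "C \<subseteq> ?W \<union> between A B" for C
      using bal[OF that(1)] that(2) W d between_subset[of A B] by blast
    ultimately show ?thesis using crk_balanced[of "?W \<union> between A B"] by simp
  qed
  have compsX: "comps (?W \<union> X) = {A, B}" "card (comps (?W \<union> X)) = 2"
    by (rule comps2[OF p]; use X cW in \<open>auto intro: conn_in_mono\<close>)+
  have A2: "crk (?W \<union> X) = 2"
  proof (cases "\<exists>Z\<in>\<L>. Z \<subseteq> inner A \<union> inner B")
    case True
    then obtain Z where Z: "Z \<in> \<L>" "Z \<subseteq> ?W \<union> X" unfolding WX by blast
    show ?thesis using crk_lifted[OF Z] compsX(2) by simp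
  next
    case False
    then have XA: "X \<subseteq> inner A" using alt by blast
    \<comment> \<open>Without such a cycle \<open>X\<close> would be spanned by \<open>?W\<close>,
      hence by \<open>?W\<close> with the crossing edges. That set would then span \<open>M\<close>,
      but its value is two and that of \<open>E\<close> is one.\<close>
    have "\<exists>C. is_cycle G C \<and> C \<subseteq> ?W \<union> X \<and> C \<notin> \<B>"
    proof (rule ccontr)
      assume "\<not> ?thesis"
      then have "crk (?W \<union> X) = crk ?W" using crk_balanced[of "?W \<union> X"] compsX(2) W3 by auto
      then have "?W \<union> X \<subseteq> cl ?W" using subset_cl_if_k_eq[of "?W \<union> X" ?W] W XE by auto
      then have "X \<subseteq> cl (?W \<union> between A B)" using closure_of_mono[of ?W "?W \<union> between A B" M] by blast
      then have "crk ((?W \<union> between A B) \<union> X) = 2"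
        using k_cl_un[of "?W \<union> between A B" X] W between_subset[of A B] B2 by simp
      moreover have "(?W \<union> between A B) \<union> X = E" using cover W XE between_subset[of A B] by blast
      ultimately show False using E1 by simp
    qed
    then obtain C where C: "is_cycle G C" "C \<subseteq> ?W \<union> X" "C \<notin> \<B>" by blast
    show ?thesis
    proof (rule crk_single2[OF compsX C])
      fix D assume D: "is_cycle G D" "D \<subseteq> ?W \<union> X" "verts_of G D \<subseteq> B"
      have "D \<subseteq> inner B" by (rule cycle_inner[OF D(1,3)])
      then have "D \<subseteq> E - X" using XA inner_disjoint[OF p(2)] inner_subset[of B] by blast
      then show "D \<in> \<B>" using bal D(1) by blast
    qed
  qed
  show ?thesis
    by (rule breakableI[OF W XE between_subset[of A B] cover]) (use E1 W3 A2 B2 in auto)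
qed

text \<open>\<open>C\<close> keeps all its edges in \<open>W0\<close>: it contains a cycle in \<F>
  and is not counted, while \<open>A\<close> and \<open>B\<close> are balanced components. One
  enlargement attaches \<open>A\<close> to \<open>C\<close> and restores \<open>X\<close>; the other
  merges \<open>A\<close> with \<open>B\<close> without using \<open>X\<close>, hence remains
  balanced on \<open>A \<union> B\<close>.\<close>

lemma suff_iii':
  assumes p: "V = A \<union> B \<union> C" "A \<inter> B = {}" "A \<inter> C = {}" "B \<inter> C = {}" "A \<noteq> {}" "B \<noteq> {}" "C \<noteq> {}"
    and c: "conn_in (inner A - X) A" "conn_in (inner B) B" "conn_in (inner C - X) C"
    and X: "X \<subseteq> inner (A \<union> C)"
    and bal: "\<And>C. is_cycle G C \<Longrightarrow> C \<subseteq> E - X \<Longrightarrow> C \<in> \<B>"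
    and Z: "Z \<in> \<F>" "verts_of G Z \<subseteq> C" and BC: "between B C = {}"
  shows breakable
proof -
  let ?W = "(inner A - X) \<union> inner B \<union> inner C"
  let ?A = "inner A \<union> between A C"
  let ?B = "between A B"
  have cZ: "is_cycle G Z" "Z \<notin> \<B>" using Z(1) cycle_class class_disjoint by auto
  have ZC: "Z \<subseteq> inner C" by (rule cycle_inner[OF cZ(1) Z(2)])
  have E1: "crk E = 1" using crk_E(2) cZ by blast
  have W: "?W \<subseteq> E" "?A \<subseteq> E" "?B \<subseteq> E" using inner_subset between_subset by auto
  have cover: "E \<subseteq> ?W \<union> ?A \<union> ?B" using edges_partition3[OF p(1)] BC by blast
  have cW: "conn_in ?W A" "conn_in ?W B" "conn_in ?W C" using c by (auto intro: conn_in_mono)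
  have XB: "X \<inter> inner B = {}" using X inner_disjoint[of "A \<union> C" B] p by blast
  have Xb: "X \<inter> ?B = {}" using X between_inner_disjoint[of A "A \<union> C" B] p by blast
  have "between C (A \<union> B) \<noteq> {}" "between B (A \<union> C) \<noteq> {}" using p by (intro cross_edge; auto)+
  then have ne: "between A C \<noteq> {}" "between A B \<noteq> {}"
    using BC between_comm[of B A] between_comm[of C A] between_comm[of C B] by (auto simp: between_Un)
  have inB: "D \<in> \<B>" if "is_cycle G D" "verts_of G D \<subseteq> B" for D
    using bal[OF that(1)] cycle_inner[OF that] XB inner_subset[of B] by blast
  have W3: "crk ?W = 3"
  proof (rule crk_single3[of ?W C A B Z])
    have *: "comps ?W = {A, B, C}" "card (comps ?W) = 3"
      by (rule comps3[OF p _ cW]; blast)+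
    show "comps ?W = {C, A, B}" unfolding * by auto
    show "card (comps ?W) = 3" by fact
    fix D assume D: "is_cycle G D" "D \<subseteq> ?W" "verts_of G D \<subseteq> A \<or> verts_of G D \<subseteq> B"
    show "D \<in> \<B>"
    proof (cases "verts_of G D \<subseteq> B")
      case True then show ?thesis by (rule inB[OF D(1)])
    next
      case False
      then have "D \<subseteq> inner A" using cycle_inner[OF D(1)] D(3) by blast
      then have "D \<subseteq> E - X" using D(2) inner_disjoint[OF p(2)] inner_disjoint[OF p(3)] inner_subset[of A] by blast
      then show ?thesis by (rule bal[OF D(1)])
    qed
  qed (use cZ ZC in auto)
  have A2: "crk (?W \<union> ?A) = 2"
  proof -
    have k0: "conn_in (?W \<union> ?A) (A \<union> C)"
      using cW ne by (intro between_conn) (auto intro: conn_in_mono)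
    have k1: "conn_in (?W \<union> ?A) B" using cW by (auto intro: conn_in_mono)
    have k2: "?W \<union> ?A \<subseteq> inner (A \<union> C) \<union> inner B"
      using between_inner_Un[of A C] inner_mono[of A "A \<union> C"] inner_mono[of C "A \<union> C"] by blast
    have P: "V = (A \<union> C) \<union> B" "(A \<union> C) \<inter> B = {}" "A \<union> C \<noteq> {}" "B \<noteq> {}" using p by blast+
    show ?thesis
      by (rule crk_single2[OF comps2[OF P k2 k0 k1] cZ(1) _ cZ(2)]) (use cZ ZC inB in auto)
  qed
  have B2: "crk (?W \<union> ?B) = 2"
  proof -
    have k0: "conn_in (?W \<union> ?B) (A \<union> B)"
      using cW ne by (intro between_conn) (auto intro: conn_in_mono)
    have k1: "conn_in (?W \<union> ?B) C" using cW by (auto intro: conn_in_mono)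
    have k2: "?W \<union> ?B \<subseteq> inner C \<union> inner (A \<union> B)"
      using between_inner_Un[of A B] inner_mono[of A "A \<union> B"] inner_mono[of B "A \<union> B"] by blast
    have P: "V = C \<union> (A \<union> B)" "C \<inter> (A \<union> B) = {}" "C \<noteq> {}" "A \<union> B \<noteq> {}" using p by blast+
    show ?thesis
    proof (rule crk_single2[OF comps2[OF P k2 k1 k0] cZ(1) _ cZ(2)])
      fix D assume D: "is_cycle G D" "D \<subseteq> ?W \<union> ?B" "verts_of G D \<subseteq> A \<union> B"
      have "D \<inter> inner C = {}" using cycle_inner[OF D(1,3)] inner_disjoint[of "A \<union> B" C] p(3,4) by blast
      then have "D \<subseteq> E - X" using D(2) XB Xb W by blast
      then show "D \<in> \<B>" by (rule bal[OF D(1)])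
    qed (use cZ ZC in auto)
  qed
  show ?thesis
    by (rule breakableI[OF W cover]) (use E1 W3 A2 B2 in auto)
qed

text \<open>\<open>A\<close> and \<open>B\<close> may contain unbalanced cycles, so in
  \<open>W0\<close> they are represented by spanning trees. Once a part is attached to
  \<open>C\<close> it reaches the cycle in \<F>, and its remaining edges add no further
  rank.\<close>

lemma suff_v:
  assumes p: "V = A \<union> B \<union> C" "A \<inter> B = {}" "A \<inter> C = {}" "B \<inter> C = {}" "A \<noteq> {}" "B \<noteq> {}" "C \<noteq> {}"
    and c: "conn_in (inner A) A" "conn_in (inner B) B" "conn_in (inner C) C"
    and Z: "Z \<in> \<F>" "verts_of G Z \<subseteq> C" and AB: "between A B = {}"
  shows breakable
proof -
  have cZ: "is_cycle G Z" "Z \<notin> \<B>" using Z(1) cycle_class class_disjoint by auto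
  have ZC: "Z \<subseteq> inner C" by (rule cycle_inner[OF cZ(1) Z(2)])
  have E1: "crk E = 1" using crk_E(2) cZ by blast
  obtain S where S: "S \<subseteq> inner A" "conn_in S A" "\<And>C. is_cycle G C \<Longrightarrow> \<not> C \<subseteq> S"
    using spanning_tree[OF c(1) inner_subset] by metis
  obtain T where T: "T \<subseteq> inner B" "conn_in T B" "\<And>C. is_cycle G C \<Longrightarrow> \<not> C \<subseteq> T"
    using spanning_tree[OF c(2) inner_subset] by metis
  let ?W = "S \<union> T \<union> inner C"
  let ?A = "inner A \<union> between A C"
  let ?B = "inner B \<union> between B C"
  have W: "?W \<subseteq> E" "?A \<subseteq> E" "?B \<subseteq> E" using inner_subset between_subset S(1) T(1) by blast+
  have cover: "E \<subseteq> ?W \<union> ?A \<union> ?B" using edges_partition3[OF p(1)] AB by blast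
  have cW: "conn_in ?W A" "conn_in ?W B" "conn_in ?W C" using c(3) S(2) T(2) by (auto intro: conn_in_mono)
  have "between A (B \<union> C) \<noteq> {}" "between B (A \<union> C) \<noteq> {}" using p by (intro cross_edge; auto)+
  then have ne: "between A C \<noteq> {}" "between B C \<noteq> {}"
    using AB between_comm[of B A] by (auto simp: between_Un)
  have id: "inner A \<inter> inner B = {}" "inner A \<inter> inner C = {}" "inner B \<inter> inner C = {}"
    using inner_disjoint p(2-4) by auto
  have bd: "between A C \<inter> inner B = {}" "between B C \<inter> inner A = {}"
    using between_inner_disjoint p(2-4) by blast+
  have noA: False if "is_cycle G D" "D \<subseteq> ?W \<union> ?B" "verts_of G D \<subseteq> A" for D
    using S(3)[OF that(1)] cycle_inner[OF that(1,3)] that(2) id bd T(1) by blast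
  have noB: False if "is_cycle G D" "D \<subseteq> ?W \<union> ?A" "verts_of G D \<subseteq> B" for D
    using T(3)[OF that(1)] cycle_inner[OF that(1,3)] that(2) id bd S(1) by blast
  have W3: "crk ?W = 3"
  proof (rule crk_single3[of ?W C A B Z])
    have *: "comps ?W = {A, B, C}" "card (comps ?W) = 3"
      by (rule comps3[OF p _ cW]; use S(1) T(1) in blast)+
    show "comps ?W = {C, A, B}" unfolding * by auto
    show "card (comps ?W) = 3" by fact
    fix D assume D: "is_cycle G D" "D \<subseteq> ?W" "verts_of G D \<subseteq> A \<or> verts_of G D \<subseteq> B"
    then show "D \<in> \<B>" using noA[OF D(1)] noB[OF D(1)] by blast
  qed (use cZ ZC in auto)
  have A2: "crk (?W \<union> ?A) = 2"
  proof -
    have k0: "conn_in (?W \<union> ?A) (A \<union> C)"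
      using cW ne by (intro between_conn) (auto intro: conn_in_mono)
    have k1: "conn_in (?W \<union> ?A) B" using cW by (auto intro: conn_in_mono)
    have k2: "?W \<union> ?A \<subseteq> inner (A \<union> C) \<union> inner B"
      using between_inner_Un[of A C] inner_mono[of A "A \<union> C"] inner_mono[of C "A \<union> C"] S(1) T(1) by blast
    have P: "V = (A \<union> C) \<union> B" "(A \<union> C) \<inter> B = {}" "A \<union> C \<noteq> {}" "B \<noteq> {}" using p by blast+
    show ?thesis
      by (rule crk_single2[OF comps2[OF P k2 k0 k1] cZ(1) _ cZ(2)]) (use cZ ZC noB in auto)
  qed
  have B2: "crk (?W \<union> ?B) = 2"
  proof -
    have k0: "conn_in (?W \<union> ?B) (B \<union> C)"
      using cW ne by (intro between_conn) (auto intro: conn_in_mono)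
    have k1: "conn_in (?W \<union> ?B) A" using cW by (auto intro: conn_in_mono)
    have k2: "?W \<union> ?B \<subseteq> inner (B \<union> C) \<union> inner A"
      using between_inner_Un[of B C] inner_mono[of B "B \<union> C"] inner_mono[of C "B \<union> C"] S(1) T(1) by blast
    have P: "V = (B \<union> C) \<union> A" "(B \<union> C) \<inter> A = {}" "B \<union> C \<noteq> {}" "A \<noteq> {}" using p by blast+
    show ?thesis
      by (rule crk_single2[OF comps2[OF P k2 k0 k1] cZ(1) _ cZ(2)]) (use cZ ZC noA in auto)
  qed
  show ?thesis
    by (rule breakableI[OF W cover]) (use E1 W3 A2 B2 in auto)
qed

end

section \<open>Necessity\<close>

context connected_qbg
begin

text \<open>\<open>cond_i\<close> to \<open>cond_v\<close> are the alternatives of the theorem,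
  expressed by \<open>conn_in\<close>, \<open>inner\<close> and vertex sets of cycles, the form that
  the matroid arguments produce. Induced subgraphs reappear only in the equivalences such as
  \<open>cond_i_iff\<close>.\<close>

definition cond_i :: bool where
  "cond_i \<longleftrightarrow> (\<exists>A B C. partition3 V A B C \<and> conn_in (inner A) A \<and> conn_in (inner B) B \<and>
     conn_in (inner C) C \<and> between A B = {} \<and>
     ((\<exists>K\<in>{A, B, C}. \<exists>Z\<in>\<L>. verts_of G Z \<subseteq> K) \<or> (\<forall>Z. is_cycle G Z \<longrightarrow> Z \<in> \<B>)))"

definition cond_ii :: bool where
  "cond_ii \<longleftrightarrow> (\<exists>A B. partition2 V A B \<and> conn_in (inner A) A \<and> conn_in (inner B) B \<and>
     (\<exists>X Y. partition2 (between A B) X Y \<and> balancing_set G \<B> X \<and> balancing_set G \<B> Y))"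

definition cond_iii :: bool where
  "cond_iii \<longleftrightarrow> (\<exists>A B X. partition2 V A B \<and> balancing_set G \<B> X \<and> X \<subseteq> inner A \<and>
     conn_in (inner A - X) A \<and> conn_in (inner B) B)"

definition cond_iii' :: bool where
  "cond_iii' \<longleftrightarrow> (\<exists>A B C X. partition3 V A B C \<and> balancing_set G \<B> X \<and> X \<subseteq> inner (A \<union> C) \<and>
     conn_in (inner A - X) A \<and> conn_in (inner B) B \<and> conn_in (inner C - X) C \<and>
     (\<exists>Z\<in>\<F>. verts_of G Z \<subseteq> C) \<and> between B C = {})"

definition cond_iv :: bool where
  "cond_iv \<longleftrightarrow> (\<exists>A B X. partition2 V A B \<and> balancing_set G \<B> X \<and> X \<subseteq> inner A \<union> inner B \<and>
     conn_in (inner A - X) A \<and> conn_in (inner B - X) B \<and>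
     (\<exists>Z\<in>\<L>. verts_of G Z \<subseteq> A) \<and> (\<exists>Z\<in>\<L>. verts_of G Z \<subseteq> B))"

definition cond_v :: bool where
  "cond_v \<longleftrightarrow> (\<exists>A B C. partition3 V A B C \<and> conn_in (inner A) A \<and> conn_in (inner B) B \<and>
     conn_in (inner C) C \<and> between A B = {} \<and> (\<exists>Z\<in>\<F>. verts_of G Z \<subseteq> C))"

lemma sufficient:
  assumes "cond_i \<or> cond_ii \<or> cond_iii \<or> cond_iii' \<or> cond_iv \<or> cond_v"
  shows breakable
  using assms
proof (elim disjE)
  assume cond_i
  then obtain A B C where *: "partition3 V A B C" "conn_in (inner A) A" "conn_in (inner B) B"
     "conn_in (inner C) C" "between A B = {}"
     "(\<exists>K\<in>{A, B, C}. \<exists>Z\<in>\<L>. verts_of G Z \<subseteq> K) \<or> (\<forall>Z. is_cycle G Z \<longrightarrow> Z \<in> \<B>)"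
    unfolding cond_i_def by blast
  have p: "V = A \<union> B \<union> C" "A \<inter> B = {}" "A \<inter> C = {}" "B \<inter> C = {}" "A \<noteq> {}" "B \<noteq> {}" "C \<noteq> {}"
    using *(1) unfolding partition3_def by auto
  have "(\<exists>Z\<in>\<L>. Z \<subseteq> inner A \<union> inner B \<union> inner C) \<or> (\<forall>Z. is_cycle G Z \<longrightarrow> Z \<in> \<B>)"
  proof (cases "\<forall>Z. is_cycle G Z \<longrightarrow> Z \<in> \<B>")
    case False
    then obtain K Z where Z: "K \<in> {A, B, C}" "Z \<in> \<L>" "verts_of G Z \<subseteq> K" using *(6) by blast
    then have "Z \<subseteq> inner K" using cycle_inner cycle_class by blast
    then show ?thesis using Z by blast
  qed simp
  then show ?thesis by (rule suff_i[OF p *(2-5)])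
next
  assume cond_ii
  then obtain A B X Y where *: "partition2 V A B" "conn_in (inner A) A" "conn_in (inner B) B"
    "partition2 (between A B) X Y" "balancing_set G \<B> X" "balancing_set G \<B> Y"
    unfolding cond_ii_def by blast
  have p: "V = A \<union> B" "A \<inter> B = {}" "A \<noteq> {}" "B \<noteq> {}" "X \<noteq> {}" "Y \<noteq> {}" "X \<inter> Y = {}" "X \<union> Y = between A B"
    using *(1,4) unfolding partition2_def by auto
  obtain C0 where C0: "is_cycle G C0" "C0 \<notin> \<B>" using *(5) unfolding balancing_iff by blast
  show ?thesis
    by (rule suff_ii[OF p(1-4) *(2,3) p(5-8) C0]) (use *(5,6) in \<open>auto simp: balancing_iff\<close>)
next
  assume cond_iii
  then obtain A B X where *: "partition2 V A B" "balancing_set G \<B> X" "X \<subseteq> inner A"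
     "conn_in (inner A - X) A" "conn_in (inner B) B"
    unfolding cond_iii_def by blast
  have p: "V = A \<union> B" "A \<inter> B = {}" "A \<noteq> {}" "B \<noteq> {}"
    using *(1) unfolding partition2_def by auto
  obtain C0 where C0: "is_cycle G C0" "C0 \<notin> \<B>" using *(2) unfolding balancing_iff by blast
  have "inner B - X = inner B" using inner_disjoint[OF p(2)] *(3) by blast
  then have "conn_in (inner B - X) B" using *(5) by simp
  then show ?thesis
    by (rule suff_balancing[OF p *(4) _ _ C0]) (use *(2,3) in \<open>auto simp: balancing_iff\<close>)
next
  assume cond_iii'
  then obtain A B C X Z where *: "partition3 V A B C" "balancing_set G \<B> X" "X \<subseteq> inner (A \<union> C)"
     "conn_in (inner A - X) A" "conn_in (inner B) B" "conn_in (inner C - X) C"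
     "Z \<in> \<F>" "verts_of G Z \<subseteq> C" "between B C = {}"
    unfolding cond_iii'_def by blast
  have p: "V = A \<union> B \<union> C" "A \<inter> B = {}" "A \<inter> C = {}" "B \<inter> C = {}" "A \<noteq> {}" "B \<noteq> {}" "C \<noteq> {}"
    using *(1) unfolding partition3_def by auto
  have c: "conn_in (inner C) C" by (rule conn_in_mono[OF *(6)]) auto
  show ?thesis
    by (rule suff_iii'[OF p *(4-6,3) _ *(7-9)]) (use *(2) in \<open>auto simp: balancing_iff\<close>)
next
  assume cond_iv
  then obtain A B X Z where *: "partition2 V A B" "balancing_set G \<B> X" "X \<subseteq> inner A \<union> inner B"
     "conn_in (inner A - X) A" "conn_in (inner B - X) B" "Z \<in> \<L>" "verts_of G Z \<subseteq> A"
    unfolding cond_iv_def by blast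
  have p: "V = A \<union> B" "A \<inter> B = {}" "A \<noteq> {}" "B \<noteq> {}"
    using *(1) unfolding partition2_def by auto
  obtain C0 where C0: "is_cycle G C0" "C0 \<notin> \<B>" using *(2) unfolding balancing_iff by blast
  have "Z \<subseteq> inner A" using cycle_inner[OF _ *(7)] cycle_class *(6) by blast
  then have alt: "X \<subseteq> inner A \<or> (\<exists>Z\<in>\<L>. Z \<subseteq> inner A \<union> inner B)" using *(6) by blast
  show ?thesis
    by (rule suff_balancing[OF p *(4,5,3) C0 _ alt]) (use *(2) in \<open>auto simp: balancing_iff\<close>)
next
  assume cond_v
  then obtain A B C Z where *: "partition3 V A B C" "conn_in (inner A) A" "conn_in (inner B) B"
     "conn_in (inner C) C" "between A B = {}" "Z \<in> \<F>" "verts_of G Z \<subseteq> C"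
    unfolding cond_v_def by blast
  have p: "V = A \<union> B \<union> C" "A \<inter> B = {}" "A \<inter> C = {}" "B \<inter> C = {}" "A \<noteq> {}" "B \<noteq> {}" "C \<noteq> {}"
    using *(1) unfolding partition3_def by auto
  show ?thesis by (rule suff_v[OF p *(2-4,6,7,5)])
qed

lemma between_outside:
  assumes "W \<subseteq> E" "K \<in> comps W" "e \<in> between A B" "A \<subseteq> K \<and> B \<inter> K = {} \<or> B \<subseteq> K \<and> A \<inter> K = {}"
  shows "e \<in> E - W"
proof -
  obtain u v where uv: "e \<in> E" "ends G e = {u, v}" "u \<in> A" "v \<in> B" using between_cases[OF assms(3)] .
  then show ?thesis using comps_edge[OF assms(2) _ _ assms(1), of e] assms(4) by auto
qed

lemma cut_insert:
  assumes "K \<in> comps W" "ends G g \<inter> K = {}" "(x, y) \<in> reach G (insert g W)" "x \<in> K"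
  shows "y \<in> K"
proof (rule reach_closed[OF assms(3,4)])
  fix e p q assume e: "e \<in> insert g W" "ends G e = {p, q}" "p \<in> K"
  then have "e \<in> W" using assms(2) by auto
  then show "q \<in> K" using comps_reach[OF assms(1) e(3), of q] reach_edge[of e W G p q] e(2) by simp
qed

text \<open>The cycle \<open>Z\<close> meets every cycle in \<F>, so it links the cycles reached
  from \<open>a\<close> and from \<open>b\<close>.\<close>

lemma hasF_L_reach:
  assumes "Z \<in> \<L>" "Z \<subseteq> X" "hasF X a" "hasF X b"
  shows "(a, b) \<in> reach G X"
proof -
  obtain C x where C: "C \<in> \<F>" "C \<subseteq> X" "x \<in> verts_of G C" "(a, x) \<in> reach G X"
    using assms(3) unfolding hasF_def by blast
  obtain D y where D: "D \<in> \<F>" "D \<subseteq> X" "y \<in> verts_of G D" "(b, y) \<in> reach G X"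
    using assms(4) unfolding hasF_def by blast
  obtain c where c: "c \<in> verts_of G Z" "c \<in> verts_of G C" using LF_meet[OF assms(1) C(1)] by blast
  obtain d where d: "d \<in> verts_of G Z" "d \<in> verts_of G D" using LF_meet[OF assms(1) D(1)] by blast
  have cyc: "is_cycle G Z" "is_cycle G C" "is_cycle G D" using assms(1) C(1) D(1) cycle_class by auto
  have 1: "(x, c) \<in> reach G X" using reach_mono[OF C(2) cycle_basic(6)[OF cyc(2) C(3) c(2)]] .
  have 2: "(c, d) \<in> reach G X" using reach_mono[OF assms(2) cycle_basic(6)[OF cyc(1) c(1) d(1)]] .
  have 3: "(d, y) \<in> reach G X" using reach_mono[OF D(2) cycle_basic(6)[OF cyc(3) d(2) D(3)]] .
  show ?thesis
    using reach_trans[OF C(4) reach_trans[OF 1 reach_trans[OF 2 reach_trans[OF 3 reach_sym[OF D(4)]]]]] .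
qed

text \<open>Mostly used contrapositively: an edge whose ends are not joined, and one of whose ends
  has no access to \<F>, is not spanned.\<close>

lemma spans_reach:
  assumes "spans X h" "ends G h = {a, b}"
  shows "(a, b) \<in> reach G X \<or> hasF X a \<and> hasF X b"
proof -
  consider C where "C \<in> \<B>" "h \<in> C" "C \<subseteq> insert h X"
    | u v where "ends G h = {u, v}" "(u, v) \<in> reach G X"
    | u v where "ends G h = {u, v}" "hasF X u" "hasF X v"
    using assms(1) unfolding spans_def by blast
  then show ?thesis
  proof cases
    case 1
    have "a \<in> verts_of G C" using ends_subset_verts_of[OF 1(2), of G] assms(2) by auto
    then show ?thesis using cycle_avoid_reach(1)[OF _ 1(2,3) assms(2)] 1(1) cycle_class by blast
  next
    case 2
    then show ?thesis using assms(2) reach_sym[OF 2(2)] by (auto simp: doubleton_eq_iff)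
  next
    case 3
    then show ?thesis using assms(2) by (auto simp: doubleton_eq_iff)
  qed
qed

end

section \<open>Flats of corank two with two parallel classes\<close>

locale corank2_flat = connected_qbg +
  fixes W assumes tc: "two_class W"
begin

lemma W_sub: "W \<subseteq> E" and W_cl: "cl W = W" and W_flat: "is_flat M W" and crk_W: "crk W = crk E + 2"
  using tc flatD[of W] unfolding two_class_def by auto

lemma flat_spans: "e \<in> E \<Longrightarrow> spans W e \<Longrightarrow> e \<in> W"
  using in_closure_iff_spans[OF W_sub, of e] W_cl by auto

lemma two_classes:
  assumes "g \<in> E - W" "h \<in> E - W" "h \<notin> cl (insert g W)"
  shows "E \<subseteq> cl (insert g W) \<union> cl (insert h W)"
  using tc assms unfolding two_class_def by simp

lemma in_cl_insert:
  assumes "g \<in> E" "h \<in> E" "h \<notin> W" "h \<noteq> g"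
  shows "h \<in> cl (insert g W) \<longleftrightarrow> spans (insert g W) h"
  by (rule in_closure_iff_spans) (use assms W_sub in auto)

text \<open>Applied to one edge of each crossing kind between three groups of vertices, to show that
  one kind does not occur.\<close>

lemma no_three_classes:
  assumes "g \<in> E - W" "h \<in> E - W" "j \<in> E - W" "g \<noteq> h" "j \<noteq> g" "j \<noteq> h"
    "\<not> spans (insert g W) h" "\<not> spans (insert g W) j" "\<not> spans (insert h W) j"
  shows False
proof -
  have "h \<notin> cl (insert g W)" using in_cl_insert[of g h] assms by auto
  then have "j \<in> cl (insert g W) \<union> cl (insert h W)" using two_classes assms(1-3) by blast
  then show False using in_cl_insert[of g j] in_cl_insert[of h j] assms by auto
qed

lemma crk_insert_W: "g \<in> E - W \<Longrightarrow> crk (insert g W) = crk E + 1"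
  using k_insert_notin[of W g] W_sub W_cl crk_W by simp

lemma comps_conn_inner:
  assumes "K \<in> comps W" "{e \<in> W. ends G e \<subseteq> K} \<subseteq> Y" shows "conn_in Y K"
  unfolding conn_in_def using reach_mono[OF assms(2) comps_connected[OF assms(1)]] by blast

lemma comps_conn_inner': "K \<in> comps W \<Longrightarrow> conn_in (inner K) K"
  by (rule comps_conn_inner) (use W_sub in \<open>auto simp: inner_def\<close>)

lemma comps_conn: "K \<in> comps W \<Longrightarrow> conn_in W K"
  by (rule comps_conn_inner) auto

lemma nec_i:
  assumes alt: "(\<exists>Z\<in>\<L>. Z \<subseteq> W) \<or> (\<forall>Z. is_cycle G Z \<longrightarrow> Z \<in> \<B>)"
  shows cond_i
proof -
  \<comment> \<open>Four minus one in the balanced case, where \<open>crk E\<close> is two; in the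
    other case \<open>crk E\<close> is one and \<open>crk W\<close> is the number of
    components.\<close>
  have "card (comps W) = 3"
  proof (cases "\<forall>Z. is_cycle G Z \<longrightarrow> Z \<in> \<B>")
    case True
    then show ?thesis using crk_balanced[of W] crk_E(1) crk_W by auto
  next
    case False
    then obtain Z where Z: "Z \<in> \<L>" "Z \<subseteq> W" using alt by blast
    have "crk E = 1" using crk_E(2)[of Z] Z(1) cycle_class class_disjoint by blast
    then show ?thesis using crk_lifted[OF Z] crk_W by simp
  qed
  then obtain A B C where c: "comps W = {A, B, C}" "A \<noteq> B" "A \<noteq> C" "B \<noteq> C"
    unfolding card_3_iff by blast
  have AK: "A \<in> comps W" "B \<in> comps W" "C \<in> comps W" using c(1) by auto
  have V: "V = A \<union> B \<union> C" using comps_cover[OF W_sub] c(1) by auto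
  have d: "A \<inter> B = {}" "A \<inter> C = {}" "B \<inter> C = {}" using comps_disjoint AK c(2-4) by auto
  have ne: "A \<noteq> {}" "B \<noteq> {}" "C \<noteq> {}" using comps_nonempty AK by auto
  have conn: "conn_in (inner A) A" "conn_in (inner B) B" "conn_in (inner C) C"
    using comps_conn_inner' AK by auto
  \<comment> \<open>Ends with access to \<F> are joined as well, through the cycle in \<L>; so here
    an edge can only be spanned if its ends are connected.\<close>
  have key: "(a, b) \<in> reach G (insert g W)" if "spans (insert g W) h" "ends G h = {a, b}" for g h a b
    using spans_reach[OF that]
  proof
    assume F: "hasF (insert g W) a \<and> hasF (insert g W) b"
    then obtain D where "D \<in> \<F>" unfolding hasF_def by blast
    then have "\<not> (\<forall>Z. is_cycle G Z \<longrightarrow> Z \<in> \<B>)" using cycle_class class_disjoint(2) by blast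
    then obtain Z where Z: "Z \<in> \<L>" "Z \<subseteq> insert g W" using alt by blast
    show ?thesis using hasF_L_reach[OF Z] F by blast
  qed
  \<comment> \<open>An edge between two of the components leaves the third one cut off, so edges of
    the three kinds are pairwise not parallel.\<close>
  have some_empty: "between A B = {} \<or> between A C = {} \<or> between B C = {}"
  proof (rule ccontr)
    assume "\<not> ?thesis"
    then obtain g h j where g: "g \<in> between A B" and h: "h \<in> between A C" and j: "j \<in> between B C" by blast
    obtain ga gb where g': "ends G g = {ga, gb}" "ga \<in> A" "gb \<in> B" using between_cases[OF g] .
    obtain ha hc where h': "ends G h = {ha, hc}" "ha \<in> A" "hc \<in> C" using between_cases[OF h] .
    obtain jb jc where j': "ends G j = {jb, jc}" "jb \<in> B" "jc \<in> C" using between_cases[OF j] .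
    show False
    proof (rule no_three_classes[of g h j])
      show "g \<in> E - W" using between_outside[OF W_sub AK(1) g] d by blast
      show "h \<in> E - W" using between_outside[OF W_sub AK(1) h] d by blast
      show "j \<in> E - W" using between_outside[OF W_sub AK(2) j] d by blast
      show "g \<noteq> h" "j \<noteq> g" "j \<noteq> h" using g' h' j' d by (auto simp: doubleton_eq_iff)
      have gC: "ends G g \<inter> C = {}" using g' d by auto
      have hB: "ends G h \<inter> B = {}" using h' d by auto
      show "\<not> spans (insert g W) h"
        using cut_insert[OF AK(3) gC reach_sym[OF key[OF _ h'(1)]]] h'(2,3) d by blast
      show "\<not> spans (insert g W) j"
        using cut_insert[OF AK(3) gC reach_sym[OF key[OF _ j'(1)]]] j'(2,3) d by blast
      show "\<not> spans (insert h W) j"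
        using cut_insert[OF AK(2) hB key[OF _ j'(1)]] j'(2,3) d by blast
    qed
  qed
  have alt': "(\<exists>K\<in>{A, B, C}. \<exists>Z\<in>\<L>. verts_of G Z \<subseteq> K) \<or> (\<forall>Z. is_cycle G Z \<longrightarrow> Z \<in> \<B>)"
  proof (cases "\<exists>Z\<in>\<L>. Z \<subseteq> W")
    case True
    then obtain Z where Z: "Z \<in> \<L>" "Z \<subseteq> W" by blast
    then obtain K where "K \<in> comps W" "verts_of G Z \<subseteq> K" using cycle_in_comp cycle_class by blast
    then show ?thesis using Z(1) c(1) by blast
  qed (use alt in simp)
  \<comment> \<open>\<open>cond_i\<close> singles out the first two parts as the nonadjacent ones,
    so the components are renamed accordingly.\<close>
  have perm: cond_i if p: "P \<in> {A, B, C}" "Q \<in> {A, B, C}" "R \<in> {A, B, C}" "{P, Q, R} = {A, B, C}"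
      "P \<noteq> Q" "P \<noteq> R" "Q \<noteq> R" and e: "between P Q = {}" for P Q R
  proof -
    have "partition3 V P Q R"
      unfolding partition3_def
    proof (intro conjI)
      show "P \<union> Q \<union> R = V"
      proof -
        have "\<Union> {P, Q, R} = V" unfolding p(4) using V by auto
        then show ?thesis by auto
      qed
      show "P \<inter> Q = {}" "P \<inter> R = {}" "Q \<inter> R = {}"
        using comps_disjoint[of P W Q] comps_disjoint[of P W R] comps_disjoint[of Q W R] p c(1) by simp_all
      show "P \<noteq> {}" "Q \<noteq> {}" "R \<noteq> {}"
        using comps_nonempty[of P W] comps_nonempty[of Q W] comps_nonempty[of R W] p(1-3) c(1) by simp_all
    qed
    moreover have "conn_in (inner P) P" "conn_in (inner Q) Q" "conn_in (inner R) R" using p(1-3) conn by auto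
    moreover have "(\<exists>K\<in>{P, Q, R}. \<exists>Z\<in>\<L>. verts_of G Z \<subseteq> K) \<or> (\<forall>Z. is_cycle G Z \<longrightarrow> Z \<in> \<B>)"
      unfolding p(4) by (rule alt')
    ultimately show ?thesis unfolding cond_i_def using e by blast
  qed
  from some_empty show ?thesis
  proof (elim disjE)
    assume "between A B = {}" then show ?thesis by (rule perm[rotated 7]) (use c in auto)
  next
    assume "between A C = {}" then show ?thesis by (rule perm[rotated 7, of _ _ B]) (use c in auto)
  next
    assume "between B C = {}" then show ?thesis by (rule perm[rotated 7, of _ _ A]) (use c in auto)
  qed
qed

text \<open>Both ends lie in one component, so \<open>x\<close> closes a cycle with
  \<open>W\<close>. Inside a balanced \<open>Y\<close> that cycle is balanced, and it puts
  \<open>x\<close> into the closure of the flat.\<close>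

lemma chord_in_W:
  assumes "K \<in> comps W" "x \<in> inner K" "x \<in> Y" "W \<subseteq> Y" "\<And>C. is_cycle G C \<Longrightarrow> C \<subseteq> Y \<Longrightarrow> C \<in> \<B>"
  shows "x \<in> W"
proof (rule ccontr)
  assume xW: "x \<notin> W"
  have xE: "x \<in> E" "ends G x \<subseteq> K" using assms(2) unfolding inner_def by auto
  obtain u v where uv: "ends G x = {u, v}" using ends_cases[OF xE(1)] .
  have "(u, v) \<in> reach G W" using comps_reach[OF assms(1), of u v] uv xE(2) by auto
  then obtain C where C: "is_cycle G C" "x \<in> C" "C \<subseteq> insert x W"
    using cycle_through_edge[OF finG(1) xE(1) uv W_sub xW] by metis
  then have "C \<in> \<B>" using assms(3-5) by blast
  then have "spans W x" unfolding spans_def using C by blast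
  then show False using flat_spans xE(1) xW by blast
qed

text \<open>The parts stay disconnected from each other, so neither a balanced cycle through
  \<open>y\<close> nor a cycle in \<F> near \<open>y\<close> can involve \<open>x\<close>; without
  \<open>x\<close> the flat would have spanned \<open>y\<close> already or would be unbalanced. What
  remains is a cycle in \<L> that uses \<open>x\<close>, and it lies in \<open>A\<close>.\<close>

lemma parallel_L:
  assumes c: "comps W = {A, B}" "A \<inter> B = {}" and bal: "\<And>C. is_cycle G C \<Longrightarrow> C \<subseteq> W \<Longrightarrow> C \<in> \<B>"
    and x: "x \<in> inner A" "x \<notin> W" and y: "y \<in> inner B" "y \<notin> W" and sp: "spans (insert x W) y"
  shows "\<exists>Z\<in>\<L>. verts_of G Z \<subseteq> A"
proof -
  have AK: "A \<in> comps W" "B \<in> comps W" using c(1) by auto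
  let ?X = "insert x W" and ?Y = "insert y (insert x W)"
  have yE: "y \<in> E" using y(1) unfolding inner_def by auto
  have Y: "?Y \<subseteq> inner A \<union> inner B"
  proof -
    have "e \<in> inner A \<union> inner B" if "e \<in> W" for e
    proof -
      have eE: "e \<in> E" using that W_sub by auto
      obtain u v where "ends G e = {u, v}" "u \<in> V" "v \<in> V" using ends_cases[OF eE] .
      then have "ends G e \<inter> A \<noteq> {} \<or> ends G e \<inter> B \<noteq> {}" using comps_cover[OF W_sub] c(1) by auto
      then show ?thesis using comps_edge[OF AK(1) that _ W_sub] comps_edge[OF AK(2) that _ W_sub] eE
        unfolding inner_def by auto
    qed
    then show ?thesis using x(1) y(1) by auto
  qed
  have V: "V = A \<union> B" using comps_cover[OF W_sub] c(1) by auto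
  have p: "A \<noteq> {}" "B \<noteq> {}" using comps_nonempty AK by auto
  have cW: "conn_in W A" "conn_in W B" using comps_conn AK by auto
  have cX: "comps ?X = {A, B}"
    by (rule comps2(1)[OF V c(2) p]) (use Y cW in \<open>auto intro: conn_in_mono\<close>)
  have cY: "comps ?Y = {A, B}"
    by (rule comps2(1)[OF V c(2) p]) (use Y cW in \<open>auto intro: conn_in_mono\<close>)
  have inW: "D \<subseteq> insert y W" if h: "is_cycle G D" "D \<subseteq> ?Y" "verts_of G D \<inter> B \<noteq> {}" for D
  proof -
    obtain K where K: "K \<in> comps ?Y" "verts_of G D \<subseteq> K" using cycle_in_comp[OF h(1,2)] by blast
    then have "verts_of G D \<subseteq> B" using cY h(3) c(2) by auto
    then have "D \<subseteq> inner B" by (rule cycle_inner[OF h(1)])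
    then show ?thesis using h(2) x(1) inner_disjoint[OF c(2)] by blast
  qed
  have yB: "ends G y \<subseteq> B" using y(1) unfolding inner_def by auto
  consider C where "C \<in> \<B>" "y \<in> C" "C \<subseteq> ?Y" | Z where "Z \<in> \<L>" "Z \<subseteq> ?X"
    | u v where "ends G y = {u, v}" "hasF ?X u"
    using sp unfolding spans_def by blast
  then show ?thesis
  proof cases
    case 1
    have cC: "is_cycle G C" using 1(1) cycle_class by simp
    have "verts_of G C \<inter> B \<noteq> {}"
      using ends_subset_verts_of[OF 1(2), of G] yB ends_nonempty[OF yE] by blast
    then have "C \<subseteq> insert y W" using inW[OF cC 1(3)] by simp
    then have "spans W y" unfolding spans_def using 1 by blast
    then show ?thesis using flat_spans yE y(2) by blast
  next
    case 2
    have cZ: "is_cycle G Z" "Z \<notin> \<B>" using 2(1) cycle_class class_disjoint by auto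
    obtain K where K: "K \<in> comps ?X" "verts_of G Z \<subseteq> K" using cycle_in_comp[OF cZ(1) 2(2)] by blast
    show ?thesis
    proof (cases "verts_of G Z \<inter> B = {}")
      case True
      then have "verts_of G Z \<subseteq> A" using K cX cycle_basic(5)[OF cZ(1)] by auto
      then show ?thesis using 2(1) by blast
    next
      case False
      have "Z \<subseteq> insert y W" using inW[OF cZ(1) _ False] 2(2) by blast
      then have "Z \<subseteq> W" using 2(2) y x inner_disjoint[OF c(2)] by blast
      then show ?thesis using bal[OF cZ(1)] cZ(2) by blast
    qed
  next
    case 3
    then obtain D z where D: "D \<in> \<F>" "D \<subseteq> ?X" "z \<in> verts_of G D" "(u, z) \<in> reach G ?X"
      unfolding hasF_def by blast
    have cD: "is_cycle G D" "D \<notin> \<B>" using D(1) cycle_class class_disjoint by auto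
    have "u \<in> B" using 3(1) yB by auto
    then have "z \<in> B" using comps_reach[of B ?X u z] cX D(4) by simp
    then have "D \<subseteq> insert y W" using inW[OF cD(1)] D(2,3) by blast
    then have "D \<subseteq> W" using D(2) y x inner_disjoint[OF c(2)] by blast
    then show ?thesis using bal[OF cD(1)] cD(2) by blast
  qed
qed

lemma nec_balanced:
  assumes bal: "\<And>C. is_cycle G C \<Longrightarrow> C \<subseteq> W \<Longrightarrow> C \<in> \<B>" and unb: "is_cycle G C0" "C0 \<notin> \<B>"
  shows "cond_ii \<or> cond_iii \<or> cond_iv"
proof -
  have E1: "crk E = 1" using crk_E(2)[OF unb] .
  then have "card (comps W) = 2" using crk_balanced[OF bal] crk_W by simp
  then obtain A B where c: "comps W = {A, B}" "A \<noteq> B" unfolding card_2_iff by blast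
  have AK: "A \<in> comps W" "B \<in> comps W" using c(1) by auto
  have V: "V = A \<union> B" using comps_cover[OF W_sub] c(1) by auto
  have d: "A \<inter> B = {}" using comps_disjoint AK c(2) by auto
  have ne: "A \<noteq> {}" "B \<noteq> {}" using comps_nonempty AK by auto
  have p2: "partition2 V A B" "partition2 V B A" unfolding partition2_def using V d ne by auto
  have conn: "conn_in (inner A) A" "conn_in (inner B) B" using comps_conn_inner' AK by auto
  have cW: "conn_in W A" "conn_in W B" using comps_conn AK by auto
  have out: "g \<in> E - W" if "g \<in> between A B" for g
    using between_outside[OF W_sub AK(1) that] d by blast
  \<comment> \<open>A crossing edge makes the hyperplane connected; with an unbalanced cycle its
    value would be one, the same as for \<open>E\<close>.\<close>
  have H: "C \<in> \<B>" if g: "g \<in> between A B" and C: "is_cycle G C" "C \<subseteq> cl (insert g W)" for g C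
  proof (rule ccontr)
    assume nb: "C \<notin> \<B>"
    have gE: "insert g W \<subseteq> E" using out[OF g] W_sub by auto
    have sub: "insert g W \<subseteq> cl (insert g W)" by (rule closure_of_extensive)
    obtain a b where ab: "ends G g = {a, b}" "a \<in> A" "b \<in> B" using between_cases[OF g] .
    have "(a, b) \<in> reach G (insert g W)" by (rule reach_edge[OF _ ab(1)]) simp
    moreover have "conn_in (insert g W) A" "conn_in (insert g W) B" using cW by (auto intro: conn_in_mono)
    ultimately have "conn_in (insert g W) V" using conn_in_Un ab(2,3) V by metis
    then have "conn_in (cl (insert g W)) V" by (rule conn_in_mono[OF _ sub])
    then have *: "comps (cl (insert g W)) = {V}" "card (comps (cl (insert g W))) = 1"
      using comps1[OF V_ne] cl_subset[of "insert g W"] gE by auto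
    have "crk (cl (insert g W)) = card (comps (cl (insert g W)))"
    proof (rule crk_single[OF _ C nb])
      show "V \<in> comps (cl (insert g W))" using * by simp
      show "verts_of G D \<subseteq> V" if "is_cycle G D" for D by (rule cycle_basic(4)[OF that])
    qed
    then have "crk (insert g W) = 1" using * k_cl[of "insert g W"] gE by simp
    then show False using crk_insert_W[OF out[OF g]] E1 by simp
  qed
  obtain g where g: "g \<in> between A B" using cross_edge[OF V d ne] by blast
  note gW = out[OF g]
  let ?H = "cl (insert g W)"
  have gE: "insert g W \<subseteq> E" using gW W_sub by auto
  have HE: "?H \<subseteq> E" using cl_subset[of "insert g W"] gE by simp
  have WH: "W \<subseteq> ?H" "g \<in> ?H" using closure_of_extensive[of "insert g W" M] by auto
  have HE': "?H \<noteq> E" using k_cl[of "insert g W"] gE crk_insert_W[OF gW] E1 by auto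
  show ?thesis
  proof (cases "between A B \<subseteq> ?H")
    case False
    then obtain h where h: "h \<in> between A B" "h \<notin> ?H" by blast
    note hW = out[OF h(1)]
    let ?H' = "cl (insert h W)"
    have hE: "insert h W \<subseteq> E" using hW W_sub by auto
    have H'E: "?H' \<subseteq> E" using cl_subset[of "insert h W"] hE by simp
    have WH': "W \<subseteq> ?H'" "h \<in> ?H'" using closure_of_extensive[of "insert h W" M] by auto
    have cover: "E \<subseteq> ?H \<union> ?H'" by (rule two_classes[OF gW hW h(2)])
    \<comment> \<open>An element of both hyperplanes outside \<open>W\<close> would be parallel to
      both \<open>g\<close> and \<open>h\<close>.\<close>
    have meet: "?H \<inter> ?H' \<subseteq> W"
    proof (rule subsetI, rule ccontr)
      fix e assume e: "e \<in> ?H \<inter> ?H'" "e \<notin> W"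
      have "cl (insert e W) = ?H" "cl (insert e W) = ?H'"
        using parallel[OF W_flat, of g e] parallel[OF W_flat, of h e] e gW hW by auto
      then show False using h(2) WH' by simp
    qed
    \<comment> \<open>Both hyperplanes are balanced, so an edge inside a part that belongs to one of
      them is already in \<open>W\<close>. Hence they add only crossing edges to \<open>W\<close>
      and divide these between them.\<close>
    have inn: "x \<in> W" if "x \<in> inner A \<union> inner B" "x \<in> ?H \<union> ?H'" for x
      using chord_in_W[OF AK(1) _ _ WH(1) H[OF g], of x] chord_in_W[OF AK(1) _ _ WH'(1) H[OF h(1)], of x]
        chord_in_W[OF AK(2) _ _ WH(1) H[OF g], of x] chord_in_W[OF AK(2) _ _ WH'(1) H[OF h(1)], of x] that
      by blast
    let ?X = "?H - W" and ?Y = "?H' - W"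
    have "between A B \<subseteq> ?X \<union> ?Y" using out cover by blast
    moreover have "?X \<union> ?Y \<subseteq> between A B" using inn edges_partition2[OF V] HE H'E by blast
    ultimately have "partition2 (between A B) ?X ?Y"
      unfolding partition2_def using WH WH' gW hW meet by blast
    moreover have "balancing_set G \<B> ?X"
      unfolding balancing_iff
    proof (intro conjI allI impI)
      show "C \<in> \<B>" if "is_cycle G C" "C \<subseteq> E - ?X" for C
        by (rule H[OF h(1) that(1)]) (use that(2) cover WH' in blast)
    qed (use HE unb in auto)
    moreover have "balancing_set G \<B> ?Y"
      unfolding balancing_iff
    proof (intro conjI allI impI)
      show "C \<in> \<B>" if "is_cycle G C" "C \<subseteq> E - ?Y" for C
        by (rule H[OF g that(1)]) (use that(2) cover WH in blast)
    qed (use H'E unb in auto)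
    ultimately have cond_ii unfolding cond_ii_def using p2(1) conn by blast
    then show ?thesis by simp
  next
    case True
    \<comment> \<open>All crossing edges are in one hyperplane, so its complement consists of edges
      inside the parts, and deleting it leaves the balanced hyperplane.\<close>
    let ?X = "E - ?H"
    have X: "?X \<subseteq> inner A \<union> inner B" using edges_partition2[OF V] True by blast
    have balX: "balancing_set G \<B> ?X"
      unfolding balancing_iff
    proof (intro conjI allI impI)
      show "C \<in> \<B>" if "is_cycle G C" "C \<subseteq> E - ?X" for C
        by (rule H[OF g that(1)]) (use that(2) in blast)
    qed (use unb in auto)
    have connX: "conn_in (inner A - ?X) A" "conn_in (inner B - ?X) B"
      by (rule comps_conn_inner[OF AK(1)] comps_conn_inner[OF AK(2)]; use W_sub WH in \<open>auto simp: inner_def\<close>)+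
    consider "?X \<subseteq> inner A" | "?X \<subseteq> inner B"
      | x y where "x \<in> ?X" "x \<in> inner A" "y \<in> ?X" "y \<in> inner B" using X by blast
    then show ?thesis
    proof cases
      case 1
      then have cond_iii unfolding cond_iii_def using p2(1) balX connX(1) conn(2) by blast
      then show ?thesis by simp
    next
      case 2
      then have cond_iii unfolding cond_iii_def using p2(2) balX connX(2) conn(1) by blast
      then show ?thesis by simp
    next
      case 3
      have xW: "x \<in> E - W" "y \<in> E - W" using 3 WH by auto
      \<comment> \<open>Elements outside the hyperplane of \<open>g\<close> are not parallel to
        \<open>g\<close>. As there are only two classes, \<open>x\<close> and \<open>y\<close> are
        parallel to each other although they lie in different parts, which is the situation of
        \<open>parallel_L\<close>.\<close>
      have gx: "g \<notin> cl (insert z W)" if "z \<in> E - W" "z \<notin> ?H" for z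
      proof
        assume "g \<in> cl (insert z W)"
        then have "cl (insert g W) = cl (insert z W)" using parallel[OF W_flat, of z g] that gW by auto
        then show False using that(2) closure_of_extensive[of "insert z W" M] by auto
      qed
      have "x \<noteq> y" using 3 inner_disjoint[OF d] by blast
      have "y \<in> cl (insert x W)"
        using two_classes[OF xW(1,2)] gx[OF xW(1)] gx[OF xW(2)] 3(1,3) gW by blast
      then have sy: "spans (insert x W) y" using in_cl_insert[of x y] xW \<open>x \<noteq> y\<close> by auto
      have "x \<in> cl (insert y W)"
        using two_classes[OF xW(2,1)] gx[OF xW(1)] gx[OF xW(2)] 3(1,3) gW by blast
      then have sx: "spans (insert y W) x" using in_cl_insert[of y x] xW \<open>x \<noteq> y\<close> by auto
      have "\<exists>Z\<in>\<L>. verts_of G Z \<subseteq> A"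
        by (rule parallel_L[OF c(1) d bal 3(2) _ 3(4) _ sy]) (use xW in auto)
      moreover have "\<exists>Z\<in>\<L>. verts_of G Z \<subseteq> B"
        by (rule parallel_L[OF _ _ bal 3(4) _ 3(2) _ sx]) (use xW c d in auto)
      ultimately have cond_iv unfolding cond_iv_def using p2(1) balX X connX by blast
      then show ?thesis by simp
    qed
  qed
qed

end

section \<open>Flats with a cycle in \<F>\<close>

context corank2_flat
begin

text \<open>\<open>B\<close> has no access to \<F>, and \<open>h\<close> keeps it that way: it joins
  two such sides or does not touch \<open>B\<close>. So \<open>e\<close>, which leaves
  \<open>B\<close>, could only be spanned by connecting its ends, and by \<open>he\<close> the edge
  \<open>h\<close> does not connect them.\<close>

lemma balanced_side_spans:
  assumes B: "B \<in> comps W" "\<And>u. u \<in> B \<Longrightarrow> \<not> hasF W u"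
    and h: "ends G h = {s, t}" "(s, t) \<notin> reach G W" "\<not> hasF W s \<and> \<not> hasF W t \<or> s \<notin> B \<and> t \<notin> B"
    and e: "ends G e = {b, c}" "b \<in> B" "c \<notin> B" and he: "s \<notin> B \<and> t \<notin> B \<or> c \<notin> {s, t} \<and> (s, c) \<notin> reach G W \<and> (t, c) \<notin> reach G W"
  shows "\<not> spans (insert h W) e"
proof
  assume sp: "spans (insert h W) e"
  have bc: "(b, c) \<notin> reach G W" using comps_reach[OF B(1) e(2), of c] e(3) by simp
  have r: "(b, c) \<notin> reach G (insert h W)"
    unfolding reach_insert[OF h(1)] using bc he comps_reach[OF B(1) e(2)] by blast
  have "\<not> hasF (insert h W) b"
    unfolding hasF_insert_bridge[OF h(1,2)] using B(2)[OF e(2)] h(3) comps_reach[OF B(1) e(2)] by blast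
  then show False using spans_reach[OF sp e(1)] r by blast
qed

text \<open>\<open>h\<close> is a bridge over \<open>W\<close>, also after adding the chord
  \<open>x\<close>, so a balanced cycle through \<open>x\<close> avoids it and \<open>x\<close> was
  spanned by \<open>W\<close> before. The other ways of being spanned are excluded: \<open>B\<close>
  remains without access to \<F>, and no cycle in \<L> arises.\<close>

lemma balanced_side_chord:
  assumes noL: "\<not> (\<exists>C\<in>\<L>. C \<subseteq> W)" and B: "B \<in> comps W" "\<And>u. u \<in> B \<Longrightarrow> \<not> hasF W u"
    and h: "ends G h = {s, t}" "(s, t) \<notin> reach G W" "\<not> hasF W s \<and> \<not> hasF W t \<or> s \<notin> B \<and> t \<notin> B"
    and x: "x \<in> inner B" and sp: "spans (insert h W) x"
  shows "x \<in> W"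
proof -
  have xE: "x \<in> E" "ends G x \<subseteq> B" using x unfolding inner_def by auto
  obtain u v where uv: "ends G x = {u, v}" using ends_cases[OF xE(1)] .
  have uB: "u \<in> B" "v \<in> B" using uv xE(2) by auto
  have nF: "\<not> hasF (insert h W) w" if "w \<in> B" for w
    unfolding hasF_insert_bridge[OF h(1,2)] using B(2)[OF that] h(3) comps_reach[OF B(1) that] by blast
  have old: "C \<subseteq> W" if "is_cycle G C" "C \<subseteq> insert h W" for C
    by (rule bridge_not_in_cycle[OF h(1,2) that])
  consider C where "C \<in> \<B>" "x \<in> C" "C \<subseteq> insert x (insert h W)" | Z where "Z \<in> \<L>" "Z \<subseteq> insert h W"
    | a b where "ends G x = {a, b}" "hasF (insert h W) a"
    using sp unfolding spans_def by blast
  then show ?thesis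
  proof cases
    case 1
    have cC: "is_cycle G C" using 1(1) cycle_class by simp
    have ruv: "(u, v) \<in> reach G W" using comps_reach[OF B(1) uB(1), of v] uB(2) by simp
    have "(s, t) \<notin> reach G (insert x W)"
      unfolding reach_insert[OF uv] using h(2) reach_trans[OF _ reach_trans[OF ruv], of s t]
        reach_trans[OF _ reach_trans[OF reach_sym[OF ruv]], of s t] by blast
    from bridge_not_in_cycle[OF h(1) this cC] have "C \<subseteq> insert x W"
      using 1(3) by (simp add: insert_commute)
    then have "spans W x" unfolding spans_def using 1 by blast
    then show ?thesis using flat_spans xE(1) by blast
  next
    case 2
    then show ?thesis using old[of Z] noL cycle_class by blast
  next
    case 3
    then show ?thesis using nF xE(2) by auto
  qed
qed

text \<open>\<open>A\<close> is adjacent to both \<open>B\<close> and \<open>C\<close>, and an edge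
  to \<open>B\<close> is not parallel to one to \<open>C\<close>, which gives the two hyperplanes.
  The one with the edges to \<open>B\<close> controls the cycles on \<open>A \<union> B\<close>, and
  the balancing set is chosen so that the cycles left are either of this kind or inside a tree in
  \<open>C\<close>, which is impossible.\<close>

lemma nec_iii':
  assumes noL: "\<not> (\<exists>C\<in>\<L>. C \<subseteq> W)" and F: "D0 \<in> \<F>" "verts_of G D0 \<subseteq> C" "D0 \<subseteq> W"
    and c: "A \<in> comps W" "B \<in> comps W" "C \<in> comps W"
    and p: "V = A \<union> B \<union> C" "A \<inter> B = {}" "A \<inter> C = {}" "B \<inter> C = {}"
    and nF: "\<And>u. u \<in> A \<union> B \<Longrightarrow> \<not> hasF W u" and CF: "\<And>u. u \<in> C \<Longrightarrow> hasF W u"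
    and BC: "between B C = {}"
  shows cond_iii'
proof -
  have ne: "A \<noteq> {}" "B \<noteq> {}" "C \<noteq> {}" using comps_nonempty c by auto
  have cD0: "is_cycle G D0" "D0 \<notin> \<B>" using F(1) cycle_class class_disjoint by auto
  have E1: "crk E = 1" using crk_E(2)[OF cD0] .
  have "between B (A \<union> C) \<noteq> {}" "between C (A \<union> B) \<noteq> {}" using p ne by (intro cross_edge; auto)+
  then have AB: "between A B \<noteq> {}" and "between A C \<noteq> {}"
    using BC between_comm[of B A] between_comm[of C A] between_comm[of C B] by (auto simp: between_Un)
  then obtain g h where g: "g \<in> between A B" and h: "h \<in> between A C" by blast
  obtain ga gb where g': "ends G g = {ga, gb}" "ga \<in> A" "gb \<in> B" using between_cases[OF g] .
  obtain ha hc where h': "ends G h = {ha, hc}" "ha \<in> A" "hc \<in> C" using between_cases[OF h] .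
  have gW: "g \<in> E - W" using between_outside[OF W_sub c(1) g] p by blast
  have hW: "h \<in> E - W" using between_outside[OF W_sub c(1) h] p by blast
  have rg: "(ga, gb) \<notin> reach G W" using comps_reach[OF c(1) g'(2), of gb] g'(3) p by blast
  have rh: "(ha, hc) \<notin> reach G W" using comps_reach[OF c(1) h'(2), of hc] h'(3) p by blast
  have hB: "ha \<notin> B \<and> hc \<notin> B" using h' p by blast
  have no_h: "\<not> spans (insert h W) e" if e: "e \<in> between A B" for e
  proof -
    obtain ea eb where e': "ends G e = {ea, eb}" "ea \<in> A" "eb \<in> B" using between_cases[OF e] .
    have "ends G e = {eb, ea}" using e'(1) by auto
    from balanced_side_spans[OF c(2) _ h'(1) rh _ this e'(3)] show ?thesis using nF hB e'(2) p(2) by blast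
  qed
  have "g \<noteq> h" using g' h' p by (auto simp: doubleton_eq_iff)
  then have gh: "g \<notin> cl (insert h W)" using in_cl_insert[of h g] gW hW no_h[OF g] by auto
  have cover: "E \<subseteq> cl (insert h W) \<union> cl (insert g W)" by (rule two_classes[OF hW gW gh])
  \<comment> \<open>Each edge inside \<open>B\<close> lies in one of the two hyperplanes, and in
    both cases it is a chord that \<open>W\<close> already spans. So the balancing set can avoid
    \<open>B\<close>.\<close>
  have innB: "inner B \<subseteq> W"
  proof (rule subsetI, rule ccontr)
    fix x assume x: "x \<in> inner B" "x \<notin> W"
    have "x \<in> E" using x(1) unfolding inner_def by auto
    moreover have "x \<noteq> g" "x \<noteq> h"
      using x(1) g h between_inner_disjoint[of A B B] between_inner_disjoint[of A B C] p by blast+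
    ultimately have "spans (insert h W) x \<or> spans (insert g W) x"
      using cover in_cl_insert[of h x] in_cl_insert[of g x] x(2) gW hW by blast
    moreover have "x \<in> W" if "spans (insert h W) x"
      by (rule balanced_side_chord[OF noL c(2) _ h'(1) rh _ x(1) that]) (use nF hB in auto)
    moreover have "x \<in> W" if "spans (insert g W) x"
      by (rule balanced_side_chord[OF noL c(2) _ g'(1) rg _ x(1) that]) (use nF g' in auto)
    ultimately show False using x(2) by blast
  qed
  let ?Y = "W \<union> between A B"
  have YE: "?Y \<subseteq> E" using W_sub between_subset[of A B] by auto
  have gE: "insert g W \<subseteq> E" using gW W_sub by auto
  have "between A B \<subseteq> cl (insert g W)"
  proof
    fix e assume e: "e \<in> between A B"
    have eW: "e \<in> E - W" using between_outside[OF W_sub c(1) e] p by blast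
    have "e \<noteq> h" using e h between_inner_Un[of A B] between_inner_disjoint[of A "A \<union> B" C] p by blast
    then have "e \<notin> cl (insert h W)" using in_cl_insert[of h e] eW hW no_h[OF e] by auto
    then show "e \<in> cl (insert g W)" using cover eW by blast
  qed
  then have "?Y \<subseteq> cl (insert g W)" using closure_of_extensive[of "insert g W" M] by blast
  then have "crk (cl (insert g W)) \<le> crk ?Y" using k_antimono[of ?Y "cl (insert g W)"] cl_subset[of "insert g W"] gE by simp
  then have Y2: "2 \<le> crk ?Y" using k_cl[of "insert g W"] gE crk_insert_W[OF gW] E1 by simp
  have cW: "conn_in W A" "conn_in W B" "conn_in W C" using comps_conn c by auto
  have YAB: "conn_in ?Y (A \<union> B)" using cW by (intro between_conn AB) (auto intro: conn_in_mono)
  have Ysub: "?Y \<subseteq> inner (A \<union> B) \<union> inner C"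
  proof -
    have "e \<in> inner (A \<union> B) \<union> inner C" if e: "e \<in> W" for e
    proof -
      have eE: "e \<in> E" using e W_sub by auto
      have "e \<notin> between A C" "e \<notin> between A B"
        using between_outside[OF W_sub c(1), of e A C] between_outside[OF W_sub c(1), of e A B] p e by auto
      then show ?thesis using edges_partition3[OF p(1) eE] BC inner_mono[of A "A \<union> B"] inner_mono[of B "A \<union> B"] by blast
    qed
    then show ?thesis using between_inner_Un[of A B] by blast
  qed
  have cY: "comps ?Y = {A \<union> B, C}"
    by (rule comps2(1)) (use p ne YAB Ysub cW(3) in \<open>auto intro: conn_in_mono\<close>)
  \<comment> \<open>An unbalanced cycle on \<open>A \<union> B\<close> misses \<open>D0\<close>, so
    it is in \<F>. Then every vertex would reach a cycle in \<F>, and the value of \<open>?Y\<close>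
    would be one, below that of the hyperplane containing it.\<close>
  have Ybal: "D \<in> \<B>" if D: "is_cycle G D" "D \<subseteq> ?Y" "verts_of G D \<subseteq> A \<union> B" for D
  proof (rule ccontr)
    assume "D \<notin> \<B>"
    moreover have "D \<notin> \<L>" using LF_meet[OF _ F(1), of D] F(2) D(3) p by blast
    ultimately have DF: "D \<in> \<F>" using D(1) cycle_class by blast
    obtain z where z: "z \<in> verts_of G D" using cycle_basic(5)[OF D(1)] by blast
    have "hasF ?Y u" if "u \<in> A \<union> B" for u
    proof -
      have "(u, z) \<in> reach G ?Y" using YAB that z D(3) unfolding conn_in_def by blast
      then show ?thesis unfolding hasF_def using DF D(2) z by blast
    qed
    moreover have "hasF ?Y u" if u: "u \<in> C" for u
    proof -
      obtain X x where "X \<in> \<F>" "X \<subseteq> W" "x \<in> verts_of G X" "(u, x) \<in> reach G W"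
        using CF[OF u] unfolding hasF_def by blast
      then show ?thesis unfolding hasF_def using reach_mono[of W ?Y u x G] by blast
    qed
    ultimately have "nonF ?Y = {}" unfolding nonF_def using p(1) by auto
    moreover have "\<not> lifted ?Y" unfolding lifted_def using DF D(2) by blast
    ultimately have "crk ?Y = 1" unfolding crk_def by simp
    then show False using Y2 by simp
  qed
  obtain T where T: "T \<subseteq> inner C" "conn_in T C" "\<And>D. is_cycle G D \<Longrightarrow> \<not> D \<subseteq> T"
    using spanning_tree[OF comps_conn_inner'[OF c(3)] inner_subset] by metis
  \<comment> \<open>Keeps the edges of \<open>W\<close> inside \<open>A\<close>, severs
    \<open>A\<close> from \<open>C\<close>, and leaves only a tree in \<open>C\<close>. A remaining
    cycle must therefore lie in \<open>?Y\<close> on the side of \<open>A \<union> B\<close>, while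
    \<open>A\<close> and \<open>C\<close> stay connected.\<close>
  let ?X = "(inner A - W) \<union> between A C \<union> (inner C - T)"
  have id: "inner A \<inter> inner B = {}" "inner A \<inter> inner C = {}" "inner B \<inter> inner C = {}"
    using inner_disjoint p(2-4) by auto
  have bd: "between A C \<inter> inner A = {}" "between A C \<inter> inner C = {}"
    using between_inner_disjoint[of A A C] between_inner_disjoint[of A C C] p(3) by auto
  have XE: "?X \<subseteq> E" using inner_subset between_subset by blast
  have "balancing_set G \<B> ?X"
    unfolding balancing_iff
  proof (intro conjI allI impI XE)
    show "\<exists>C. is_cycle G C \<and> C \<notin> \<B>" using cD0 by blast
    fix D assume D: "is_cycle G D" "D \<subseteq> E - ?X"
    have "E - ?X \<subseteq> ?Y \<union> T" using edges_partition3[OF p(1)] BC innB by blast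
    have EX: "E - ?X \<subseteq> inner (A \<union> B) \<union> inner C"
      using edges_partition3[OF p(1)] BC inner_mono[of A "A \<union> B"] inner_mono[of B "A \<union> B"] between_inner_Un[of A B] by blast
    have "verts_of G D \<subseteq> A \<union> B \<or> verts_of G D \<subseteq> C"
    proof -
      let ?Z = "inner (A \<union> B) \<union> inner C"
      have WZ: "W \<union> between A B \<subseteq> ?Z" by (rule Ysub)
      have "comps ?Z = {A \<union> B, C}"
        by (rule comps2(1)) (use p ne conn_in_mono[OF YAB WZ] conn_in_mono[OF cW(3), of ?Z] WZ in auto)
      then show ?thesis using cycle_in_comp[OF D(1), of ?Z] D(2) EX by blast
    qed
    then show "D \<in> \<B>"
    proof
      assume AB: "verts_of G D \<subseteq> A \<union> B"
      have "D \<subseteq> inner (A \<union> B)" by (rule cycle_inner[OF D(1) AB])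
      then have "D \<subseteq> ?Y" using D(2) \<open>E - ?X \<subseteq> ?Y \<union> T\<close> T(1) inner_disjoint[of "A \<union> B" C] p by blast
      then show ?thesis by (rule Ybal[OF D(1) _ AB])
    next
      assume "verts_of G D \<subseteq> C"
      then have "D \<subseteq> inner C" by (rule cycle_inner[OF D(1)])
      then have "D \<subseteq> T" using D(2) by blast
      then show ?thesis using T(3)[OF D(1)] by blast
    qed
  qed
  moreover have "?X \<subseteq> inner (A \<union> C)"
    using inner_mono[of A "A \<union> C"] inner_mono[of C "A \<union> C"] between_inner_Un[of A C] by blast
  moreover have "conn_in (inner A - ?X) A"
  proof (rule comps_conn_inner[OF c(1)])
    have "{e \<in> W. ends G e \<subseteq> A} \<subseteq> inner A \<inter> W" using W_sub unfolding inner_def by blast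
    then show "{e \<in> W. ends G e \<subseteq> A} \<subseteq> inner A - ?X" using id bd by blast
  qed
  moreover have "conn_in (inner C - ?X) C"
    by (rule conn_in_mono[OF T(2)]) (use T(1) id bd in blast)
  moreover have "conn_in (inner B) B" using comps_conn_inner'[OF c(2)] .
  moreover have "partition3 V A B C" unfolding partition3_def using p ne by simp
  ultimately show ?thesis unfolding cond_iii'_def using BC F(1,2) by blast
qed

text \<open>\<open>P\<close> stands for the deleted path: at most two pairs, any two of which share
  a vertex. The vertices with access to \<F> form one group beside the two counted components, and
  the properties of \<open>P\<close> show that this group is a single component.\<close>

lemma nec_F:
  assumes noL: "\<not> (\<exists>C\<in>\<L>. C \<subseteq> W)" and F: "D0 \<in> \<F>" "D0 \<subseteq> W"
    and P: "finite P" "card P \<le> 2" "\<And>p q. p \<in> P \<Longrightarrow> q \<in> P \<Longrightarrow> p \<inter> q \<noteq> {}"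
      "\<And>x y. x \<in> V \<Longrightarrow> y \<in> V \<Longrightarrow> x \<noteq> y \<Longrightarrow> {x, y} \<notin> P \<Longrightarrow> \<exists>e\<in>E. ends G e = {x, y}"
  shows "cond_iii' \<or> cond_v"
proof -
  have cD0: "is_cycle G D0" "D0 \<notin> \<B>" using F(1) cycle_class class_disjoint by auto
  have E1: "crk E = 1" using crk_E(2)[OF cD0] .
  have "\<not> lifted W" unfolding lifted_def using F by blast
  then have "card (nonF W) = 2" using crk_W E1 unfolding crk_def by simp
  then obtain A B where n: "nonF W = {A, B}" "A \<noteq> B" unfolding card_2_iff by blast
  have c: "A \<in> comps W" "B \<in> comps W" using n nonF_subset[of W] by auto
  have d: "A \<inter> B = {}" using comps_disjoint[OF c n(2)] .
  have ne: "A \<noteq> {}" "B \<noteq> {}" using comps_nonempty c by auto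
  let ?C = "V - A - B"
  have ABV: "A \<subseteq> V" "B \<subseteq> V" using comps_cover[OF W_sub] c by auto
  have p: "V = A \<union> B \<union> ?C" "A \<inter> ?C = {}" "B \<inter> ?C = {}" using ABV by auto
  have nF: "\<not> hasF W u" if u: "u \<in> A \<union> B" for u
  proof -
    obtain K where K: "K \<in> nonF W" "u \<in> K" using u n(1) by auto
    then obtain v where v: "K = comp W v" "\<not> hasF W v" unfolding nonF_def by blast
    then show ?thesis using hasF_reach_iff[of v u W] K(2) by simp
  qed
  have CF: "hasF W u" if u: "u \<in> ?C" for u
  proof (rule ccontr)
    assume "\<not> hasF W u"
    then have "comp W u \<in> nonF W" unfolding nonF_def using u by blast
    moreover have "u \<in> comp W u" by simp
    ultimately show False using n(1) u by blast
  qed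
  \<comment> \<open>Both ends reach cycles in \<F>, so such an edge is spanned and belongs to the
    flat. Different components of the group are therefore not adjacent.\<close>
  have not_both: "\<not> (\<exists>u v. e \<in> E \<and> ends G e = {u, v} \<and> u \<in> ?C \<and> v \<in> ?C \<and> e \<notin> W)" for e
  proof
    assume "\<exists>u v. e \<in> E \<and> ends G e = {u, v} \<and> u \<in> ?C \<and> v \<in> ?C \<and> e \<notin> W"
    then obtain u v where e: "e \<in> E" "ends G e = {u, v}" "u \<in> ?C" "v \<in> ?C" "e \<notin> W" by blast
    have "spans W e" unfolding spans_def using e(2) CF[OF e(3)] CF[OF e(4)] by blast
    then show False using flat_spans e(1,5) by blast
  qed
  have some_empty: "between A B = {} \<or> between A ?C = {} \<or> between B ?C = {}"
  proof (rule ccontr)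
    assume "\<not> ?thesis"
    then obtain g h j where g: "g \<in> between A B" and h: "h \<in> between A ?C" and j: "j \<in> between B ?C" by blast
    obtain ga gb where g': "ends G g = {ga, gb}" "ga \<in> A" "gb \<in> B" using between_cases[OF g] .
    obtain ha hc where h': "ends G h = {ha, hc}" "ha \<in> A" "hc \<in> ?C" using between_cases[OF h] .
    obtain jb jc where j': "ends G j = {jb, jc}" "jb \<in> B" "jc \<in> ?C" using between_cases[OF j] .
    have rg: "(ga, gb) \<notin> reach G W" using comps_reach[OF c(1) g'(2), of gb] g'(3) d by blast
    have rh: "(ha, hc) \<notin> reach G W" using comps_reach[OF c(1) h'(2), of hc] h'(3) by blast
    have far: "(x, y) \<notin> reach G W" if "x \<in> A \<union> B" "y \<in> ?C" for x y
      using that comps_reach[OF c(1), of x y] comps_reach[OF c(2), of x y] by blast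
    show False
    proof (rule no_three_classes[of g h j])
      show "g \<in> E - W" using between_outside[OF W_sub c(1) g] d by blast
      show "h \<in> E - W" using between_outside[OF W_sub c(1) h] by blast
      show "j \<in> E - W" using between_outside[OF W_sub c(2) j] by blast
      show "g \<noteq> h" "j \<noteq> g" "j \<noteq> h" using g' h' j' d by (auto simp: doubleton_eq_iff)
      show "\<not> spans (insert g W) h"
        by (rule balanced_side_spans[OF c(1) _ g'(1) rg _ h'(1,2)])
          (use nF g' h' far[of ga hc] far[of gb hc] in auto)
      show "\<not> spans (insert g W) j"
        by (rule balanced_side_spans[OF c(2) _ g'(1) rg _ j'(1,2)])
          (use nF g' j' far[of ga jc] far[of gb jc] in auto)
      show "\<not> spans (insert h W) j"
        by (rule balanced_side_spans[OF c(2) _ h'(1) rh _ j'(1,2)]) (use nF h' j' d in auto)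
    qed
  qed
  obtain K0 where K0: "K0 \<in> comps W" "verts_of G D0 \<subseteq> K0" using cycle_in_comp[OF cD0(1) F(2)] by blast
  obtain z where z: "z \<in> verts_of G D0" using cycle_basic(5)[OF cD0(1)] by blast
  have zF: "hasF W z" unfolding hasF_def using F z reach_refl[of z G W] by blast
  have zV: "z \<in> V" using z cycle_basic(4)[OF cD0(1)] by auto
  then have zC: "z \<in> ?C" using nF zF by blast
  have K0C: "K0 \<subseteq> ?C"
  proof
    fix w assume w: "w \<in> K0"
    have "(z, w) \<in> reach G W" using comps_reach[OF K0(1), of z w] z K0(2) w by blast
    then have "hasF W w" using zF hasF_reach_iff by blast
    then show "w \<in> ?C" using nF[of w] w K0(1) comps_cover[OF W_sub] by blast
  qed
  \<comment> \<open>Vertices \<open>z\<close>, \<open>w\<close> in different components of the group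
    form a missing pair. A vertex of a part not adjacent to the group would add two more missing
    pairs, one too many. So \<open>A\<close> and \<open>B\<close> are not adjacent, which gives a
    missing pair disjoint from \<open>{z, w}\<close>.\<close>
  have CK0: "?C \<subseteq> K0"
  proof (rule subsetI, rule ccontr)
    fix w assume w: "w \<in> ?C" "w \<notin> K0"
    have zw: "z \<noteq> w" using w z K0(2) by auto
    have nr: "(z, w) \<notin> reach G W" using comps_reach[OF K0(1), of z w] z K0(2) w(2) by blast
    have "{z, w} \<in> P"
    proof (rule ccontr)
      assume "{z, w} \<notin> P"
      then obtain e where e: "e \<in> E" "ends G e = {z, w}" using P(4)[of z w] zV w(1) zw by blast
      then have "e \<in> W" using not_both[of e] zC w(1) by blast
      then show False using reach_edge[OF _ e(2)] nr by blast
    qed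
    have miss: "{x, y} \<in> P" if h: "between S T = {}" "x \<in> S" "y \<in> T" "S \<subseteq> V" "T \<subseteq> V" "S \<inter> T = {}" for x y S T
    proof (rule ccontr)
      assume "{x, y} \<notin> P"
      then obtain e where "e \<in> E" "ends G e = {x, y}" using P(4)[of x y] h by blast
      then show False using h(1-3) unfolding edges_between_def by blast
    qed
    have tri: "between S ?C \<noteq> {}" if S: "S \<subseteq> V" "S \<inter> ?C = {}" "S \<noteq> {}" for S
    proof
      assume e: "between S ?C = {}"
      obtain a where a: "a \<in> S" using S(3) by blast
      have "{a, z} \<in> P" "{a, w} \<in> P" using miss[OF e a] zC w(1) S by blast+
      then have "{{z, w}, {a, z}, {a, w}} \<subseteq> P" using \<open>{z, w} \<in> P\<close> by blast
      then have "card {{z, w}, {a, z}, {a, w}} \<le> 2" using card_mono[OF P(1)] P(2) by (meson le_trans)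
      moreover have "a \<noteq> z" "a \<noteq> w" using a S(2) zC w(1) by blast+
      then have "card {{z, w}, {a, z}, {a, w}} = 3" using zw by (auto simp: doubleton_eq_iff)
      ultimately show False by simp
    qed
    have "between A B = {}" using some_empty tri[of A] tri[of B] ABV ne by blast
    moreover obtain a b where ab: "a \<in> A" "b \<in> B" using ne by blast
    ultimately have "{a, b} \<in> P" using miss[of A B a b] ABV d by blast
    then have "{z, w} \<inter> {a, b} \<noteq> {}" by (rule P(3)[OF \<open>{z, w} \<in> P\<close>])
    then show False using ab zC w(1) by blast
  qed
  have CK: "?C \<in> comps W" using K0C CK0 K0(1) by auto
  have D0C: "verts_of G D0 \<subseteq> ?C" using K0(2) K0C by blast
  have neC: "?C \<noteq> {}" using comps_nonempty[OF CK] .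
  from some_empty show ?thesis
  proof (elim disjE)
    assume "between A B = {}"
    moreover have "partition3 V A B ?C" unfolding partition3_def using p d ne neC by auto
    ultimately have cond_v
      unfolding cond_v_def using comps_conn_inner'[OF c(1)] comps_conn_inner'[OF c(2)]
        comps_conn_inner'[OF CK] F(1) D0C by blast
    then show ?thesis by simp
  next
    assume "between B ?C = {}"
    then have cond_iii' using nec_iii'[OF noL F(1) D0C F(2) c CK p(1) d p(2,3) nF CF] by blast
    then show ?thesis by simp
  next
    assume AC: "between A ?C = {}"
    have "V = B \<union> A \<union> ?C" "B \<inter> A = {}" using p(1) d by auto
    from nec_iii'[OF noL F(1) D0C F(2) c(2,1) CK this p(3,2) _ CF AC] nF have cond_iii' by blast
    then show ?thesis by simp
  qed
qed

end

section \<open>Assembling the equivalence\<close>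

context connected_qbg
begin

lemma necessary:
  assumes breakable
    and P: "finite P" "card P \<le> 2" "\<And>p q. p \<in> P \<Longrightarrow> q \<in> P \<Longrightarrow> p \<inter> q \<noteq> {}"
      "\<And>x y. x \<in> V \<Longrightarrow> y \<in> V \<Longrightarrow> x \<noteq> y \<Longrightarrow> {x, y} \<notin> P \<Longrightarrow> \<exists>e\<in>E. ends G e = {x, y}"
  shows "cond_i \<or> cond_ii \<or> cond_iii \<or> cond_iii' \<or> cond_iv \<or> cond_v"
proof -
  obtain W where "two_class W"
    using assms(1) disconnected_contraction_two_class unfolding breakable_def by metis
  then interpret corank2_flat G \<B> \<L> \<F> W by unfold_locales
  consider "(\<exists>Z\<in>\<L>. Z \<subseteq> W) \<or> (\<forall>Z. is_cycle G Z \<longrightarrow> Z \<in> \<B>)"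
    | C0 where "\<And>C. is_cycle G C \<Longrightarrow> C \<subseteq> W \<Longrightarrow> C \<in> \<B>" "is_cycle G C0" "C0 \<notin> \<B>"
    | D0 where "\<not> (\<exists>Z\<in>\<L>. Z \<subseteq> W)" "D0 \<in> \<F>" "D0 \<subseteq> W"
    using cycle_class by blast
  then show ?thesis
  proof cases
    case 1 then show ?thesis using nec_i by simp
  next
    case 2 then show ?thesis using nec_balanced[of C0] by blast
  next
    case 3
    have "cond_iii' \<or> cond_v" by (rule nec_F[OF 3 P])
    then show ?thesis by blast
  qed
qed

lemma class_subset: "\<L> \<subseteq> \<B> \<union> \<L> \<union> \<F>" "\<F> \<subseteq> \<B> \<union> \<L> \<union> \<F>" by auto

text \<open>\<open>conn_in\<close> holds for the empty set while \<open>connected_graph\<close>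
  demands a vertex, so the translation relies on the parts of a partition being nonempty, here and
  in the equivalences that follow.\<close>

lemma cond_i_iff:
  "cond_i \<longleftrightarrow> (\<exists>V1 V2 V3. partition3 (verts G) V1 V2 V3 \<and>
        connected_graph (induced G V1) \<and> connected_graph (induced G V2) \<and>
        connected_graph (induced G V3) \<and>
        edges_between G V1 V2 = {} \<and>
        ((\<exists>W\<in>{V1, V2, V3}. contains_cycle_in (induced G W) \<L>) \<or>
         (\<forall>C. is_cycle G C \<longrightarrow> C \<in> \<B>)))"
  unfolding cond_i_def
proof (intro ex_cong1 conj_cong refl)
  fix V1 V2 V3 assume "partition3 V V1 V2 V3"
  then have p: "V1 \<subseteq> V" "V2 \<subseteq> V" "V3 \<subseteq> V" "V1 \<noteq> {}" "V2 \<noteq> {}" "V3 \<noteq> {}"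
    unfolding partition3_def by auto
  show "conn_in (inner V1) V1 = connected_graph (induced G V1)"
    "conn_in (inner V2) V2 = connected_graph (induced G V2)"
    "conn_in (inner V3) V3 = connected_graph (induced G V3)"
    using p by (simp_all add: connected_induced conn_in_def)
  show "((\<exists>K\<in>{V1, V2, V3}. \<exists>Z\<in>\<L>. verts_of G Z \<subseteq> K) \<or> (\<forall>Z. is_cycle G Z \<longrightarrow> Z \<in> \<B>)) =
    ((\<exists>W\<in>{V1, V2, V3}. contains_cycle_in (induced G W) \<L>) \<or> (\<forall>C. is_cycle G C \<longrightarrow> C \<in> \<B>))"
    using p contains_cycle_induced[OF _ class_subset(1)] by simp
qed

lemma cond_ii_iff:
  "cond_ii \<longleftrightarrow> (\<exists>V1 V2. partition2 (verts G) V1 V2 \<and>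
        connected_graph (induced G V1) \<and> connected_graph (induced G V2) \<and>
        (\<exists>X Y. partition2 (edges_between G V1 V2) X Y \<and>
           balancing_set G \<B> X \<and> balancing_set G \<B> Y))"
  unfolding cond_ii_def
proof (intro ex_cong1 conj_cong refl)
  fix V1 V2 assume "partition2 V V1 V2"
  then have p: "V1 \<subseteq> V" "V2 \<subseteq> V" "V1 \<noteq> {}" "V2 \<noteq> {}"
    unfolding partition2_def by auto
  show "conn_in (inner V1) V1 = connected_graph (induced G V1)"
    "conn_in (inner V2) V2 = connected_graph (induced G V2)"
    using p by (simp_all add: connected_induced conn_in_def)
qed

lemma cond_iii_iff:
  "cond_iii \<longleftrightarrow> (\<exists>V1 V2 X. partition2 (verts G) V1 V2 \<and>
        balancing_set G \<B> X \<and> X \<subseteq> edges (induced G V1) \<and>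
        connected_graph (delete_edges (induced G V1) X) \<and>
        connected_graph (induced G V2))"
  unfolding cond_iii_def edges_induced
proof (intro ex_cong1 conj_cong refl)
  fix V1 V2 X assume "partition2 V V1 V2"
  then have p: "V1 \<subseteq> V" "V2 \<subseteq> V" "V1 \<noteq> {}" "V2 \<noteq> {}"
    unfolding partition2_def by auto
  show "conn_in (inner V1 - X) V1 = connected_graph (delete_edges (induced G V1) X)"
    "conn_in (inner V2) V2 = connected_graph (induced G V2)"
    using p by (simp_all add: connected_induced connected_induced_delete conn_in_def)
qed

lemma cond_iii'_iff:
  "cond_iii' \<longleftrightarrow> (\<exists>V1 V2 V3 X. partition3 (verts G) V1 V2 V3 \<and>
        balancing_set G \<B> X \<and> X \<subseteq> edges (induced G (V1 \<union> V3)) \<and>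
        connected_graph (delete_edges (induced G V1) X) \<and>
        connected_graph (induced G V2) \<and>
        connected_graph (delete_edges (induced G V3) X) \<and>
        contains_cycle_in (induced G V3) \<F> \<and>
        edges_between G V2 V3 = {})"
  unfolding cond_iii'_def edges_induced
proof (intro ex_cong1 conj_cong refl)
  fix V1 V2 V3 X assume "partition3 V V1 V2 V3"
  then have p: "V1 \<subseteq> V" "V2 \<subseteq> V" "V3 \<subseteq> V" "V1 \<noteq> {}" "V2 \<noteq> {}" "V3 \<noteq> {}"
    unfolding partition3_def by auto
  show "conn_in (inner V1 - X) V1 = connected_graph (delete_edges (induced G V1) X)"
    "conn_in (inner V2) V2 = connected_graph (induced G V2)"
    "conn_in (inner V3 - X) V3 = connected_graph (delete_edges (induced G V3) X)"
    using p by (simp_all add: connected_induced connected_induced_delete conn_in_def)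
  show "(\<exists>Z\<in>\<F>. verts_of G Z \<subseteq> V3) = contains_cycle_in (induced G V3) \<F>"
    using contains_cycle_induced[OF p(3) class_subset(2)] by simp
qed

lemma cond_iv_iff:
  "cond_iv \<longleftrightarrow> (\<exists>V1 V2 X. partition2 (verts G) V1 V2 \<and>
        balancing_set G \<B> X \<and> X \<subseteq> edges (induced G V1) \<union> edges (induced G V2) \<and>
        connected_graph (delete_edges (induced G V1) X) \<and>
        connected_graph (delete_edges (induced G V2) X) \<and>
        contains_cycle_in (induced G V1) \<L> \<and> contains_cycle_in (induced G V2) \<L>)"
  unfolding cond_iv_def edges_induced
proof (intro ex_cong1 conj_cong refl)
  fix V1 V2 X assume "partition2 V V1 V2"
  then have p: "V1 \<subseteq> V" "V2 \<subseteq> V" "V1 \<noteq> {}" "V2 \<noteq> {}"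
    unfolding partition2_def by auto
  show "conn_in (inner V1 - X) V1 = connected_graph (delete_edges (induced G V1) X)"
    "conn_in (inner V2 - X) V2 = connected_graph (delete_edges (induced G V2) X)"
    using p by (simp_all add: connected_induced_delete conn_in_def)
  show "(\<exists>Z\<in>\<L>. verts_of G Z \<subseteq> V1) = contains_cycle_in (induced G V1) \<L>"
    "(\<exists>Z\<in>\<L>. verts_of G Z \<subseteq> V2) = contains_cycle_in (induced G V2) \<L>"
    using p contains_cycle_induced[OF _ class_subset(1)] by simp_all
qed

lemma cond_v_iff:
  "cond_v \<longleftrightarrow> (\<exists>V1 V2 V3. partition3 (verts G) V1 V2 V3 \<and>
        connected_graph (induced G V1) \<and> connected_graph (induced G V2) \<and>
        connected_graph (induced G V3) \<and>
        edges_between G V1 V2 = {} \<and>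
        contains_cycle_in (induced G V3) \<F>)"
  unfolding cond_v_def
proof (intro ex_cong1 conj_cong refl)
  fix V1 V2 V3 assume "partition3 V V1 V2 V3"
  then have p: "V1 \<subseteq> V" "V2 \<subseteq> V" "V3 \<subseteq> V" "V1 \<noteq> {}" "V2 \<noteq> {}" "V3 \<noteq> {}"
    unfolding partition3_def by auto
  show "conn_in (inner V1) V1 = connected_graph (induced G V1)"
    "conn_in (inner V2) V2 = connected_graph (induced G V2)"
    "conn_in (inner V3) V3 = connected_graph (induced G V3)"
    using p by (simp_all add: connected_induced conn_in_def)
  show "(\<exists>Z\<in>\<F>. verts_of G Z \<subseteq> V3) = contains_cycle_in (induced G V3) \<F>"
    using contains_cycle_induced[OF p(3) class_subset(2)] by simp
qed

end

text \<open>Edges of \<open>complete_graph\<close> are their own sets of ends, so adjacent edges are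
  intersecting sets. In a path with two edges the middle vertex lies on both.\<close>

lemma short_path_edges:
  assumes "is_path (complete_graph U) u v P" "card P \<le> 2"
  shows "finite P" "\<And>p q. p \<in> P \<Longrightarrow> q \<in> P \<Longrightarrow> p \<inter> q \<noteq> {}"
proof -
  show "finite P" using is_path_basic(6)[OF assms(1)] .
  have "\<forall>p\<in>P. \<forall>q\<in>P. p \<inter> q \<noteq> {}"
    using assms
  proof (induction rule: is_path_induct)
    case (Nil u)
    then show ?case by simp
  next
    case (Cons u w v e P)
    have e: "e = {u, w}" using Cons.hyps(3) by (simp add: complete_graph_def)
    have "e \<notin> P" using ends_subset_verts_of[of e P "complete_graph U"] Cons.hyps(3,6) by auto
    then have c: "card P \<le> 1" using Cons.prems is_path_basic(6)[OF Cons.hyps(1)] by simp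
    have ne: "p \<noteq> {}" if "p \<in> P" for p
      using is_path_basic(10)[OF Cons.hyps(1) that] by (auto simp: complete_graph_def)
    have "p \<inter> q \<noteq> {}" if "p \<in> P" "q \<in> P" for p q
      using that c ne is_path_basic(6)[OF Cons.hyps(1)] card_le_Suc0_iff_eq[of P] by auto
    moreover have "e \<inter> p \<noteq> {}" if p: "p \<in> P" for p
    proof -
      \<comment> \<open>At most one edge remains after \<open>e\<close>; if there is one, it starts
        at the second vertex \<open>w\<close> and so meets \<open>e\<close>.\<close>
      have "w \<in> verts_of (complete_graph U) P"
      proof -
        have "w \<noteq> v"
        proof
          assume "w = v"
          then have "P = {}" using path_loop_empty Cons.hyps(1) by metis
          then show False using p by simp
        qed
        then show ?thesis using is_path_basic(8)[OF Cons.hyps(1)] by auto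
      qed
      then obtain q where "q \<in> P" "w \<in> q" by (auto simp: verts_of_def complete_graph_def)
      moreover have "q = p" using c p \<open>q \<in> P\<close> is_path_basic(6)[OF Cons.hyps(1)] card_le_Suc0_iff_eq[of P] by auto
      ultimately show ?thesis using e by auto
    qed
    ultimately show ?case using e by (auto simp: Int_commute)
  qed
  then show "\<And>p q. p \<in> P \<Longrightarrow> q \<in> P \<Longrightarrow> p \<inter> q \<noteq> {}" by blast
qed

lemma simplification_edge:
  assumes "simplification G = delete_edges (complete_graph (verts G)) P"
    "x \<in> verts G" "y \<in> verts G" "x \<noteq> y" "{x, y} \<notin> P"
  shows "\<exists>e\<in>edges G. ends G e = {x, y}"
proof -
  have "{x, y} \<in> edges (delete_edges (complete_graph (verts G)) P)"
    using assms(2-5) unfolding delete_edges_def complete_graph_def by auto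
  then have "{x, y} \<in> edges (simplification G)" using assms(1) by simp
  then show ?thesis unfolding simplification_def by auto
qed

text \<open>Two vertices have two further vertices as possible common neighbours, and at most two pairs
  are missing.\<close>

lemma near_complete_connected:
  assumes "finite P" "card P \<le> 2" "card (verts G) > 3"
    and edge: "\<And>x y. x \<in> verts G \<Longrightarrow> y \<in> verts G \<Longrightarrow> x \<noteq> y \<Longrightarrow> {x, y} \<notin> P \<Longrightarrow> \<exists>e\<in>edges G. ends G e = {x, y}"
    and x: "x \<in> verts G" and y: "y \<in> verts G"
  shows "(x, y) \<in> reach G (edges G)"
proof (rule ccontr)
  assume n: "(x, y) \<notin> reach G (edges G)"
  have adj: "(a, b) \<in> reach G (edges G)" if "a \<in> verts G" "b \<in> verts G" "{a, b} \<notin> P" for a b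
    using edge[OF that(1,2) _ that(3)] reach_edge[of _ "edges G" G a b] reach_refl[of a G "edges G"]
    by (cases "a = b") auto
  have xy: "x \<noteq> y" using n by auto
  have fin: "finite (verts G)" using assms(3) card.infinite by fastforce
  have "card (verts G - {x, y}) \<ge> 2"
    using assms(3) x y xy fin by (simp add: card_Diff_subset)
  then obtain S where S: "S \<subseteq> verts G - {x, y}" "card S = 2" using obtain_subset_with_card_n by metis
  then obtain a b where "S = {a, b}" "a \<noteq> b" unfolding card_2_iff by blast
  then have ab: "a \<in> verts G - {x, y}" "b \<in> verts G - {x, y}" "a \<noteq> b" using S(1) by auto
  \<comment> \<open>Neither of the two further vertices \<open>a\<close>, \<open>b\<close> can be a
    common neighbour, and each failure costs a missing pair; together with \<open>{x, y}\<close>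
    these are three.\<close>
  have one: "{x, z} \<in> P \<or> {z, y} \<in> P" if "z \<in> verts G" for z
    using adj[OF x that] adj[OF that y] reach_trans[of x z G "edges G" y] n by blast
  obtain p where p: "p \<in> P" "p = {x, a} \<or> p = {a, y}" using one[of a] ab(1) by auto
  obtain q where q: "q \<in> P" "q = {x, b} \<or> q = {b, y}" using one[of b] ab(2) by auto
  have ne: "p \<noteq> {x, y}" "q \<noteq> {x, y}" "p \<noteq> q" using p(2) q(2) ab by (auto simp: doubleton_eq_iff)
  have "{x, y} \<in> P" using adj[OF x y] n by blast
  then have "{{x, y}, p, q} \<subseteq> P" using p q by auto
  then have "card {{x, y}, p, q} \<le> 2" using card_mono[OF assms(1)] assms(2) by (meson le_trans)
  moreover have "card {{x, y}, p, q} = 3" using ne by auto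
  ultimately show False by simp
qed

theorem theorem6p3:
  fixes G :: "('v, 'e) mgraph" and \<B> \<L> \<F> :: "'e set set" and M :: "'e matroid"
  assumes "quasi_biased_graph G \<B> \<L> \<F>"
    and "\<exists>u v P. is_path (complete_graph (verts G)) u v P \<and> card P \<le> 2 \<and>
           simplification G = delete_edges (complete_graph (verts G)) P"
    and "card (verts G) > 3"
    and "M = qb_matroid G \<B> \<L> \<F>"
    and "connected_matroid M"
  shows "\<not> unbreakable M \<longleftrightarrow>
    (\<comment> \<open>(i)\<close>
     (\<exists>V1 V2 V3. partition3 (verts G) V1 V2 V3 \<and>
        connected_graph (induced G V1) \<and> connected_graph (induced G V2) \<and>
        connected_graph (induced G V3) \<and>
        edges_between G V1 V2 = {} \<and>
        ((\<exists>W\<in>{V1, V2, V3}. contains_cycle_in (induced G W) \<L>) \<or>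
         (\<forall>C. is_cycle G C \<longrightarrow> C \<in> \<B>)))
   \<or> \<comment> \<open>(ii)\<close>
     (\<exists>V1 V2. partition2 (verts G) V1 V2 \<and>
        connected_graph (induced G V1) \<and> connected_graph (induced G V2) \<and>
        (\<exists>X Y. partition2 (edges_between G V1 V2) X Y \<and>
           balancing_set G \<B> X \<and> balancing_set G \<B> Y))
   \<or> \<comment> \<open>(iii)\<close>
     (\<exists>V1 V2 X. partition2 (verts G) V1 V2 \<and>
        balancing_set G \<B> X \<and> X \<subseteq> edges (induced G V1) \<and>
        connected_graph (delete_edges (induced G V1) X) \<and>
        connected_graph (induced G V2))
   \<or> \<comment> \<open>(iii)'\<close>
     (\<exists>V1 V2 V3 X. partition3 (verts G) V1 V2 V3 \<and>
        balancing_set G \<B> X \<and> X \<subseteq> edges (induced G (V1 \<union> V3)) \<and>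
        connected_graph (delete_edges (induced G V1) X) \<and>
        connected_graph (induced G V2) \<and>
        connected_graph (delete_edges (induced G V3) X) \<and>
        contains_cycle_in (induced G V3) \<F> \<and>
        edges_between G V2 V3 = {})
   \<or> \<comment> \<open>(iv)\<close>
     (\<exists>V1 V2 X. partition2 (verts G) V1 V2 \<and>
        balancing_set G \<B> X \<and> X \<subseteq> edges (induced G V1) \<union> edges (induced G V2) \<and>
        connected_graph (delete_edges (induced G V1) X) \<and>
        connected_graph (delete_edges (induced G V2) X) \<and>
        contains_cycle_in (induced G V1) \<L> \<and> contains_cycle_in (induced G V2) \<L>)
   \<or> \<comment> \<open>(v)\<close>
     (\<exists>V1 V2 V3. partition3 (verts G) V1 V2 V3 \<and>
        connected_graph (induced G V1) \<and> connected_graph (induced G V2) \<and>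
        connected_graph (induced G V3) \<and>
        edges_between G V1 V2 = {} \<and>
        contains_cycle_in (induced G V3) \<F>))"
proof -
  obtain u v P where P: "is_path (complete_graph (verts G)) u v P" "card P \<le> 2"
    "simplification G = delete_edges (complete_graph (verts G)) P"
    using assms(2) by blast
  note fin = short_path_edges[OF P(1,2)] and edge = simplification_edge[OF P(3)]
  interpret connected_qbg G \<B> \<L> \<F>
  proof
    show "quasi_biased_graph G \<B> \<L> \<F>" by fact
    then interpret qbg G \<B> \<L> \<F> by unfold_locales
    show "conn_in (edges G) (verts G)"
      unfolding conn_in_def using near_complete_connected[OF fin(1) P(2) assms(3) edge] by blast
    show "verts G \<noteq> {}" using assms(3) by auto
  qed
  have "\<not> unbreakable M \<longleftrightarrow> breakable"
    using not_unbreakable_iff assms(4,5) unfolding breakable_def by simp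
  also have "\<dots> \<longleftrightarrow> cond_i \<or> cond_ii \<or> cond_iii \<or> cond_iii' \<or> cond_iv \<or> cond_v"
    using sufficient necessary[OF _ fin(1) P(2) fin(2) edge] by blast
  finally show ?thesis
    unfolding cond_i_iff cond_ii_iff cond_iii_iff cond_iii'_iff cond_iv_iff cond_v_iff .
qed

end
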